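(* Let $(M,g)$ with $g\in\mathcal{C}^{1,1}$ be a globally hyperbolic spacetime and let $\Sigma\subset M$ be an acausal, spacelike, future causally complete (smooth) hypersurface. Then the future cut locus $\mathrm{Cut}^+(\Sigma)\subset M$ has measure zero.
   Context: $M$ is a connected, Hausdorff, second countable smooth manifold of dimension $n\ge2$ with a time-oriented Lorentzian metric $g$. $\mathcal{C}^{1,1}$ means differentiable with locally Lipschitz first derivatives (so geodesics with given initial data exist locally and are unique). A causal (timelike) curve is a locally Lipschitz map $\gamma$ from an interval to $M$ with $\dot\gamma\neq0$ and $g(\dot\gamma,\dot\gamma)\le0$ ($<0$) almost everywhere; future directed if $\dot\gamma$ is future pointing almost everywhere. $I^\pm,J^\pm$ are the timelike and causal futures/pasts. $(M,g)$ is globally hyperbolic if it is causal and all $J^+(p)\cap J^-(q)$ are compact. $L(\gamma)=\int\sqrt{|g(\dot\gamma,\dot\gamma)|}\,dt$; $\tau(p,q)$ is the supremum of $L(\gamma)$ over future directed causal curves from $p$ to $q$ (and $0$ if there are none); $\tau_\Sigma(p)=\sup_{q\in\Sigma}\tau(q,p)$. $\Sigma$ is acausal if no causal curve meets it more than once; future causally complete if for every $p\in J^+(\Sigma)$ the set $J^-(p)\cap\Sigma$ has compact closure in $\Sigma$. $S^+N\Sigma$ is the set of future pointing vectors $v\in TM|_\Sigma$ normal to $\Sigma$ with $g(v,v)=-1$. $\gamma_v$ is the maximal geodesic with $\dot\gamma_v(0)=v$, and $\mathcal{D}\subset S^+N\Sigma\times\mathbb{R}$ is the set of $(v,t)$ such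 that $\gamma_v(t)$ is defined. The cut function is $s_\Sigma^+:S^+N\Sigma\to\overline{\mathbb{R}}$, $s_\Sigma^+(v)=\sup\{t>0:(v,t)\in\mathcal{D},\ \tau_\Sigma(\gamma_v(t))=L(\gamma_v|_{[0,t]})\}$. The tangential future cut locus is $\mathrm{Cut}_T^+(\Sigma)=\{s_\Sigma^+(v)v:\ v\in S^+N\Sigma,\ (v,s_\Sigma^+(v))\in\mathcal{D}\}\subset N\Sigma$ and $\mathrm{Cut}^+(\Sigma)=\exp^N(\mathrm{Cut}_T^+(\Sigma))$, where $\exp^N$ is the normal exponential map, i.e. $\mathrm{Cut}^+(\Sigma)$ is the set of points $\gamma_v(s_\Sigma^+(v))$ for such $v$. Measure zero is with respect to the volume measure of $g$ (equivalently Lebesgue measure in charts). *)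

theory Defs
  imports "HOL-Analysis.Analysis"
begin

section \<open>Differentiability classes on open subsets of a normed space\<close>

text \<open>In finite dimension, continuity (resp. local Lipschitz continuity) of the derivative is the
  same as that of all directional derivatives. All sets \<open>S\<close> below are open where these notions
  are used, except that \<open>locally_lipschitz_on\<close> is also applied to relatively open subsets of
  intervals.\<close>

primrec Ck_on :: "nat \<Rightarrow> ('a::real_normed_vector \<Rightarrow> 'b::real_normed_vector) \<Rightarrow> 'a set \<Rightarrow> bool" where
  "Ck_on 0 f S \<longleftrightarrow> continuous_on S f"
| "Ck_on (Suc k) f S \<longleftrightarrow>
     (\<forall>x\<in>S. f differentiable (at x)) \<and> (\<forall>v. Ck_on k (\<lambda>x. frechet_derivative f (at x) v) S)"

definition smooth_on :: "('a::real_normed_vector \<Rightarrow> 'b::real_normed_vector) \<Rightarrow> 'a set \<Rightarrow> bool" where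
  "smooth_on f S \<longleftrightarrow> (\<forall>k. Ck_on k f S)"

definition locally_lipschitz_on :: "('a::metric_space \<Rightarrow> 'b::metric_space) \<Rightarrow> 'a set \<Rightarrow> bool" where
  "locally_lipschitz_on f S \<longleftrightarrow> (\<forall>x\<in>S. \<exists>r>0. \<exists>L. L-lipschitz_on (cball x r \<inter> S) f)"

definition C11_on :: "('a::real_normed_vector \<Rightarrow> 'b::real_normed_vector) \<Rightarrow> 'a set \<Rightarrow> bool" where
  "C11_on f S \<longleftrightarrow> (\<forall>x\<in>S. f differentiable (at x)) \<and>
     (\<forall>v. locally_lipschitz_on (\<lambda>x. frechet_derivative f (at x) v) S)"

section \<open>Smooth manifolds\<close>

text \<open>The manifold is the whole type \<open>'m\<close>; the Hausdorff and second countability axioms are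
  carried by type classes. It is modelled on the Euclidean space \<open>'e\<close>, so its dimension is
  \<open>DIM('e)\<close>. Only the values of \<open>chart_map c\<close> on \<open>chart_dom c\<close> matter.\<close>

datatype ('m, 'e) chart = Chart (chart_dom: "'m set") (chart_map: "'m \<Rightarrow> 'e")

definition chart_img :: "('m, 'e) chart \<Rightarrow> 'e set" where
  "chart_img c = chart_map c ` chart_dom c"

definition chart_inv :: "('m, 'e) chart \<Rightarrow> 'e \<Rightarrow> 'm" where
  "chart_inv c = inv_into (chart_dom c) (chart_map c)"

definition is_chart :: "('m::topological_space, 'e::euclidean_space) chart \<Rightarrow> bool" where
  "is_chart c \<longleftrightarrow> open (chart_dom c) \<and> open (chart_img c) \<and>
     homeomorphism (chart_dom c) (chart_img c) (chart_map c) (chart_inv c)"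

definition transition :: "('m, 'e) chart \<Rightarrow> ('m, 'e) chart \<Rightarrow> 'e \<Rightarrow> 'e" where
  "transition c d = chart_map d \<circ> chart_inv c"

definition smoothly_compatible :: "('m, 'e::euclidean_space) chart \<Rightarrow> ('m, 'e) chart \<Rightarrow> bool" where
  "smoothly_compatible c d \<longleftrightarrow>
     smooth_on (transition c d) (chart_map c ` (chart_dom c \<inter> chart_dom d)) \<and>
     smooth_on (transition d c) (chart_map d ` (chart_dom c \<inter> chart_dom d))"

text \<open>A smooth structure is a maximal smooth atlas.\<close>

definition smooth_structure :: "('m::topological_space, 'e::euclidean_space) chart set \<Rightarrow> bool" where
  "smooth_structure A \<longleftrightarrow>
     (\<forall>c\<in>A. is_chart c) \<and> (\<Union>c\<in>A. chart_dom c) = UNIV \<and>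
     (\<forall>c\<in>A. \<forall>d\<in>A. smoothly_compatible c d) \<and>
     (\<forall>c. is_chart c \<and> (\<forall>d\<in>A. smoothly_compatible c d) \<longrightarrow> c \<in> A)"

section \<open>Tangent vectors\<close>

text \<open>A tangent vector at \<open>p\<close> is the family of its coordinate representations in all charts
  around \<open>p\<close>, related by the Jacobians of the transition maps; the family is normalised to vanish
  on all other charts. Linear operations are pointwise and the zero vector is \<open>\<lambda>_. 0\<close>.\<close>

type_synonym ('m, 'e) tvec = "('m, 'e) chart \<Rightarrow> 'e"

definition charts_at :: "('m, 'e) chart set \<Rightarrow> 'm \<Rightarrow> ('m, 'e) chart set" where
  "charts_at A p = {c \<in> A. p \<in> chart_dom c}"

definition tangent_space :: "('m, 'e::euclidean_space) chart set \<Rightarrow> 'm \<Rightarrow> ('m, 'e) tvec set" where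
  "tangent_space A p =
     {v. (\<forall>c\<in>charts_at A p. \<forall>d\<in>charts_at A p.
            v d = frechet_derivative (transition c d) (at (chart_map c p)) (v c)) \<and>
         (\<forall>c. c \<notin> charts_at A p \<longrightarrow> v c = 0)}"

text \<open>The tangent vector at \<open>p\<close> with coordinates \<open>u\<close> in the chart \<open>c\<close>.\<close>

definition tvec_of :: "('m, 'e::euclidean_space) chart set \<Rightarrow> ('m, 'e) chart \<Rightarrow> 'm \<Rightarrow> 'e \<Rightarrow> ('m, 'e) tvec" where
  "tvec_of A c p u =
     (\<lambda>d. if d \<in> charts_at A p
          then frechet_derivative (transition c d) (at (chart_map c p)) u else 0)"

definition tscale :: "real \<Rightarrow> ('m, 'e::euclidean_space) tvec \<Rightarrow> ('m, 'e) tvec" where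
  "tscale a v = (\<lambda>c. a *\<^sub>R v c)"

definition has_velocity :: "('m, 'e::euclidean_space) chart set \<Rightarrow> (real \<Rightarrow> 'm) \<Rightarrow> real \<Rightarrow> ('m, 'e) tvec \<Rightarrow> bool" where
  "has_velocity A \<gamma> t v \<longleftrightarrow> v \<in> tangent_space A (\<gamma> t) \<and>
     (\<forall>c\<in>charts_at A (\<gamma> t). ((chart_map c \<circ> \<gamma>) has_vector_derivative v c) (at t))"

definition velocity :: "('m, 'e::euclidean_space) chart set \<Rightarrow> (real \<Rightarrow> 'm) \<Rightarrow> real \<Rightarrow> ('m, 'e) tvec" where
  "velocity A \<gamma> t = (THE v. has_velocity A \<gamma> t v)"

section \<open>Time-oriented Lorentzian manifolds\<close>

text \<open>The time orientation is given by a continuous timelike vector field \<open>time_field\<close>. The values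
  of \<open>metric M p\<close> outside the tangent space at \<open>p\<close> are irrelevant.\<close>

record ('m, 'e) spacetime =
  atlas :: "('m, 'e) chart set"
  metric :: "'m \<Rightarrow> ('m, 'e) tvec \<Rightarrow> ('m, 'e) tvec \<Rightarrow> real"
  time_field :: "'m \<Rightarrow> ('m, 'e) tvec"

text \<open>The coordinate expression of the metric: \<open>metric_in M c x u v\<close> is $g_{ij}(x) u^i v^j$.\<close>

definition metric_in :: "('m, 'e::euclidean_space) spacetime \<Rightarrow> ('m, 'e) chart \<Rightarrow> 'e \<Rightarrow> 'e \<Rightarrow> 'e \<Rightarrow> real" where
  "metric_in M c x u v =
     (let p = chart_inv c x in metric M p (tvec_of (atlas M) c p u) (tvec_of (atlas M) c p v))"

text \<open>Signature $(-,+,\dots,+)$: \<open>L\<close> maps the standard basis of \<open>'e\<close> to a frame in which the form is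
  diagonal with entry $-1$ at \<open>e0\<close> and $+1$ elsewhere.\<close>

definition lorentzian_form :: "('e::euclidean_space \<Rightarrow> 'e \<Rightarrow> real) \<Rightarrow> bool" where
  "lorentzian_form B \<longleftrightarrow> bilinear B \<and> (\<forall>u v. B u v = B v u) \<and>
     (\<exists>L :: 'e \<Rightarrow> 'e. \<exists>e0\<in>Basis. linear L \<and> bij L \<and>
        (\<forall>a\<in>Basis. \<forall>b\<in>Basis. B (L a) (L b) = (if a \<noteq> b then 0 else if a = e0 then -1 else 1)))"

definition lorentzian_metric :: "('m, 'e::euclidean_space) spacetime \<Rightarrow> bool" where
  "lorentzian_metric M \<longleftrightarrow> (\<forall>c\<in>atlas M. \<forall>x\<in>chart_img c. lorentzian_form (metric_in M c x))"

definition C11_metric :: "('m, 'e::euclidean_space) spacetime \<Rightarrow> bool" where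
  "C11_metric M \<longleftrightarrow> (\<forall>c\<in>atlas M. \<forall>u v. C11_on (\<lambda>x. metric_in M c x u v) (chart_img c))"

definition time_oriented :: "('m, 'e::euclidean_space) spacetime \<Rightarrow> bool" where
  "time_oriented M \<longleftrightarrow>
     (\<forall>p. time_field M p \<in> tangent_space (atlas M) p \<and>
          metric M p (time_field M p) (time_field M p) < 0) \<and>
     (\<forall>c\<in>atlas M. continuous_on (chart_img c) (\<lambda>x. time_field M (chart_inv c x) c))"

definition causal_vector :: "('m, 'e::euclidean_space) spacetime \<Rightarrow> 'm \<Rightarrow> ('m, 'e) tvec \<Rightarrow> bool" where
  "causal_vector M p v \<longleftrightarrow> v \<in> tangent_space (atlas M) p \<and> v \<noteq> (\<lambda>_. 0) \<and> metric M p v v \<le> 0"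

definition future_pointing :: "('m, 'e::euclidean_space) spacetime \<Rightarrow> 'm \<Rightarrow> ('m, 'e) tvec \<Rightarrow> bool" where
  "future_pointing M p v \<longleftrightarrow> causal_vector M p v \<and> metric M p (time_field M p) v < 0"

section \<open>Causality\<close>

definition locally_lipschitz_curve ::
    "('m::topological_space, 'e::euclidean_space) spacetime \<Rightarrow> real set \<Rightarrow> (real \<Rightarrow> 'm) \<Rightarrow> bool" where
  "locally_lipschitz_curve M I \<gamma> \<longleftrightarrow> continuous_on I \<gamma> \<and>
     (\<forall>c\<in>atlas M. locally_lipschitz_on (chart_map c \<circ> \<gamma>) (I \<inter> \<gamma> -` chart_dom c))"

text \<open>Intervals of parameters are non-degenerate, since otherwise the almost everywhere conditions
  would be void.\<close>

definition fd_causal_curve ::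
    "('m::topological_space, 'e::euclidean_space) spacetime \<Rightarrow> real set \<Rightarrow> (real \<Rightarrow> 'm) \<Rightarrow> bool" where
  "fd_causal_curve M I \<gamma> \<longleftrightarrow> is_interval I \<and> interior I \<noteq> {} \<and> locally_lipschitz_curve M I \<gamma> \<and>
     (AE t\<in>I in lebesgue. \<exists>v. has_velocity (atlas M) \<gamma> t v \<and> future_pointing M (\<gamma> t) v)"

definition fd_causal_curve_from_to ::
    "('m::topological_space, 'e::euclidean_space) spacetime \<Rightarrow> real \<Rightarrow> real \<Rightarrow> (real \<Rightarrow> 'm) \<Rightarrow> 'm \<Rightarrow> 'm \<Rightarrow> bool" where
  "fd_causal_curve_from_to M a b \<gamma> p q \<longleftrightarrow>
     a < b \<and> fd_causal_curve M {a..b} \<gamma> \<and> \<gamma> a = p \<and> \<gamma> b = q"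

definition causal_future ::
    "('m::topological_space, 'e::euclidean_space) spacetime \<Rightarrow> 'm \<Rightarrow> 'm set" where
  "causal_future M p = {q. q = p \<or> (\<exists>a b \<gamma>. fd_causal_curve_from_to M a b \<gamma> p q)}"

definition causal_past ::
    "('m::topological_space, 'e::euclidean_space) spacetime \<Rightarrow> 'm \<Rightarrow> 'm set" where
  "causal_past M q = {p. p = q \<or> (\<exists>a b \<gamma>. fd_causal_curve_from_to M a b \<gamma> p q)}"

definition causal_spacetime :: "('m::topological_space, 'e::euclidean_space) spacetime \<Rightarrow> bool" where
  "causal_spacetime M \<longleftrightarrow> \<not> (\<exists>a b \<gamma> p. fd_causal_curve_from_to M a b \<gamma> p p)"

definition globally_hyperbolic :: "('m::topological_space, 'e::euclidean_space) spacetime \<Rightarrow> bool" where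
  "globally_hyperbolic M \<longleftrightarrow>
     causal_spacetime M \<and> (\<forall>p q. compact (causal_future M p \<inter> causal_past M q))"

text \<open>On the null set where the velocity does not exist the integrand is unspecified. For the
  curves considered the integrand is bounded and Lebesgue measurable.\<close>

definition curve_length :: "('m, 'e::euclidean_space) spacetime \<Rightarrow> real \<Rightarrow> real \<Rightarrow> (real \<Rightarrow> 'm) \<Rightarrow> real" where
  "curve_length M a b \<gamma> =
     (LINT t:{a..b}|lebesgue.
        sqrt \<bar>metric M (\<gamma> t) (velocity (atlas M) \<gamma> t) (velocity (atlas M) \<gamma> t)\<bar>)"

text \<open>In \<open>ennreal\<close> the supremum of the empty set is \<open>0\<close>.\<close>

definition time_separation ::
    "('m::topological_space, 'e::euclidean_space) spacetime \<Rightarrow> 'm \<Rightarrow> 'm \<Rightarrow> ennreal" where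
  "time_separation M p q =
     Sup {ennreal (curve_length M a b \<gamma>) | a b \<gamma>. fd_causal_curve_from_to M a b \<gamma> p q}"

definition time_separation_from ::
    "('m::topological_space, 'e::euclidean_space) spacetime \<Rightarrow> 'm set \<Rightarrow> 'm \<Rightarrow> ennreal" where
  "time_separation_from M S p = (SUP q\<in>S. time_separation M q p)"

section \<open>Hypersurfaces\<close>

definition adapted_chart ::
    "('m, 'e::euclidean_space) spacetime \<Rightarrow> 'm set \<Rightarrow> 'm \<Rightarrow> ('m, 'e) chart \<Rightarrow> 'e \<Rightarrow> bool" where
  "adapted_chart M S p c b \<longleftrightarrow> c \<in> charts_at (atlas M) p \<and> b \<in> Basis \<and>
     chart_map c ` (chart_dom c \<inter> S) = {x \<in> chart_img c. x \<bullet> b = 0}"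

definition smooth_hypersurface :: "('m, 'e::euclidean_space) spacetime \<Rightarrow> 'm set \<Rightarrow> bool" where
  "smooth_hypersurface M S \<longleftrightarrow> (\<forall>p\<in>S. \<exists>c b. adapted_chart M S p c b)"

definition hypersurface_tangent ::
    "('m, 'e::euclidean_space) spacetime \<Rightarrow> 'm set \<Rightarrow> 'm \<Rightarrow> ('m, 'e) tvec set" where
  "hypersurface_tangent M S p =
     {v \<in> tangent_space (atlas M) p. \<exists>c b. adapted_chart M S p c b \<and> v c \<bullet> b = 0}"

definition spacelike :: "('m, 'e::euclidean_space) spacetime \<Rightarrow> 'm set \<Rightarrow> bool" where
  "spacelike M S \<longleftrightarrow>
     (\<forall>p\<in>S. \<forall>v\<in>hypersurface_tangent M S p. v \<noteq> (\<lambda>_. 0) \<longrightarrow> metric M p v v > 0)"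

text \<open>Past directed curves are covered by reversing the parameter.\<close>

definition acausal :: "('m::topological_space, 'e::euclidean_space) spacetime \<Rightarrow> 'm set \<Rightarrow> bool" where
  "acausal M S \<longleftrightarrow> (\<forall>I \<gamma>. fd_causal_curve M I \<gamma> \<longrightarrow>
     (\<forall>s\<in>I. \<forall>t\<in>I. \<gamma> s \<in> S \<and> \<gamma> t \<in> S \<longrightarrow> s = t))"

text \<open>\<open>S \<inter> closure X\<close> is the closure of \<open>X\<close> in the subspace \<open>S\<close>.\<close>

definition future_causally_complete ::
    "('m::topological_space, 'e::euclidean_space) spacetime \<Rightarrow> 'm set \<Rightarrow> bool" where
  "future_causally_complete M S \<longleftrightarrow>
     (\<forall>p \<in> (\<Union>q\<in>S. causal_future M q). compact (S \<inter> closure (causal_past M p \<inter> S)))"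

section \<open>Geodesics\<close>

text \<open>The Christoffel symbols of the Levi-Civita connection in the chart \<open>c\<close>, as the vector
  $\Gamma^k_{ij}(x) u^i v^j$, given by the Koszul formula.\<close>

definition christoffel ::
    "('m, 'e::euclidean_space) spacetime \<Rightarrow> ('m, 'e) chart \<Rightarrow> 'e \<Rightarrow> 'e \<Rightarrow> 'e \<Rightarrow> 'e" where
  "christoffel M c x u v =
     (THE z. \<forall>w. metric_in M c x z w =
        (frechet_derivative (\<lambda>y. metric_in M c y v w) (at x) u
         + frechet_derivative (\<lambda>y. metric_in M c y u w) (at x) v
         - frechet_derivative (\<lambda>y. metric_in M c y u v) (at x) w) / 2)"

definition geodesic ::
    "('m::topological_space, 'e::euclidean_space) spacetime \<Rightarrow> real set \<Rightarrow> (real \<Rightarrow> 'm) \<Rightarrow> bool" where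
  "geodesic M I \<gamma> \<longleftrightarrow> open I \<and> is_interval I \<and> continuous_on I \<gamma> \<and>
     (\<forall>t\<in>I. \<forall>c\<in>charts_at (atlas M) (\<gamma> t).
        let x = chart_map c \<circ> \<gamma>; x' = (\<lambda>s. vector_derivative x (at s)) in
        x differentiable (at t) \<and>
        (x' has_vector_derivative - christoffel M c (x t) (x' t) (x' t)) (at t))"

definition geodesic_with_init ::
    "('m::topological_space, 'e::euclidean_space) spacetime \<Rightarrow> 'm \<times> ('m, 'e) tvec \<Rightarrow> real set \<Rightarrow> (real \<Rightarrow> 'm) \<Rightarrow> bool" where
  "geodesic_with_init M v I \<gamma> \<longleftrightarrow>
     geodesic M I \<gamma> \<and> 0 \<in> I \<and> \<gamma> 0 = fst v \<and> has_velocity (atlas M) \<gamma> 0 (snd v)"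

text \<open>The maximal geodesic with initial velocity \<open>v\<close> is the union of all geodesics with initial
  velocity \<open>v\<close>. The definite description is justified by uniqueness of geodesics.\<close>

definition geodesic_domain ::
    "('m::topological_space, 'e::euclidean_space) spacetime \<Rightarrow> 'm \<times> ('m, 'e) tvec \<Rightarrow> real set" where
  "geodesic_domain M v = \<Union>{I. \<exists>\<gamma>. geodesic_with_init M v I \<gamma>}"

definition max_geodesic ::
    "('m::topological_space, 'e::euclidean_space) spacetime \<Rightarrow> 'm \<times> ('m, 'e) tvec \<Rightarrow> real \<Rightarrow> 'm" where
  "max_geodesic M v t = (THE q. \<exists>I \<gamma>. geodesic_with_init M v I \<gamma> \<and> t \<in> I \<and> \<gamma> t = q)"

section \<open>The future cut locus of a hypersurface\<close>

definition normal_bundle ::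
    "('m, 'e::euclidean_space) spacetime \<Rightarrow> 'm set \<Rightarrow> ('m \<times> ('m, 'e) tvec) set" where
  "normal_bundle M S = {(p, v). p \<in> S \<and> v \<in> tangent_space (atlas M) p \<and>
     (\<forall>w\<in>hypersurface_tangent M S p. metric M p v w = 0)}"

definition future_unit_normals ::
    "('m, 'e::euclidean_space) spacetime \<Rightarrow> 'm set \<Rightarrow> ('m \<times> ('m, 'e) tvec) set" where
  "future_unit_normals M S =
     {(p, v) \<in> normal_bundle M S. future_pointing M p v \<and> metric M p v v = -1}"

definition cut_function ::
    "('m::topological_space, 'e::euclidean_space) spacetime \<Rightarrow> 'm set \<Rightarrow> 'm \<times> ('m, 'e) tvec \<Rightarrow> ereal" where
  "cut_function M S v =
     Sup {ereal t | t. t > 0 \<and> t \<in> geodesic_domain M v \<and>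
        time_separation_from M S (max_geodesic M v t) =
          ennreal (curve_length M 0 t (max_geodesic M v))}"

definition tangential_cut_locus ::
    "('m::topological_space, 'e::euclidean_space) spacetime \<Rightarrow> 'm set \<Rightarrow> ('m \<times> ('m, 'e) tvec) set" where
  "tangential_cut_locus M S =
     {(p, tscale t v) | p v t. (p, v) \<in> future_unit_normals M S \<and>
        cut_function M S (p, v) = ereal t \<and> t \<in> geodesic_domain M (p, v)}"

definition exp_map ::
    "('m::topological_space, 'e::euclidean_space) spacetime \<Rightarrow> 'm \<times> ('m, 'e) tvec \<Rightarrow> 'm" where
  "exp_map M v = max_geodesic M v 1"

definition future_cut_locus ::
    "('m::topological_space, 'e::euclidean_space) spacetime \<Rightarrow> 'm set \<Rightarrow> 'm set" where
  "future_cut_locus M S = exp_map M ` tangential_cut_locus M S"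

definition measure_zero :: "('m, 'e::euclidean_space) spacetime \<Rightarrow> 'm set \<Rightarrow> bool" where
  "measure_zero M N \<longleftrightarrow> (\<forall>c\<in>atlas M. negligible (chart_map c ` (chart_dom c \<inter> N)))"

end

theory Submission
  imports Defs
begin

text \<open>
  The argument is local and avoids the normal exponential map. Let \<open>u\<close> be the time separation from
  \<open>S\<close>, read in a chart, and let \<open>z\<close> be a unit speed geodesic that realises \<open>u\<close>. Displacing the end
  points of short pieces of \<open>z\<close> and comparing lengths through the first variation formula shows that
  at every interior point of \<open>z\<close> the function \<open>u\<close> is touched from below and from above by quadratic
  functions with uniform constants and with the same linear part \<open>- g(z', \<cdot>)\<close>. Hence on the set of
  such points the direction of the maximal geodesic is unique and a Lipschitz function of the point,
  and flowing along these geodesics for a fixed time is Lipschitz by Gronwall's inequality.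

  A cut point is reached by flowing for time \<open>d\<close> from a point whose remaining time to the cut point
  is exactly \<open>d\<close>. The remaining time is a measurable function on a bounded set, because its
  superlevel sets are closed; so for all but countably many \<open>d\<close> its level set is negligible, and so
  is the Lipschitz image of that level set.
\<close>

section \<open>Gronwall's inequality and elementary estimates\<close>

text \<open>For \<open>g\<close> of class C11 the curvature exists only almost everywhere, so Jacobi
  fields and the second variation are not at hand pointwise. A length expansion whose remainder is
  bounded by a multiple of the squared displacement asks only for Lipschitz first derivatives of
  \<open>g\<close>.

  Touching from above relies on a piece of maximal geodesic beyond the point. Past a cut point there
  is none, which is why the argument steps back by a time \<open>d\<close>. All steps back have the
  same length, so that a single map defined on a single null set catches every cut point of the
  piece under consideration.

  The constants depend on the room before and after the point, on a bound for the coordinate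
  velocity and on a compact neighbourhood. The cut set is therefore exhausted by countably many
  pieces on which these data are fixed. The time separation is \<open>ennreal\<close> valued; that
  it is finite near a maximal geodesic is a by-product of touching from above.\<close>

lemma nondecreasing_within:
  fixes f :: "real \<Rightarrow> real"
  assumes "a \<le> b"
    and der: "\<And>r. r \<in> {a..b} \<Longrightarrow> (f has_real_derivative f' r) (at r within {a..b})"
    and nonneg: "\<And>r. r \<in> {a..b} \<Longrightarrow> 0 \<le> f' r"
  shows "f a \<le> f b"
proof (rule DERIV_nonneg_imp_increasing_open[OF \<open>a \<le> b\<close>])
  show "continuous_on {a..b} f"
    using der by (rule DERIV_continuous_on)
  fix r assume r: "a < r" "r < b"
  then have "at r within {a..b} = at r"
    by (intro at_within_interior) simp
  with der[of r] nonneg[of r] r show "\<exists>y. (f has_real_derivative y) (at r) \<and> 0 \<le> y"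
    by (metis atLeastAtMost_iff less_imp_le)
qed

lemma nonincreasing_within:
  fixes f :: "real \<Rightarrow> real"
  assumes "a \<le> b"
    and der: "\<And>r. r \<in> {a..b} \<Longrightarrow> (f has_real_derivative f' r) (at r within {a..b})"
    and nonpos: "\<And>r. r \<in> {a..b} \<Longrightarrow> f' r \<le> 0"
  shows "f b \<le> f a"
proof -
  have "- f a \<le> - f b"
    by (rule nondecreasing_within[of a b "\<lambda>r. - f r" "\<lambda>r. - f' r"])
      (use assms in \<open>auto intro!: derivative_intros\<close>)
  then show ?thesis by simp
qed

text \<open>By Cauchy-Schwarz \<open>w \<bullet> w\<close> times \<open>exp (- 2 * L * r)\<close>
  does not increase, and times \<open>exp (2 * L * r)\<close> it does not decrease. Working with the
  square avoids differentiating the norm at zeros of \<open>w\<close>. The second estimate compares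
  geodesics backwards in the parameter.\<close>

lemma gronwall:
  fixes w :: "real \<Rightarrow> 'a::real_inner"
  assumes "a \<le> b"
    and der: "\<And>r. r \<in> {a..b} \<Longrightarrow> (w has_vector_derivative w' r) (at r within {a..b})"
    and bound: "\<And>r. r \<in> {a..b} \<Longrightarrow> norm (w' r) \<le> L * norm (w r)"
    and s: "a \<le> s" "s \<le> t" "t \<le> b"
  shows "norm (w t) \<le> exp (L * (t - s)) * norm (w s)"
    and "norm (w s) \<le> exp (L * (t - s)) * norm (w t)"
proof -
  have ip: "\<bar>w r \<bullet> w' r\<bar> \<le> L * (w r \<bullet> w r)" if "r \<in> {a..b}" for r
  proof -
    have "\<bar>w r \<bullet> w' r\<bar> \<le> norm (w r) * norm (w' r)"
      by (rule Cauchy_Schwarz_ineq2)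
    also have "\<dots> \<le> norm (w r) * (L * norm (w r))"
      using bound[OF that] by (intro mult_left_mono) auto
    also have "\<dots> = L * (w r \<bullet> w r)"
      by (metis mult.left_commute power2_eq_square power2_norm_eq_inner)
    finally show ?thesis .
  qed
  have derf: "((\<lambda>r. (w r \<bullet> w r) * exp (2 * c * r)) has_real_derivative
      (2 * (w r \<bullet> w' r) + 2 * c * (w r \<bullet> w r)) * exp (2 * c * r)) (at r within {s..t})"
    if "r \<in> {s..t}" for r c
  proof -
    have "((\<lambda>r. w r \<bullet> w r) has_real_derivative 2 * (w r \<bullet> w' r)) (at r within {a..b})"
    proof -
      have "((\<lambda>r. w r \<bullet> w r) has_vector_derivative (w r \<bullet> w' r + w' r \<bullet> w r)) (at r within {a..b})"
        using bounded_bilinear.has_vector_derivative[OF bounded_bilinear_inner der der] that s by auto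
      then show ?thesis
        by (simp add: has_real_derivative_iff_has_vector_derivative inner_commute)
    qed
    then have "((\<lambda>r. w r \<bullet> w r) has_real_derivative 2 * (w r \<bullet> w' r)) (at r within {s..t})"
      by (rule DERIV_subset) (use s in auto)
    moreover have "((\<lambda>r. exp (2 * c * r)) has_real_derivative 2 * c * exp (2 * c * r)) (at r within {s..t})"
      by (auto intro!: derivative_eq_intros)
    ultimately have "((\<lambda>r. (w r \<bullet> w r) * exp (2 * c * r)) has_real_derivative
       2 * (w r \<bullet> w' r) * exp (2 * c * r) + (2 * c * exp (2 * c * r)) * (w r \<bullet> w r)) (at r within {s..t})"
      by (rule DERIV_mult)
    then show ?thesis
      by (rule back_subst[of "\<lambda>D. (_ has_real_derivative D) _"]) (simp add: algebra_simps)
  qed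
  have sq: "norm x \<le> exp (L * (t - s)) * norm y"
    if "(x \<bullet> x) * exp (2 * c) \<le> (y \<bullet> y) * exp (2 * d)" "d - c = L * (t - s)" for x y :: 'a and c d
  proof -
    have "(norm x)\<^sup>2 \<le> (y \<bullet> y) * exp (2 * d) / exp (2 * c)"
      using that(1) by (simp add: power2_norm_eq_inner field_simps)
    also have "\<dots> = (norm y)\<^sup>2 * exp (2 * (L * (t - s)))"
      unfolding that(2)[symmetric] by (simp add: power2_norm_eq_inner exp_diff right_diff_distrib)
    also have "\<dots> = (exp (L * (t - s)) * norm y)\<^sup>2"
      by (simp only: power_mult_distrib exp_double mult.commute)
    finally show ?thesis
      by (rule power2_le_imp_le) simp
  qed
  have "(w t \<bullet> w t) * exp (2 * (- L) * t) \<le> (w s \<bullet> w s) * exp (2 * (- L) * s)"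
  proof (rule nonincreasing_within[OF \<open>s \<le> t\<close> derf])
    fix r assume "r \<in> {s..t}"
    then show "(2 * (w r \<bullet> w' r) + 2 * (- L) * (w r \<bullet> w r)) * exp (2 * (- L) * r) \<le> 0"
      using ip[of r] s by (intro mult_nonpos_nonneg) auto
  qed auto
  then show "norm (w t) \<le> exp (L * (t - s)) * norm (w s)"
    by (intro sq[of _ "- L * t" _ "- L * s"]) (auto simp: algebra_simps)
  have "(w s \<bullet> w s) * exp (2 * L * s) \<le> (w t \<bullet> w t) * exp (2 * L * t)"
  proof (rule nondecreasing_within[OF \<open>s \<le> t\<close> derf])
    fix r assume "r \<in> {s..t}"
    then show "0 \<le> (2 * (w r \<bullet> w' r) + 2 * L * (w r \<bullet> w r)) * exp (2 * L * r)"
      using ip[of r] s by (intro mult_nonneg_nonneg) auto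
  qed auto
  then show "norm (w s) \<le> exp (L * (t - s)) * norm (w t)"
    by (intro sq[of _ "L * s" _ "L * t"]) (auto simp: algebra_simps)
qed


section \<open>Lipschitz constants on compact sets, expansions in a basis, a square root
  bound\<close>

lemma locally_lipschitz_on_compact:
  assumes "locally_lipschitz_on f U" "compact K" "K \<subseteq> U"
  obtains L where "L-lipschitz_on K f"
proof -
  \<comment> \<open>\<open>local_lipschitz\<close> speaks of time dependent families;
    \<open>f\<close> is read as a family over the single time 0, which brings in the compactness
    argument.\<close>
  have ll: "local_lipschitz {0::real} K (\<lambda>_. f)"
    unfolding local_lipschitz_def
  proof (intro ballI)
    fix x t assume "x \<in> K" "t \<in> {0::real}"
    with assms obtain r L where "r > 0" "L-lipschitz_on (cball x r \<inter> U) f"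
      unfolding locally_lipschitz_on_def by blast
    then have "L-lipschitz_on (cball x r \<inter> K) f"
      by (rule_tac lipschitz_on_subset) (use assms(3) in auto)
    with \<open>r > 0\<close> show "\<exists>u>0. \<exists>L. \<forall>t\<in>cball t u \<inter> {0}. L-lipschitz_on (cball x u \<inter> K) f"
      by blast
  qed
  have "compact {0::real}"
    by simp
  then obtain L where "\<And>t. t \<in> {0::real} \<Longrightarrow> L-lipschitz_on K f"
    using local_lipschitz_compact_implies_lipschitz[OF ll assms(2)] continuous_on_const by blast
  then show ?thesis
    using that by blast
qed

lemma locally_lipschitz_on_imp_continuous_on:
  assumes "locally_lipschitz_on f U" "open U"
  shows "continuous_on U f"
proof -
  have "isCont f x" if x: "x \<in> U" for x
  proof -
    obtain r L where r: "r > 0" "L-lipschitz_on (cball x r \<inter> U) f"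
      using assms(1) x unfolding locally_lipschitz_on_def by blast
    have "continuous_on (cball x r \<inter> U) f"
      by (rule lipschitz_on_continuous_on[OF r(2)])
    then have "continuous_on (ball x r \<inter> U) f"
      by (rule continuous_on_subset) auto
    moreover have "open (ball x r \<inter> U)" "x \<in> ball x r \<inter> U"
      using assms(2) that r(1) by auto
    ultimately show ?thesis
      by (simp add: continuous_on_eq_continuous_at)
  qed
  then show ?thesis
    by (simp add: continuous_at_imp_continuous_on)
qed

lemma bilinear_expand:
  fixes B :: "'e::euclidean_space \<Rightarrow> 'e \<Rightarrow> real"
  assumes "bilinear B"
  shows "B u v = (\<Sum>i\<in>Basis. \<Sum>j\<in>Basis. (u \<bullet> i) * (v \<bullet> j) * B i j)"
proof -
  have l1: "linear (\<lambda>x. B x v)" and l2: "linear (B x)" for v x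
    using assms by (auto simp: bilinear_def)
  have "B u v = B (\<Sum>i\<in>Basis. (u \<bullet> i) *\<^sub>R i) (\<Sum>j\<in>Basis. (v \<bullet> j) *\<^sub>R j)"
    by (simp add: euclidean_representation)
  also have "\<dots> = (\<Sum>i\<in>Basis. (u \<bullet> i) * B i (\<Sum>j\<in>Basis. (v \<bullet> j) *\<^sub>R j))"
    using linear_sum[OF l1, of "\<lambda>i. (u \<bullet> i) *\<^sub>R i" Basis] linear_cmul[OF l1] by simp
  also have "\<dots> = (\<Sum>i\<in>Basis. (u \<bullet> i) * (\<Sum>j\<in>Basis. (v \<bullet> j) * B i j))"
    using linear_sum[OF l2, of _ "\<lambda>i. (v \<bullet> i) *\<^sub>R i" Basis] linear_cmul[OF l2] by simp
  finally show ?thesis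
    by (simp add: sum_distrib_left mult.assoc)
qed

lemma bilinear_sum_bound:
  fixes A :: "'e::euclidean_space \<Rightarrow> 'e \<Rightarrow> real" and B :: real
  assumes "\<And>i j. i \<in> Basis \<Longrightarrow> j \<in> Basis \<Longrightarrow> \<bar>A i j\<bar> \<le> B"
  shows "\<bar>\<Sum>i\<in>Basis. \<Sum>j\<in>Basis. (u \<bullet> i) * (v \<bullet> j) * A i j\<bar> \<le> (DIM('e))\<^sup>2 * B * norm u * norm v"
proof -
  have "\<bar>(u \<bullet> i) * (v \<bullet> j) * A i j\<bar> \<le> norm u * norm v * B" if "i \<in> Basis" "j \<in> Basis" for i j
    using that assms[OF that] by (auto simp: abs_mult intro!: mult_mono Basis_le_norm)
  then have "\<bar>\<Sum>i\<in>Basis. \<Sum>j\<in>Basis. (u \<bullet> i) * (v \<bullet> j) * A i j\<bar>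
      \<le> (\<Sum>i\<in>(Basis::'e set). \<Sum>j\<in>(Basis::'e set). norm u * norm v * B)"
    by (intro order.trans[OF sum_abs] sum_mono) auto
  then show ?thesis
    by (simp add: power2_eq_square mult_ac)
qed

lemma linear_sum_bound:
  fixes A :: "'e::euclidean_space \<Rightarrow> real" and B :: real
  assumes "linear A" "\<And>i. i \<in> Basis \<Longrightarrow> \<bar>A i\<bar> \<le> B"
  shows "\<bar>A k\<bar> \<le> DIM('e) * B * norm k"
proof -
  have "A k = A (\<Sum>i\<in>Basis. (k \<bullet> i) *\<^sub>R i)"
    by (simp add: euclidean_representation)
  also have "\<dots> = (\<Sum>i\<in>Basis. (k \<bullet> i) * A i)"
    using linear_sum[OF assms(1), of "\<lambda>i. (k \<bullet> i) *\<^sub>R i" Basis] linear_cmul[OF assms(1)] by simp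
  finally have "\<bar>A k\<bar> \<le> (\<Sum>i\<in>Basis. \<bar>(k \<bullet> i) * A i\<bar>)"
    by (simp add: sum_abs)
  also have "\<dots> \<le> (\<Sum>i\<in>(Basis::'e set). norm k * B)"
    by (intro sum_mono) (auto simp: abs_mult intro!: mult_mono Basis_le_norm assms(2))
  finally show ?thesis by (simp add: mult_ac)
qed

text \<open>The left side factors as (1 - x)(2 + x)/2, so after squaring the claim is (2 + x)^2 (1 -
  x) \<le> 4, that is x^2 (x + 3) \<ge> 0. With \<open>1 - x\<close> the negative of a perturbed
  squared speed, this bounds the speed from below up to a quadratic error.\<close>

lemma sqrt_one_minus_ge:
  fixes x :: real
  assumes "x \<le> 1"
  shows "1 - x / 2 - x\<^sup>2 / 2 \<le> sqrt (1 - x)"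
proof (cases "1 - x / 2 - x\<^sup>2 / 2 \<le> 0")
  case True
  then show ?thesis using assms by (intro order.trans[OF True]) simp
next
  case False
  have "(x + 2) * (1 - x) > 0"
    using False by (simp add: algebra_simps power2_eq_square)
  then have "-2 < x"
    using assms by (simp add: zero_less_mult_iff)
  have "1 - x / 2 - x\<^sup>2 / 2 = (1 - x) * (x + 2) / 2"
    by (simp add: field_simps power2_eq_square)
  then have "4 * (1 - x / 2 - x\<^sup>2 / 2)\<^sup>2 = (1 - x) * ((x + 2)\<^sup>2 * (1 - x))"
    by (simp only:) (simp add: power2_eq_square)
  moreover have "(x + 2)\<^sup>2 * (1 - x) \<le> 4"
  proof -
    have "4 - (x + 2)\<^sup>2 * (1 - x) = x\<^sup>2 * (x + 3)"
      by (simp add: algebra_simps power2_eq_square)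
    moreover have "0 \<le> x\<^sup>2 * (x + 3)"
      using \<open>-2 < x\<close> by (intro mult_nonneg_nonneg) auto
    ultimately show ?thesis by linarith
  qed
  ultimately have "(1 - x / 2 - x\<^sup>2 / 2)\<^sup>2 \<le> 1 - x"
    using assms mult_left_mono[of "(x + 2)\<^sup>2 * (1 - x)" 4 "1 - x"] by simp
  then show ?thesis
    by (rule real_le_rsqrt)
qed

section \<open>Lorentzian forms and metrics in a chart\<close>

lemma lorentzian_form_frame:
  fixes B :: "'e::euclidean_space \<Rightarrow> 'e \<Rightarrow> real"
  assumes "lorentzian_form B"
  obtains L :: "'e \<Rightarrow> 'e" and e0 where "linear L" "bij L" "e0 \<in> Basis"
    "\<And>a b. a \<in> Basis \<Longrightarrow> b \<in> Basis \<Longrightarrow> B (L a) (L b) = (if a \<noteq> b then 0 else if a = e0 then -1 else 1)"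
proof -
  from assms obtain L :: "'e \<Rightarrow> 'e" and e0 where "linear L" "bij L" "e0 \<in> Basis"
    "\<forall>a\<in>Basis. \<forall>b\<in>Basis. B (L a) (L b) = (if a \<noteq> b then 0 else if a = e0 then -1 else 1)"
    unfolding lorentzian_form_def by (elim conjE exE bexE)
  then show ?thesis
    by (intro that[of L e0]) simp_all
qed

text \<open>Pairing with \<open>L b\<close> for a basis vector \<open>b\<close> returns the
  coordinate of \<open>z\<close> along \<open>L b\<close> up to sign, so every coordinate
  vanishes.\<close>

lemma lorentzian_form_nondegenerate:
  fixes B :: "'e::euclidean_space \<Rightarrow> 'e \<Rightarrow> real"
  assumes "lorentzian_form B" "\<And>w. B z w = 0"
  shows "z = 0"
proof -
  obtain L :: "'e \<Rightarrow> 'e" and e0 where L: "linear L" "bij L" and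
    BL: "\<And>a b. a \<in> Basis \<Longrightarrow> b \<in> Basis \<Longrightarrow> B (L a) (L b) = (if a \<noteq> b then 0 else if a = e0 then -1 else 1)"
    using assms(1) by (rule lorentzian_form_frame) blast
  have bil: "bilinear B"
    using assms(1) by (simp add: lorentzian_form_def)
  have lin: "linear (\<lambda>x. B x v)" for v
    using bil by (auto simp: bilinear_def)
  obtain y where y: "z = L y"
    using \<open>bij L\<close> by (metis bij_pointE)
  have yb: "y \<bullet> b = 0" if b: "b \<in> Basis" for b
  proof -
    have lc: "linear (\<lambda>x. B (L x) (L b))"
      using linear_compose[OF L(1) lin[of "L b"]] by (simp add: o_def)
    have "0 = B (L y) (L b)"
      using assms(2) y by simp
    also have "\<dots> = B (L (\<Sum>i\<in>Basis. (y \<bullet> i) *\<^sub>R i)) (L b)"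
      by (simp add: euclidean_representation)
    also have "\<dots> = (\<Sum>i\<in>Basis. (y \<bullet> i) * B (L i) (L b))"
      using linear_sum[OF lc, of "\<lambda>i. (y \<bullet> i) *\<^sub>R i" Basis] linear_cmul[OF lc] by simp
    also have "\<dots> = (\<Sum>i\<in>Basis. if i = b then (y \<bullet> b) * (if b = e0 then -1 else 1) else 0)"
      using b BL by (intro sum.cong) auto
    also have "\<dots> = (y \<bullet> b) * (if b = e0 then -1 else 1)"
      using b by (simp add: sum.delta')
    finally show ?thesis
      by (auto split: if_splits)
  qed
  have "y = 0"
    by (rule euclidean_eqI) (simp add: yb)
  then show ?thesis
    using y L(1) by (simp add: linear_0)
qed

text \<open>If \<open>B a b = 0\<close>, then \<open>B\<close> would be negative definite on the span of \<open>a\<close> and \<open>b\<close>,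
  which contains a nonzero vector without component along the negative basis direction.\<close>

lemma lorentzian_form_timelike_nonzero:
  fixes B :: "'e::euclidean_space \<Rightarrow> 'e \<Rightarrow> real"
  assumes "lorentzian_form B" "B a a < 0" "B b b < 0"
  shows "B a b \<noteq> 0"
proof
  assume ab: "B a b = 0"
  obtain L :: "'e \<Rightarrow> 'e" and e0 where L: "linear L" "bij L" "e0 \<in> Basis" and
    BL: "\<And>a b. a \<in> Basis \<Longrightarrow> b \<in> Basis \<Longrightarrow> B (L a) (L b) = (if a \<noteq> b then 0 else if a = e0 then -1 else 1)"
    using assms(1) by (rule lorentzian_form_frame) blast
  have bil: "bilinear B" and sym: "\<And>u v. B u v = B v u"
    using assms(1) by (auto simp: lorentzian_form_def)
  obtain x y where x: "a = L x" and y: "b = L y"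
    using \<open>bij L\<close> by (metis bij_pointE)
  have bilL: "bilinear (\<lambda>u v. B (L u) (L v))"
    unfolding bilinear_def[of "\<lambda>u v. B (L u) (L v)"]
    using bil L(1)
    by (auto intro!: linearI simp: bilinear_ladd bilinear_radd bilinear_lmul bilinear_rmul linear_add linear_cmul)
  have pos: "0 \<le> B (L z) (L z)" if "z \<bullet> e0 = 0" for z
  proof -
    have "B (L z) (L z) = (\<Sum>i\<in>Basis. \<Sum>j\<in>Basis. (z \<bullet> i) * (z \<bullet> j) * B (L i) (L j))"
      by (rule bilinear_expand[OF bilL])
    also have "\<dots> = (\<Sum>i\<in>Basis. \<Sum>j\<in>Basis. if j = i then (z \<bullet> i) * (z \<bullet> i) * B (L i) (L i) else 0)"
      by (intro sum.cong) (auto simp: BL)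
    also have "\<dots> = (\<Sum>i\<in>Basis. (z \<bullet> i) * (z \<bullet> i) * B (L i) (L i))"
      by (simp add: sum.delta)
    also have "\<dots> \<ge> 0"
      using that by (intro sum_nonneg) (auto simp: BL)
    finally show ?thesis .
  qed
  have nonzero: "y \<bullet> e0 \<noteq> 0"
    using pos[of y] assms(3) y by auto
  \<comment> \<open>These coefficients cancel the \<open>e0\<close> component of
    \<open>c *\<^sub>R x + d *\<^sub>R y\<close>; \<open>c\<close> is nonzero because
    \<open>b\<close> is timelike.\<close>
  define c d where "c = y \<bullet> e0" and "d = - (x \<bullet> e0)"
  have "0 \<le> B (L (c *\<^sub>R x + d *\<^sub>R y)) (L (c *\<^sub>R x + d *\<^sub>R y))"
    by (rule pos) (simp add: c_def d_def inner_add_left inner_diff_left)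
  also have "L (c *\<^sub>R x + d *\<^sub>R y) = c *\<^sub>R a + d *\<^sub>R b"
    using L(1) by (simp add: x y linear_add linear_cmul)
  also have "B (c *\<^sub>R a + d *\<^sub>R b) (c *\<^sub>R a + d *\<^sub>R b) = c\<^sup>2 * B a a + d\<^sup>2 * B b b"
    using bil ab sym[of b a]
    by (simp add: bilinear_ladd bilinear_radd bilinear_lmul bilinear_rmul power2_eq_square algebra_simps)
  also have "\<dots> < 0"
  proof -
    have "c\<^sup>2 * B a a < 0"
      using nonzero assms(2) by (simp add: c_def mult_pos_neg)
    moreover have "d\<^sup>2 * B b b \<le> 0"
      using assms(3) by (simp add: mult_nonneg_nonpos)
    ultimately show ?thesis by linarith
  qed
  finally show False by simp
qed

section \<open>Lorentz metrics of class C11 on an open set of coordinates\<close>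

locale lorentz_patch =
  fixes U :: "'e::euclidean_space set" and g :: "'e \<Rightarrow> 'e \<Rightarrow> 'e \<Rightarrow> real"
  assumes open_U: "open U"
    and form: "x \<in> U \<Longrightarrow> lorentzian_form (g x)"
    and C11: "C11_on (\<lambda>x. g x u v) U"
begin

definition dg :: "'e \<Rightarrow> 'e \<Rightarrow> 'e \<Rightarrow> 'e \<Rightarrow> real" where
  "dg x u v k = frechet_derivative (\<lambda>y. g y u v) (at x) k"

definition Gam :: "'e \<Rightarrow> 'e \<Rightarrow> 'e \<Rightarrow> 'e" where
  "Gam x u v = (THE z. \<forall>w. g x z w = (dg x v w u + dg x u w v - dg x u v w) / 2)"

lemma bil: "x \<in> U \<Longrightarrow> bilinear (g x)"
  using form by (auto simp: lorentzian_form_def)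

lemma sym: "x \<in> U \<Longrightarrow> g x u v = g x v u"
  using form by (auto simp: lorentzian_form_def)

lemmas g_simps = bilinear_ladd[OF bil] bilinear_radd[OF bil] bilinear_lmul[OF bil]
  bilinear_rmul[OF bil] bilinear_lsub[OF bil] bilinear_rsub[OF bil] bilinear_lneg[OF bil]
  bilinear_rneg[OF bil] bilinear_lzero[OF bil] bilinear_rzero[OF bil]

lemma g_expand: "x \<in> U \<Longrightarrow> g x u v = (\<Sum>i\<in>Basis. \<Sum>j\<in>Basis. (u \<bullet> i) * (v \<bullet> j) * g x i j)"
  by (rule bilinear_expand[OF bil])

lemma has_derivative_g: "x \<in> U \<Longrightarrow> ((\<lambda>y. g y u v) has_derivative dg x u v) (at x)"
  using C11[of u v] frechet_derivative_works unfolding C11_on_def dg_def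
  by (metis (no_types, lifting) ext)

lemma linear_dg: "x \<in> U \<Longrightarrow> linear (dg x u v)"
  using has_derivative_g has_derivative_linear by blast

text \<open>On \<open>U\<close> the metric is a combination of its basis coefficients with factors
  independent of the point, so uniqueness of the derivative carries bilinearity in \<open>u\<close>,
  \<open>v\<close> over to \<open>dg\<close>.\<close>

lemma dg_expand:
  assumes "x \<in> U"
  shows "dg x u v k = (\<Sum>i\<in>Basis. \<Sum>j\<in>Basis. (u \<bullet> i) * (v \<bullet> j) * dg x i j k)"
proof -
  have "((\<lambda>y. \<Sum>i\<in>Basis. \<Sum>j\<in>Basis. (u \<bullet> i) * (v \<bullet> j) * g y i j) has_derivative
      (\<lambda>k. \<Sum>i\<in>Basis. \<Sum>j\<in>Basis. (u \<bullet> i) * (v \<bullet> j) * dg x i j k)) (at x)"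
    by (intro has_derivative_sum has_derivative_mult_right has_derivative_g[OF assms])
  then have "((\<lambda>y. g y u v) has_derivative
      (\<lambda>k. \<Sum>i\<in>Basis. \<Sum>j\<in>Basis. (u \<bullet> i) * (v \<bullet> j) * dg x i j k)) (at x)"
    by (rule has_derivative_transform_within_open[OF _ open_U assms]) (rule g_expand[symmetric])
  then have "dg x u v = (\<lambda>k. \<Sum>i\<in>Basis. \<Sum>j\<in>Basis. (u \<bullet> i) * (v \<bullet> j) * dg x i j k)"
    by (rule has_derivative_unique[OF has_derivative_g[OF assms]])
  then show ?thesis
    by (rule fun_cong)
qed

lemma bilinear_dg:
  assumes "x \<in> U"
  shows "bilinear (\<lambda>u v. dg x u v k)"
proof -
  have eq: "(\<lambda>u v. dg x u v k) = (\<lambda>u v. \<Sum>i\<in>Basis. \<Sum>j\<in>Basis. (u \<bullet> i) * (v \<bullet> j) * dg x i j k)"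
    by (intro ext dg_expand assms)
  show ?thesis
    unfolding eq bilinear_def
    by (auto intro!: linearI simp: algebra_simps inner_add_left sum.distrib sum_distrib_left)
qed

lemmas dg_simps = bilinear_ladd[OF bilinear_dg] bilinear_radd[OF bilinear_dg]
  bilinear_lmul[OF bilinear_dg] bilinear_rmul[OF bilinear_dg]
  bilinear_lsub[OF bilinear_dg] bilinear_rsub[OF bilinear_dg]
  bilinear_lneg[OF bilinear_dg] bilinear_rneg[OF bilinear_dg]
  linear_add[OF linear_dg] linear_cmul[OF linear_dg] linear_diff[OF linear_dg]
  linear_neg[OF linear_dg]

lemma nondegenerate: "x \<in> U \<Longrightarrow> (\<And>w. g x z w = g x y w) \<Longrightarrow> z = y"
  using lorentzian_form_nondegenerate[OF form, of x "z - y"] by (simp add: g_simps)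

text \<open>The definite description in \<open>Gam\<close> is legitimate: lowering an index is an
  injective linear map by nondegeneracy, hence surjective in finite dimension, so exactly one vector
  represents the linear form given by the Koszul formula.\<close>

lemma Gam:
  assumes x: "x \<in> U"
  shows "g x (Gam x u v) w = (dg x v w u + dg x u w v - dg x u v w) / 2"
proof -
  define K where "K w = (dg x v w u + dg x u w v - dg x u v w) / 2" for w
  have K: "linear K"
    unfolding K_def by (rule linearI) (simp_all add: dg_simps x algebra_simps add_divide_distrib diff_divide_distrib)
  define T where "T z = (\<Sum>i\<in>Basis. g x z i *\<^sub>R i)" for z
  have T: "linear T"
    unfolding T_def
    by (rule linearI) (simp_all add: g_simps x algebra_simps sum.distrib scaleR_sum_right)
  have expand: "f w = (\<Sum>i\<in>Basis. (w \<bullet> i) * f i)" if "linear f" for f :: "'e \<Rightarrow> real" and w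
    using linear_sum[OF that, of "\<lambda>i. (w \<bullet> i) *\<^sub>R i" Basis] linear_cmul[OF that]
    by (simp add: euclidean_representation)
  have lin: "linear (g x z)" for z
    using bil[OF x] by (simp add: bilinear_def)
  have "inj T"
    unfolding linear_injective_0[OF T]
  proof (intro allI impI)
    fix z assume "T z = 0"
    then have "g x z i = 0" if "i \<in> Basis" for i
      using that inner_sum_left_Basis[OF that, of "g x z"] by (simp add: T_def)
    then have "g x z w = 0" for w
      using expand[OF lin, of z w] by simp
    then show "z = 0"
      using lorentzian_form_nondegenerate[OF form[OF x]] by blast
  qed
  then have "surj T"
    by (rule linear_inj_imp_surj[OF T])
  then obtain z where z: "T z = (\<Sum>i\<in>Basis. K i *\<^sub>R i)"
    by (metis surjD)
  have zi: "g x z i = K i" if "i \<in> Basis" for i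
    using arg_cong[OF z, of "\<lambda>y. y \<bullet> i"] that
    by (simp add: T_def inner_sum_left_Basis)
  have "g x z w = K w" for w
    unfolding expand[OF lin, of z w] expand[OF K, of w] by (intro sum.cong refl) (simp add: zi)
  then have zK: "\<forall>w. g x z w = K w" ..
  have "\<exists>!z. \<forall>w. g x z w = K w"
  proof (rule ex1I)
    show "z' = z" if "\<forall>w. g x z' w = K w" for z'
      by (rule nondegenerate[OF x]) (use zK that in simp)
  qed (rule zK)
  then have "\<forall>w. g x (Gam x u v) w = K w"
    unfolding Gam_def K_def[symmetric] by (rule theI')
  then show ?thesis
    by (simp add: K_def)
qed

lemma Gam_scale:
  assumes x: "x \<in> U"
  shows "Gam x (c *\<^sub>R v) (c *\<^sub>R v) = (c * c) *\<^sub>R Gam x v v"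
proof (rule nondegenerate[OF x])
  show "g x (Gam x (c *\<^sub>R v) (c *\<^sub>R v)) w = g x ((c * c) *\<^sub>R Gam x v v) w" for w
    unfolding g_simps(3)[OF x] Gam[OF x]
    by (simp add: dg_simps[OF x] right_diff_distrib distrib_left)
qed

lemma timelike_nonzero: "x \<in> U \<Longrightarrow> g x a a < 0 \<Longrightarrow> g x b b < 0 \<Longrightarrow> g x a b \<noteq> 0"
  using lorentzian_form_timelike_nonzero[OF form] by blast

text \<open>A product rule, obtained from the basis coefficients; the coefficient formula holds near
  \<open>r\<close> because \<open>z\<close> is continuous and \<open>U\<close> is open. Derivatives
  are relative to \<open>T\<close> so that endpoints of closed intervals are covered.\<close>

lemma g_has_vector_derivative:
  assumes z: "(z has_vector_derivative z') (at r within T)" and "r \<in> T" and zr: "z r \<in> U"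
    and A: "(A has_vector_derivative A') (at r within T)"
    and B: "(B has_vector_derivative B') (at r within T)"
  shows "((\<lambda>s. g (z s) (A s) (B s)) has_real_derivative
    (dg (z r) (A r) (B r) z' + g (z r) A' (B r) + g (z r) (A r) B')) (at r within T)"
proof -
  have gz: "((\<lambda>s. g (z s) i j) has_vector_derivative dg (z r) i j z') (at r within T)" for i j
    using vector_derivative_diff_chain_within[OF z has_derivative_at_withinI[OF has_derivative_g[OF zr]]]
    by (simp add: o_def)
  have comp: "((\<lambda>s. X s \<bullet> i) has_real_derivative X' \<bullet> i) (at r within T)"
    if "(X has_vector_derivative X') (at r within T)" for X :: "real \<Rightarrow> 'e" and X' i
    using bounded_linear.has_vector_derivative[OF bounded_linear_inner_left that]
    by (simp add: has_real_derivative_iff_has_vector_derivative)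
  have "((\<lambda>s. \<Sum>i\<in>Basis. \<Sum>j\<in>Basis. (A s \<bullet> i) * (B s \<bullet> j) * g (z s) i j) has_real_derivative
      (\<Sum>i\<in>Basis. \<Sum>j\<in>Basis. ((A' \<bullet> i) * (B r \<bullet> j) + (B' \<bullet> j) * (A r \<bullet> i)) * g (z r) i j
        + dg (z r) i j z' * ((A r \<bullet> i) * (B r \<bullet> j)))) (at r within T)"
    by (intro DERIV_sum DERIV_mult comp A B)
      (use gz in \<open>simp add: has_real_derivative_iff_has_vector_derivative\<close>)
  also have "(\<Sum>i\<in>Basis. \<Sum>j\<in>Basis. ((A' \<bullet> i) * (B r \<bullet> j) + (B' \<bullet> j) * (A r \<bullet> i)) * g (z r) i j
        + dg (z r) i j z' * ((A r \<bullet> i) * (B r \<bullet> j)))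
    = dg (z r) (A r) (B r) z' + g (z r) A' (B r) + g (z r) (A r) B'"
    unfolding dg_expand[OF zr, of "A r"] g_expand[OF zr, of A'] g_expand[OF zr, of "A r"]
      sum.distrib[symmetric]
    by (intro sum.cong refl) (simp add: algebra_simps)
  finally have D: "((\<lambda>s. \<Sum>i\<in>Basis. \<Sum>j\<in>Basis. (A s \<bullet> i) * (B s \<bullet> j) * g (z s) i j) has_real_derivative
      dg (z r) (A r) (B r) z' + g (z r) A' (B r) + g (z r) (A r) B') (at r within T)" .
  have "(z \<longlongrightarrow> z r) (at r within T)"
    using has_vector_derivative_continuous[OF z] by (simp add: continuous_within)
  then have "\<forall>\<^sub>F s in at r within T. z s \<in> U"
    using open_U zr by (rule topological_tendstoD)
  then have "\<forall>\<^sub>F s in at r within T. (\<Sum>i\<in>Basis. \<Sum>j\<in>Basis. (A s \<bullet> i) * (B s \<bullet> j) * g (z s) i j)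
      = g (z s) (A s) (B s)"
    by eventually_elim (rule g_expand[symmetric])
  from has_field_derivative_cong_eventually[OF this g_expand[OF zr, symmetric]] D
  show ?thesis by simp
qed

end

section \<open>Uniform constants on a compact convex set\<close>

lemma (in lorentz_patch) g_expand_right: "x \<in> U \<Longrightarrow> g x u v = (\<Sum>i\<in>Basis. (v \<bullet> i) * g x u i)"
proof -
  assume "x \<in> U"
  then have lin: "linear (g x u)"
    using bil by (simp add: bilinear_def)
  show ?thesis
    using linear_sum[OF lin, of "\<lambda>i. (v \<bullet> i) *\<^sub>R i" Basis] linear_cmul[OF lin]
    by (simp add: euclidean_representation)
qed

text \<open>A single \<open>G\<close> serves as bound and Lipschitz constant for \<open>g\<close>
  and \<open>dg\<close> and as Taylor constant. \<open>\<kappa>\<close> quantifies nondegeneracy: an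
  estimate of the covector \<open>g x z\<close> becomes an estimate of \<open>z\<close>, with a
  constant that does not depend on the base point.\<close>

locale lorentz_ball = lorentz_patch U g for U :: "'e::euclidean_space set" and g +
  fixes Q :: "'e set" and G \<kappa> :: real
  assumes Q: "compact Q" "convex Q" "Q \<subseteq> U" and G_pos: "0 < G" and \<kappa>_pos: "0 < \<kappa>"
    and g_le: "x \<in> Q \<Longrightarrow> \<bar>g x u v\<bar> \<le> G * norm u * norm v"
    and g_lip: "x \<in> Q \<Longrightarrow> y \<in> Q \<Longrightarrow> \<bar>g x u v - g y u v\<bar> \<le> G * norm (x - y) * norm u * norm v"
    and dg_le: "x \<in> Q \<Longrightarrow> \<bar>dg x u v k\<bar> \<le> G * norm u * norm v * norm k"
    and dg_lip: "x \<in> Q \<Longrightarrow> y \<in> Q \<Longrightarrow>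
      \<bar>dg x u v k - dg y u v k\<bar> \<le> G * norm (x - y) * norm u * norm v * norm k"
    and g_taylor: "x \<in> Q \<Longrightarrow> y \<in> Q \<Longrightarrow>
      \<bar>g y u v - g x u v - dg x u v (y - x)\<bar> \<le> G * (norm (y - x))\<^sup>2 * norm u * norm v"
    and g_coercive: "x \<in> Q \<Longrightarrow> (\<And>w. \<bar>g x z w\<bar> \<le> B * norm w) \<Longrightarrow> \<kappa> * norm z \<le> B"

context lorentz_patch
begin

lemma locally_lipschitz_dg: "locally_lipschitz_on (\<lambda>x. dg x u v k) U"
  unfolding dg_def by (rule spec[OF conjunct2[OF C11[unfolded C11_on_def]]])

lemma ball_constants:
  assumes Q: "compact Q" "convex Q" "Q \<subseteq> U"
  obtains G \<kappa> where "lorentz_ball U g Q G \<kappa>"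
proof -
  have cont_dg: "continuous_on Q (\<lambda>x. dg x i j k)" for i j k
  proof -
    from locally_lipschitz_on_imp_continuous_on[OF locally_lipschitz_dg open_U] Q(3)
    show ?thesis by (rule continuous_on_subset)
  qed
  have cont_g: "continuous_on Q (\<lambda>x. g x i j)" for i j
    by (rule has_derivative_continuous_on[OF has_derivative_at_withinI[OF has_derivative_g]])
      (use Q(3) in auto)
  have bounded: "\<exists>B. \<forall>x\<in>Q. \<bar>f x\<bar> \<le> B" if "continuous_on Q f" for f :: "'e \<Rightarrow> real"
    using compact_imp_bounded[OF compact_continuous_image[OF that Q(1)]]
    by (auto simp: bounded_iff)
  \<comment> \<open>Constants found for each pair of indices are merged into one positive constant,
    namely 1 plus the sum of their absolute values.\<close>
  have unif: "\<exists>B>0. \<forall>i\<in>Basis. \<forall>j\<in>Basis. P i j B"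
    if ex: "\<And>i j. \<exists>B. P i j B" and mono: "\<And>i j B B'. P i j B \<Longrightarrow> B \<le> B' \<Longrightarrow> P i j B'"
    for P :: "'e \<Rightarrow> 'e \<Rightarrow> real \<Rightarrow> bool"
  proof -
    obtain b where b: "\<And>i j. P i j (b i j)"
      using ex by metis
    define B where "B = 1 + (\<Sum>i\<in>(Basis::'e set). \<Sum>j\<in>(Basis::'e set). \<bar>b i j\<bar>)"
    have "b i j \<le> B" if "i \<in> Basis" "j \<in> Basis" for i j
    proof -
      have "\<bar>b i j\<bar> \<le> (\<Sum>j\<in>(Basis::'e set). \<bar>b i j\<bar>)"
        using that by (intro member_le_sum[of j Basis "\<lambda>j. \<bar>b i j\<bar>"]) auto
      then have "b i j \<le> (\<Sum>j\<in>(Basis::'e set). \<bar>b i j\<bar>)"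
        by linarith
      also have "\<dots> \<le> (\<Sum>i\<in>(Basis::'e set). \<Sum>j\<in>(Basis::'e set). \<bar>b i j\<bar>)"
        using that by (intro member_le_sum[of i Basis "\<lambda>i. \<Sum>j\<in>Basis. \<bar>b i j\<bar>"]) (auto intro: sum_nonneg)
      finally show ?thesis by (simp add: B_def)
    qed
    moreover have "B > 0"
      by (simp add: B_def add_pos_nonneg sum_nonneg)
    ultimately show ?thesis
      using b mono by blast
  qed
  have "\<exists>B>0. \<forall>i\<in>Basis. \<forall>j\<in>Basis. \<forall>x\<in>Q. \<bar>g x i j\<bar> \<le> B"
    by (rule unif[OF bounded[OF cont_g]]) force
  then obtain B1 where B1: "B1 > 0" "\<And>i j x. i \<in> Basis \<Longrightarrow> j \<in> Basis \<Longrightarrow> x \<in> Q \<Longrightarrow> \<bar>g x i j\<bar> \<le> B1"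
    by blast
  have linQ: "linear (dg x i j)" if "x \<in> Q" for x i j
    using linear_dg that Q(3) by auto
  have mono: "a \<le> B' * t" if "a \<le> B * t" "B \<le> B'" "t \<ge> 0" for a B B' t :: real
    using that mult_right_mono[of B B' t] by linarith
  have mono2: "a \<le> B' * t * s" if "a \<le> B * t * s" "B \<le> B'" "t \<ge> 0" "s \<ge> 0" for a B B' t s :: real
    using mono[of a B "t * s" B'] that by (simp add: mult.assoc)
  have B2ex: "\<exists>B. \<forall>x\<in>Q. \<forall>k. \<bar>dg x i j k\<bar> \<le> B * norm k" for i j
  proof -
    \<comment> \<open>\<open>unif\<close> merges over pairs of basis vectors; here the second index
      \<open>k'\<close> is a dummy.\<close>
    have "\<exists>B>0. \<forall>k\<in>Basis. \<forall>k'\<in>(Basis::'e set). \<forall>x\<in>Q. \<bar>dg x i j k\<bar> \<le> B"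
      by (rule unif[OF bounded[OF cont_dg]]) force
    then obtain b where b: "b > 0" "\<And>k x. k \<in> Basis \<Longrightarrow> x \<in> Q \<Longrightarrow> \<bar>dg x i j k\<bar> \<le> b"
      using nonempty_Basis by blast
    show ?thesis
      using linear_sum_bound[OF linQ b(2)] by blast
  qed
  have "\<exists>B>0. \<forall>i\<in>Basis. \<forall>j\<in>Basis. \<forall>x\<in>Q. \<forall>k. \<bar>dg x i j k\<bar> \<le> B * norm k"
    by (rule unif[OF B2ex]) (blast intro: mono norm_ge_zero)
  then obtain B2 where B2: "B2 > 0"
    "\<And>i j x k. i \<in> Basis \<Longrightarrow> j \<in> Basis \<Longrightarrow> x \<in> Q \<Longrightarrow> \<bar>dg x i j k\<bar> \<le> B2 * norm k"
    by blast
  have B3ex: "\<exists>B. \<forall>x\<in>Q. \<forall>y\<in>Q. \<forall>k. \<bar>dg x i j k - dg y i j k\<bar> \<le> B * norm (x - y) * norm k" for i j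
  proof -
    have ex: "\<exists>B. \<forall>x\<in>Q. \<forall>y\<in>Q. \<bar>dg x i j k - dg y i j k\<bar> \<le> B * norm (x - y)" for k
    proof -
      obtain L where "L-lipschitz_on Q (\<lambda>x. dg x i j k)"
        using locally_lipschitz_on_compact[OF locally_lipschitz_dg Q(1,3)] .
      then show ?thesis
        by (auto simp: lipschitz_on_def dist_norm intro!: exI[of _ L])
    qed
    have "\<exists>B>0. \<forall>k\<in>Basis. \<forall>k'\<in>(Basis::'e set). \<forall>x\<in>Q. \<forall>y\<in>Q.
        \<bar>dg x i j k - dg y i j k\<bar> \<le> B * norm (x - y)"
      by (rule unif[OF ex]) (blast intro: mono norm_ge_zero)
    then obtain b where b: "b > 0"
      "\<And>k x y. k \<in> Basis \<Longrightarrow> x \<in> Q \<Longrightarrow> y \<in> Q \<Longrightarrow> \<bar>dg x i j k - dg y i j k\<bar> \<le> b * norm (x - y)"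
      using nonempty_Basis by blast
    have "\<bar>dg x i j k - dg y i j k\<bar> \<le> (DIM('e) * b) * norm (x - y) * norm k" if "x \<in> Q" "y \<in> Q" for x y k
      using linear_sum_bound[OF linear_compose_sub[OF linQ linQ] b(2)] that
      by (simp add: mult.assoc)
    then show ?thesis by blast
  qed
  have "\<exists>B>0. \<forall>i\<in>Basis. \<forall>j\<in>Basis. \<forall>x\<in>Q. \<forall>y\<in>Q. \<forall>k.
      \<bar>dg x i j k - dg y i j k\<bar> \<le> B * norm (x - y) * norm k"
    by (rule unif[OF B3ex]) (blast intro: mono2 norm_ge_zero)
  then obtain B3 where B3: "B3 > 0"
    "\<And>i j x y k. i \<in> Basis \<Longrightarrow> j \<in> Basis \<Longrightarrow> x \<in> Q \<Longrightarrow> y \<in> Q \<Longrightarrow>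
      \<bar>dg x i j k - dg y i j k\<bar> \<le> B3 * norm (x - y) * norm k"
    by blast
  have segQ: "closed_segment x y \<subseteq> Q" if "x \<in> Q" "y \<in> Q" for x y
    using that Q(2) by (rule closed_segment_subset)
  have der: "((\<lambda>y. g y u v) has_derivative dg x u v) (at x within S)" if "x \<in> Q" for x u v S
    by (rule has_derivative_at_withinI[OF has_derivative_g]) (use that Q(3) in auto)
  have glip: "\<bar>g x i j - g y i j\<bar> \<le> B2 * norm (x - y)"
    if "i \<in> Basis" "j \<in> Basis" "x \<in> Q" "y \<in> Q" for i j x y
  proof -
    have "norm (g x i j - g y i j) \<le> B2 * norm (x - y)"
    proof (rule differentiable_bound[where f = "\<lambda>y. g y i j" and f' = "\<lambda>x. dg x i j"])
      show "((\<lambda>y. g y i j) has_derivative dg z i j) (at z within Q)" if "z \<in> Q" for z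
        using that by (rule der)
      show "onorm (dg z i j) \<le> B2" if z: "z \<in> Q" for z
      proof (rule onorm_le)
        show "norm (dg z i j k) \<le> B2 * norm k" for k
          using B2(2)[OF \<open>i \<in> Basis\<close> \<open>j \<in> Basis\<close> z, of k] by simp
      qed
    qed (use Q \<open>x \<in> Q\<close> \<open>y \<in> Q\<close> in auto)
    then show ?thesis by simp
  qed
  \<comment> \<open>Mean value inequality for \<open>g\<close> minus its linearisation at
    \<open>x\<close>: the derivative of the difference at \<open>z\<close> is
    \<open>dg z - dg x\<close>, of size at most a multiple of the distance from \<open>x\<close> by
    the Lipschitz bound \<open>B3\<close>.\<close>
  have gtay: "\<bar>g y i j - g x i j - dg x i j (y - x)\<bar> \<le> B3 * (norm (y - x))\<^sup>2"
    if ij: "i \<in> Basis" "j \<in> Basis" and xy: "x \<in> Q" "y \<in> Q" for i j x y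
  proof -
    have sub: "closed_segment x y \<subseteq> Q"
      using segQ[OF xy] .
    have D: "((\<lambda>y. g y i j - dg x i j y) has_derivative (\<lambda>k. dg z i j k - dg x i j k)) (at z within closed_segment x y)"
      if "z \<in> closed_segment x y" for z
      by (intro has_derivative_diff der linear_imp_has_derivative linQ[OF xy(1)]) (use that sub in blast)
    have on: "onorm (\<lambda>k. dg z i j k - dg x i j k) \<le> B3 * norm (y - x)" if z: "z \<in> closed_segment x y" for z
    proof (rule onorm_le)
      fix k
      have "norm (dg z i j k - dg x i j k) \<le> B3 * norm (z - x) * norm k"
        using B3(2)[OF ij _ xy(1), of z k] z sub by auto
      also have "\<dots> \<le> B3 * norm (y - x) * norm k"
        using segment_bound(1)[OF z] B3(1) by (intro mult_right_mono mult_left_mono) auto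
      finally show "norm (dg z i j k - dg x i j k) \<le> B3 * norm (y - x) * norm k" .
    qed
    have "norm (g y i j - dg x i j y - (g x i j - dg x i j x)) \<le> B3 * norm (y - x) * norm (y - x)"
      by (rule differentiable_bound[where S = "closed_segment x y" and f = "\<lambda>y. g y i j - dg x i j y"
        and f' = "\<lambda>z k. dg z i j k - dg x i j k"]) (use D on in simp_all)
    then show ?thesis
      using linear_diff[OF linQ[OF xy(1)], of i j y x] by (simp add: power2_eq_square algebra_simps)
  qed
  \<comment> \<open>\<open>c\<close> is the minimum of the sum of \<open>\<bar>g x z i\<bar>\<close>
    over the compact product of \<open>Q\<close> and the unit sphere. It is positive by
    nondegeneracy, and homogeneity extends the bound to all \<open>z\<close>.\<close>
  obtain c where c: "c > 0" "\<And>x z. x \<in> Q \<Longrightarrow> c * norm z \<le> (\<Sum>i\<in>Basis. \<bar>g x z i\<bar>)"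
  proof (cases "Q = {}")
    case True
    then show ?thesis using that[of 1] by simp
  next
    case False
    define m where "m = (\<lambda>(x, z). \<Sum>i\<in>Basis. \<bar>g x z i\<bar>)"
    have m_eq: "m (x, z) = (\<Sum>i\<in>Basis. \<bar>\<Sum>j\<in>Basis. (z \<bullet> j) * g x j i\<bar>)" if "x \<in> Q" for x z
    proof -
      have lin: "linear (\<lambda>z. g x z i)" for i
        using bil that Q(3) by (auto simp: bilinear_def)
      have "g x z i = (\<Sum>j\<in>Basis. (z \<bullet> j) * g x j i)" for i
        using linear_sum[OF lin[of i], of "\<lambda>j. (z \<bullet> j) *\<^sub>R j" Basis] linear_cmul[OF lin[of i]]
        by (simp add: euclidean_representation)
      then show ?thesis
        by (simp add: m_def)
    qed
    have cgf: "continuous_on (Q \<times> sphere 0 1) (\<lambda>p. g (fst p) i j)" for i j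
      by (rule continuous_on_compose2[OF cont_g continuous_on_fst]) (auto intro: continuous_on_id)
    have "continuous_on (Q \<times> sphere 0 1) (\<lambda>p. \<Sum>i\<in>Basis. \<bar>\<Sum>j\<in>Basis. (snd p \<bullet> j) * g (fst p) j i\<bar>)"
      by (intro continuous_intros cgf)
    then have cm: "continuous_on (Q \<times> sphere 0 1) m"
      by (rule continuous_on_eq) (auto simp: m_eq)
    have "Q \<times> sphere (0::'e) 1 \<noteq> {}"
      using False by simp
    then obtain p where p: "p \<in> Q \<times> sphere 0 1" "\<And>q. q \<in> Q \<times> sphere 0 1 \<Longrightarrow> m p \<le> m q"
      using continuous_attains_inf[OF compact_Times[OF Q(1) compact_sphere] _ cm] by blast
    obtain x z where xz: "p = (x, z)" "x \<in> Q" "norm z = 1"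
      using p(1) by (cases p) auto
    have "m p > 0"
    proof (rule ccontr)
      assume "\<not> 0 < m p"
      moreover have "m p \<ge> 0"
        by (simp add: m_def xz(1) sum_nonneg)
      ultimately have "m p = 0"
        by linarith
      then have "(\<Sum>i\<in>Basis. \<bar>g x z i\<bar>) = 0"
        by (simp add: m_def xz(1))
      then have "\<forall>i\<in>Basis. g x z i = 0"
        by (simp add: sum_nonneg_eq_0_iff)
      moreover have "x \<in> U"
        using xz(2) Q(3) by auto
      ultimately have "g x z w = 0" for w
        by (simp add: g_expand_right)
      then have "z = 0"
        using lorentzian_form_nondegenerate[OF form] \<open>x \<in> U\<close> by blast
      then show False
        using xz(3) by simp
    qed
    moreover have "m p * norm z \<le> (\<Sum>i\<in>Basis. \<bar>g x z i\<bar>)" if x: "x \<in> Q" for x z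
    proof (cases "z = 0")
      case True
      then show ?thesis by (simp add: sum_nonneg)
    next
      case False
      have "x \<in> U" using x Q(3) by auto
      have "m p \<le> m (x, z /\<^sub>R norm z)"
        using False x by (intro p(2)) simp
      also have "\<dots> = (\<Sum>i\<in>Basis. \<bar>g x z i\<bar>) / norm z"
        using \<open>x \<in> U\<close> by (simp add: m_def g_simps abs_mult sum_distrib_left[symmetric] divide_inverse mult.commute)
      finally show ?thesis
        using False by (simp add: field_simps)
    qed
    ultimately show ?thesis by (rule that)
  qed
  \<comment> \<open>The squared dimension counts the pairs of basis vectors in
    \<open>bilinear_sum_bound\<close>.\<close>
  define G where "G = (DIM('e))\<^sup>2 * (B1 + B2 + B3)"
  have G: "(DIM('e))\<^sup>2 * B \<le> G" if "B \<le> B1 + B2 + B3" for B :: real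
    using that by (simp add: G_def mult_left_mono)
  have le: "\<bar>s\<bar> \<le> G * t * norm u * norm v"
    if s: "s = (\<Sum>i\<in>Basis. \<Sum>j\<in>Basis. (u \<bullet> i) * (v \<bullet> j) * A i j)" and "t \<ge> 0" "B \<le> B1 + B2 + B3"
      and "\<And>i j. i \<in> Basis \<Longrightarrow> j \<in> Basis \<Longrightarrow> \<bar>A i j\<bar> \<le> B * t" for s t B :: real and A and u v :: 'e
  proof -
    have "\<bar>s\<bar> \<le> (DIM('e))\<^sup>2 * (B * t) * norm u * norm v"
      unfolding s by (rule bilinear_sum_bound) (use that in auto)
    also have "\<dots> \<le> G * t * norm u * norm v"
      using G[OF that(3)] that(2) by (simp add: mult.assoc[symmetric] mult_right_mono)
    finally show ?thesis .
  qed
  \<comment> \<open>The dimension divides \<open>c\<close> because each of the basis vectors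
    contributes at most \<open>B\<close> to the sum that \<open>c\<close> bounds from below.\<close>
  have ball: "lorentz_ball U g Q G (c / DIM('e))"
  proof unfold_locales
    fix x y u v k :: 'e assume x: "x \<in> Q"
    then have xU: "x \<in> U" using Q(3) by auto
    show "\<bar>g x u v\<bar> \<le> G * norm u * norm v"
      using le[OF g_expand[OF xU, of u v], of 1 B1] B1 B2(1) B3(1) x by simp
    show "\<bar>dg x u v k\<bar> \<le> G * norm u * norm v * norm k"
      using le[OF dg_expand[OF xU, of u v k], of "norm k" B2] B1(1) B2 B3(1) x by (simp add: mult_ac)
    assume y: "y \<in> Q"
    then have yU: "y \<in> U" using Q(3) by auto
    have "g x u v - g y u v = (\<Sum>i\<in>Basis. \<Sum>j\<in>Basis. (u \<bullet> i) * (v \<bullet> j) * (g x i j - g y i j))"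
      unfolding g_expand[OF xU, of u] g_expand[OF yU, of u] by (simp add: sum_subtractf right_diff_distrib)
    from le[OF this, of "norm (x - y)" B2]
    show "\<bar>g x u v - g y u v\<bar> \<le> G * norm (x - y) * norm u * norm v"
      using glip x y B1(1) B3(1) by simp
    have "dg x u v k - dg y u v k = (\<Sum>i\<in>Basis. \<Sum>j\<in>Basis. (u \<bullet> i) * (v \<bullet> j) * (dg x i j k - dg y i j k))"
      unfolding dg_expand[OF xU, of u] dg_expand[OF yU, of u] by (simp add: sum_subtractf right_diff_distrib)
    from le[OF this, of "norm (x - y) * norm k" B3]
    show "\<bar>dg x u v k - dg y u v k\<bar> \<le> G * norm (x - y) * norm u * norm v * norm k"
      using B3(2) x y B1(1) B2(1) by (simp add: mult_ac)
    have "g y u v - g x u v - dg x u v (y - x)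
        = (\<Sum>i\<in>Basis. \<Sum>j\<in>Basis. (u \<bullet> i) * (v \<bullet> j) * (g y i j - g x i j - dg x i j (y - x)))"
      unfolding g_expand[OF xU, of u] g_expand[OF yU, of u] dg_expand[OF xU, of u]
      by (simp add: sum_subtractf right_diff_distrib)
    from le[OF this, of "(norm (y - x))\<^sup>2" B3]
    show "\<bar>g y u v - g x u v - dg x u v (y - x)\<bar> \<le> G * (norm (y - x))\<^sup>2 * norm u * norm v"
      using gtay x y B1(1) B2(1) by simp
  next
    fix x z B assume x: "x \<in> Q" and B: "\<And>w. \<bar>g x z w\<bar> \<le> B * norm w"
    have "c * norm z \<le> (\<Sum>i\<in>Basis. \<bar>g x z i\<bar>)"
      by (rule c(2)[OF x])
    also have "\<dots> \<le> (\<Sum>i\<in>(Basis::'e set). B)"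
      using B by (intro sum_mono) (metis mult.right_neutral norm_Basis)
    finally show "c / DIM('e) * norm z \<le> B"
      by (simp add: field_simps)
  qed (use Q B1(1) B2(1) B3(1) c(1) in \<open>auto simp: G_def\<close>)
  then show ?thesis by (rule that)
qed

end

context lorentz_ball
begin

text \<open>For equal arguments the Koszul formula reads \<open>dg x v w v - dg x v v w / 2\<close>,
  whence the factor 3/2 = 1 + 1/2. Coercivity turns the bound on pairings into a bound on the
  norm.\<close>

lemma Gam_le:
  assumes x: "x \<in> Q"
  shows "\<kappa> * norm (Gam x v v) \<le> 3 / 2 * G * (norm v)\<^sup>2"
proof (rule g_coercive[OF x])
  fix w
  have xU: "x \<in> U" using x Q by auto
  have "\<bar>g x (Gam x v v) w\<bar> \<le> \<bar>dg x v w v\<bar> + \<bar>dg x v v w\<bar> / 2"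
    using abs_triangle_ineq4[of "dg x v w v" "dg x v v w / 2"]
    by (simp add: Gam[OF xU] diff_divide_distrib)
  also have "\<dots> \<le> 3 / 2 * G * (norm v)\<^sup>2 * norm w"
    using dg_le[OF x, of v w v] dg_le[OF x, of v v w] by (simp add: power2_eq_square mult_ac)
  finally show "\<bar>g x (Gam x v v) w\<bar> \<le> 3 / 2 * G * (norm v)\<^sup>2 * norm w" .
qed

text \<open>This makes the geodesic equation an ordinary differential equation with Lipschitz right
  hand side, as long as positions stay in \<open>Q\<close> and velocities are bounded by
  \<open>N\<close>.\<close>

lemma Gam_diff_le:
  assumes x: "x \<in> Q" and y: "y \<in> Q" and v: "norm v \<le> N" and u: "norm u \<le> N"
  shows "\<kappa> * norm (Gam x v v - Gam y u u) \<le>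
    3 * G * N * norm (v - u) + (3 / 2 * G * N\<^sup>2 + G * (3 / 2 * G * N\<^sup>2 / \<kappa>)) * norm (x - y)"
proof (rule g_coercive[OF x])
  fix w
  have xU: "x \<in> U" and yU: "y \<in> U" using x y Q by auto
  have N: "0 \<le> N" using v norm_ge_zero order_trans by blast
  let ?K = "\<lambda>x v. dg x v w v - dg x v v w / 2"
  have bound: "\<bar>dg z a b c\<bar> \<le> G * A * B * norm w"
    if "z \<in> Q" "norm a * norm b * norm c \<le> A * B * norm w" for z a b c A B
  proof -
    have "\<bar>dg z a b c\<bar> \<le> G * (norm a * norm b * norm c)"
      using dg_le[OF that(1), of a b c] by (simp add: mult_ac)
    also have "\<dots> \<le> G * (A * B * norm w)"
      using that(2) G_pos by (intro mult_left_mono) auto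
    finally show ?thesis by (simp add: mult_ac)
  qed
  have e1: "\<bar>?K x v - ?K y v\<bar> \<le> 3 / 2 * G * N\<^sup>2 * norm (x - y) * norm w"
  proof -
    have b: "\<bar>dg x v a c - dg y v a c\<bar> \<le> G * N\<^sup>2 * norm (x - y) * norm w"
      if "norm a * norm c = norm v * norm w" for a c
    proof -
      have "\<bar>dg x v a c - dg y v a c\<bar> \<le> G * norm (x - y) * norm w * (norm v * norm v)"
        using dg_lip[OF x y, of v a c] that by (metis mult.assoc mult.commute)
      also have "\<dots> \<le> G * norm (x - y) * norm w * (N * N)"
        using v G_pos by (intro mult_left_mono mult_mono N) auto
      finally show ?thesis by (simp add: power2_eq_square mult_ac)
    qed
    show ?thesis
      using b[of w v] b[of v w] by (simp add: mult_ac abs_if split: if_splits)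
  qed
  have e2: "\<bar>?K y v - ?K y u\<bar> \<le> 3 * G * N * norm (v - u) * norm w"
  proof -
    have "?K y v - ?K y u = (dg y (v - u) w v + dg y u w (v - u))
        - (dg y (v - u) v w + dg y u (v - u) w) / 2"
      by (simp add: dg_simps[OF yU] diff_divide_distrib add_divide_distrib)
    moreover have "\<bar>dg y (v - u) w v\<bar> \<le> G * N * norm (v - u) * norm w"
      by (rule bound[OF y]) (use v in \<open>simp add: mult_ac mult_left_mono mult_right_mono\<close>)
    moreover have "\<bar>dg y u w (v - u)\<bar> \<le> G * N * norm (v - u) * norm w"
      by (rule bound[OF y]) (use u in \<open>simp add: mult_ac mult_left_mono mult_right_mono\<close>)
    moreover have "\<bar>dg y (v - u) v w\<bar> \<le> G * N * norm (v - u) * norm w"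
      by (rule bound[OF y]) (use v in \<open>simp add: mult_ac mult_left_mono mult_right_mono\<close>)
    moreover have "\<bar>dg y u (v - u) w\<bar> \<le> G * N * norm (v - u) * norm w"
      by (rule bound[OF y]) (use u in \<open>simp add: mult_ac mult_left_mono mult_right_mono\<close>)
    moreover have "\<bar>(a + b) - (c + d) / 2\<bar> \<le> 3 * X"
      if "\<bar>a\<bar> \<le> X" "\<bar>b\<bar> \<le> X" "\<bar>c\<bar> \<le> X" "\<bar>d\<bar> \<le> X" for a b c d X :: real
    proof (rule abs_leI)
      have ub: "a \<le> X" "b \<le> X" "c \<le> X" "d \<le> X" "-a \<le> X" "-b \<le> X" "-c \<le> X" "-d \<le> X"
        using that by (auto simp: abs_le_iff)
      show "a + b - (c + d) / 2 \<le> 3 * X"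
        using ub by (simp add: field_simps)
      show "- (a + b - (c + d) / 2) \<le> 3 * X"
        using ub by (simp add: field_simps)
    qed
    ultimately have "\<bar>?K y v - ?K y u\<bar> \<le> 3 * (G * N * norm (v - u) * norm w)"
      by presburger
    then show ?thesis by (simp add: mult_ac)
  qed
  have e3: "\<bar>g y (Gam y u u) w - g x (Gam y u u) w\<bar> \<le> G * (3 / 2 * G * N\<^sup>2 / \<kappa>) * norm (x - y) * norm w"
  proof -
    have "\<kappa> * norm (Gam y u u) \<le> 3 / 2 * G * N\<^sup>2"
      using Gam_le[OF y, of u] power_mono[OF u, of 2] G_pos
      by (meson mult_left_mono norm_ge_zero order_trans less_imp_le mult_nonneg_nonneg zero_le_divide_iff zero_le_numeral)
    then have "norm (Gam y u u) \<le> 3 / 2 * G * N\<^sup>2 / \<kappa>"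
      using \<kappa>_pos by (simp add: field_simps)
    then have "G * norm (x - y) * norm w * norm (Gam y u u) \<le> G * norm (x - y) * norm w * (3 / 2 * G * N\<^sup>2 / \<kappa>)"
      using G_pos by (intro mult_left_mono) auto
    then show ?thesis
      using g_lip[OF y x, of "Gam y u u" w] by (simp add: norm_minus_commute mult_ac)
  qed
  \<comment> \<open>Three sources of error: the base point in \<open>dg\<close>, the velocity, and
    the base point of the metric that lowers the index. The last one calls for a bound on
    \<open>Gam y u u\<close> itself.\<close>
  have "g x (Gam x v v - Gam y u u) w = (?K x v - ?K y v) + (?K y v - ?K y u)
      + (g y (Gam y u u) w - g x (Gam y u u) w)"
    by (simp add: g_simps[OF xU] Gam[OF xU] Gam[OF yU] diff_divide_distrib)
  then have "\<bar>g x (Gam x v v - Gam y u u) w\<bar> \<le> \<bar>?K x v - ?K y v\<bar> + \<bar>?K y v - ?K y u\<bar>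
      + \<bar>g y (Gam y u u) w - g x (Gam y u u) w\<bar>"
    by (simp only:)
  also have "\<dots> \<le> 3 / 2 * G * N\<^sup>2 * norm (x - y) * norm w + 3 * G * N * norm (v - u) * norm w
      + G * (3 / 2 * G * N\<^sup>2 / \<kappa>) * norm (x - y) * norm w"
    by (intro add_mono e1 e2 e3)
  finally show "\<bar>g x (Gam x v v - Gam y u u) w\<bar> \<le> (3 * G * N * norm (v - u)
      + (3 / 2 * G * N\<^sup>2 + G * (3 / 2 * G * N\<^sup>2 / \<kappa>)) * norm (x - y)) * norm w"
    by (simp add: algebra_simps)
qed

end

section \<open>Perturbed geodesics and the first variation\<close>

context lorentz_patch
begin

text \<open>The geodesic equation as a first order system with the velocity as a separate function,
  ready for comparison in phase space; derivatives are one-sided at endpoints belonging to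
  \<open>T\<close>.\<close>

definition geodesic_arc :: "(real \<Rightarrow> 'e) \<Rightarrow> (real \<Rightarrow> 'e) \<Rightarrow> real set \<Rightarrow> bool" where
  "geodesic_arc z v T \<longleftrightarrow> (\<forall>r\<in>T. z r \<in> U \<and> (z has_vector_derivative v r) (at r within T) \<and>
     (v has_vector_derivative - Gam (z r) (v r) (v r)) (at r within T))"

lemma geodesic_arc_subset: "geodesic_arc z v T \<Longrightarrow> T' \<subseteq> T \<Longrightarrow> geodesic_arc z v T'"
  unfolding geodesic_arc_def by (meson has_vector_derivative_within_subset subsetD)

lemma geodesic_arc_continuous:
  assumes "geodesic_arc z v T"
  shows "continuous_on T z" "continuous_on T v"
  using assms unfolding geodesic_arc_def
  by (meson continuous_on_eq_continuous_within has_vector_derivative_continuous)+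

lemma continuous_on_g:
  assumes "continuous_on T z" "continuous_on T A" "continuous_on T B" "z ` T \<subseteq> U"
  shows "continuous_on T (\<lambda>t. g (z t) (A t) (B t))"
proof -
  have gU: "continuous_on U (\<lambda>x. g x i j)" for i j
    by (rule has_derivative_continuous_on[OF has_derivative_at_withinI[OF has_derivative_g]])
  have "continuous_on T (\<lambda>t. \<Sum>i\<in>Basis. \<Sum>j\<in>Basis. (A t \<bullet> i) * (B t \<bullet> j) * g (z t) i j)"
    by (intro continuous_intros assms continuous_on_compose2[OF gU assms(1,4)])
  then show ?thesis
    by (rule continuous_on_eq) (use assms(4) g_expand in \<open>auto simp flip: g_expand\<close>)
qed

text \<open>The geodesic equation in lowered form: no Christoffel symbols remain.\<close>

lemma geodesic_arc_momentum:
  assumes arc: "geodesic_arc z v T" and r: "r \<in> T"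
    and k: "(k has_vector_derivative q) (at r within T)"
  shows "((\<lambda>s. g (z s) (v s) (k s)) has_real_derivative
    dg (z r) (v r) (v r) (k r) / 2 + g (z r) (v r) q) (at r within T)"
proof -
  have zU: "z r \<in> U" and z: "(z has_vector_derivative v r) (at r within T)"
    and v: "(v has_vector_derivative - Gam (z r) (v r) (v r)) (at r within T)"
    using arc r by (auto simp: geodesic_arc_def)
  show ?thesis
    by (rule DERIV_cong[OF g_has_vector_derivative[OF z r zU v k]])
      (simp add: g_simps[OF zU] Gam[OF zU] field_simps)
qed

text \<open>The derivative of the metric along the curve cancels against the two Christoffel terms,
  since \<open>2 * g (z r) (Gam (z r) v v) v = dg (z r) v v v\<close> by the Koszul formula.\<close>

lemma geodesic_arc_speed:
  assumes arc: "geodesic_arc z v T" and r: "r \<in> T"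
  shows "((\<lambda>s. g (z s) (v s) (v s)) has_real_derivative 0) (at r within T)"
proof -
  have zU: "z r \<in> U" and z: "(z has_vector_derivative v r) (at r within T)"
    and v: "(v has_vector_derivative - Gam (z r) (v r) (v r)) (at r within T)"
    using arc r by (auto simp: geodesic_arc_def)
  show ?thesis
    by (rule DERIV_cong[OF g_has_vector_derivative[OF z r zU v v]])
      (simp add: g_simps[OF zU] Gam[OF zU] sym[OF zU, of "v r"])
qed

end

context lorentz_ball
begin

text \<open>Gronwall's inequality for the difference of the pairs of position and velocity.
  \<open>L\<close> depends only on \<open>N\<close> and the constants of \<open>Q\<close>, so it
  serves all arcs and all intervals at once; \<open>s\<close> and \<open>t\<close> may come in
  either order.\<close>

lemma geodesic_flow_lipschitz:
  obtains L where "\<And>z1 v1 z2 v2 a b s t. \<lbrakk>geodesic_arc z1 v1 {a..b}; geodesic_arc z2 v2 {a..b};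
      \<And>r. r \<in> {a..b} \<Longrightarrow> z1 r \<in> Q \<and> z2 r \<in> Q \<and> norm (v1 r) \<le> N \<and> norm (v2 r) \<le> N;
      s \<in> {a..b}; t \<in> {a..b}\<rbrakk>
    \<Longrightarrow> norm (z1 t - z2 t, v1 t - v2 t) \<le> exp (L * \<bar>t - s\<bar>) * norm (z1 s - z2 s, v1 s - v2 s)"
proof -
  \<comment> \<open>\<open>A\<close> and \<open>B\<close> are the coefficients in
    \<open>Gam_diff_le\<close> divided by \<open>\<kappa>\<close>; the 1 in \<open>L\<close>
    accounts for the equation that the derivative of the position is the velocity.\<close>
  define A where "A = 3 * G * N / \<kappa>"
  define B where "B = (3 / 2 * G * N\<^sup>2 + G * (3 / 2 * G * N\<^sup>2 / \<kappa>)) / \<kappa>"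
  define L where "L = 1 + \<bar>A\<bar> + \<bar>B\<bar>"
  show ?thesis
  proof (rule that[of L])
    fix z1 v1 z2 v2 a b s t
    assume arc: "geodesic_arc z1 v1 {a..b}" "geodesic_arc z2 v2 {a..b}"
      and bd: "\<And>r. r \<in> {a..b} \<Longrightarrow> z1 r \<in> Q \<and> z2 r \<in> Q \<and> norm (v1 r) \<le> N \<and> norm (v2 r) \<le> N"
      and st: "s \<in> {a..b}" "t \<in> {a..b}"
    define w where "w r = (z1 r - z2 r, v1 r - v2 r)" for r
    define w' where "w' r = (v1 r - v2 r, - Gam (z1 r) (v1 r) (v1 r) + Gam (z2 r) (v2 r) (v2 r))" for r
    have der: "(w has_vector_derivative w' r) (at r within {a..b})" if "r \<in> {a..b}" for r
    proof -
      have "((\<lambda>r. v1 r - v2 r) has_vector_derivative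
        - Gam (z1 r) (v1 r) (v1 r) - - Gam (z2 r) (v2 r) (v2 r)) (at r within {a..b})"
        by (rule has_vector_derivative_diff) (use arc that in \<open>auto simp: geodesic_arc_def\<close>)
      moreover have "((\<lambda>r. z1 r - z2 r) has_vector_derivative v1 r - v2 r) (at r within {a..b})"
        by (rule has_vector_derivative_diff) (use arc that in \<open>auto simp: geodesic_arc_def\<close>)
      ultimately show ?thesis
        unfolding w_def w'_def by (intro has_vector_derivative_Pair) auto
    qed
    have bound: "norm (w' r) \<le> L * norm (w r)" if "r \<in> {a..b}" for r
    proof -
      have le: "norm (z1 r - z2 r) \<le> norm (w r)" "norm (v1 r - v2 r) \<le> norm (w r)"
        using norm_fst_le[of "z1 r - z2 r" "v1 r - v2 r"] norm_snd_le[of "v1 r - v2 r" "z1 r - z2 r"]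
        by (auto simp: w_def)
      have "\<kappa> * norm (Gam (z1 r) (v1 r) (v1 r) - Gam (z2 r) (v2 r) (v2 r))
          \<le> \<kappa> * (A * norm (v1 r - v2 r) + B * norm (z1 r - z2 r))"
        using Gam_diff_le[of "z1 r" "z2 r" "v1 r" N "v2 r"] bd[OF that] \<kappa>_pos
        by (simp add: A_def B_def distrib_left)
      then have "norm (Gam (z1 r) (v1 r) (v1 r) - Gam (z2 r) (v2 r) (v2 r))
          \<le> A * norm (v1 r - v2 r) + B * norm (z1 r - z2 r)"
        using \<kappa>_pos by simp
      also have "\<dots> \<le> \<bar>A\<bar> * norm (w r) + \<bar>B\<bar> * norm (w r)"
        using le by (intro add_mono mult_mono) auto
      finally have "norm (w' r) \<le> norm (w r) + (\<bar>A\<bar> * norm (w r) + \<bar>B\<bar> * norm (w r))"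
        unfolding w'_def
        by (intro order_trans[OF norm_Pair_le] add_mono le(2)) (simp add: norm_minus_commute)
      then show ?thesis
        by (simp add: L_def algebra_simps)
    qed
    have ab: "a \<le> b" using st by auto
    show "norm (z1 t - z2 t, v1 t - v2 t) \<le> exp (L * \<bar>t - s\<bar>) * norm (z1 s - z2 s, v1 s - v2 s)"
    proof (cases "s \<le> t")
      case True
      then show ?thesis
        using gronwall(1)[OF ab der bound, of s t] st by (simp add: w_def)
    next
      case False
      then show ?thesis
        using gronwall(2)[OF ab der bound, of t s] st by (simp add: w_def)
    qed
  qed
qed

text \<open>Expansion of the squared speed around \<open>(x, v)\<close>, where it equals -1. The
  linear part is \<open>dg x v v k + 2 * g x v q\<close>. The three summands of the quadratic
  constant come from the Taylor remainder in the base point, from the mixed term in base point and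
  velocity, and from the square of \<open>q\<close>.\<close>

lemma perturbed_speed:
  assumes x: "x \<in> Q" "x + k \<in> Q" and v: "norm v \<le> N" "g x v v = -1"
    and k: "norm k \<le> m" "norm q \<le> c * m" and c: "0 \<le> c"
  shows "\<bar>g (x + k) (v + q) (v + q) + 1 - (dg x v v k + 2 * g x v q)\<bar>
      \<le> (G * N\<^sup>2 + 2 * G * N * c + G * c\<^sup>2) * m\<^sup>2"
    and "\<bar>dg x v v k + 2 * g x v q\<bar> \<le> (G * N\<^sup>2 + 2 * G * N * c) * m"
proof -
  have xU: "x \<in> U" "x + k \<in> U" using x Q by auto
  have N: "0 \<le> N" using v(1) norm_ge_zero order_trans by blast
  have m: "0 \<le> m" using k(1) norm_ge_zero order_trans by blast
  have vv: "norm v * norm v \<le> N\<^sup>2"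
    using v(1) N by (simp add: power2_eq_square mult_mono)
  have kk: "(norm k)\<^sup>2 \<le> m\<^sup>2"
    using k(1) by (rule power_mono) simp
  have e1: "\<bar>g (x + k) v v - g x v v - dg x v v k\<bar> \<le> G * N\<^sup>2 * m\<^sup>2"
  proof -
    have "\<bar>g (x + k) v v - g x v v - dg x v v k\<bar> \<le> G * ((norm k)\<^sup>2 * (norm v * norm v))"
      using g_taylor[OF x, of v v] by (simp add: mult_ac)
    also have "\<dots> \<le> G * (m\<^sup>2 * N\<^sup>2)"
      using kk vv G_pos by (intro mult_left_mono mult_mono) auto
    finally show ?thesis by (simp add: mult_ac)
  qed
  have e2: "\<bar>g (x + k) v q - g x v q\<bar> \<le> G * N * c * m\<^sup>2"
  proof -
    have "\<bar>g (x + k) v q - g x v q\<bar> \<le> G * (norm k * (norm v * norm q))"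
      using g_lip[OF x(2,1), of v q] by (simp add: mult_ac)
    also have "\<dots> \<le> G * (m * (N * (c * m)))"
      using k v N m c G_pos by (intro mult_left_mono mult_mono) auto
    finally show ?thesis by (simp add: power2_eq_square mult_ac)
  qed
  have e3: "\<bar>g (x + k) q q\<bar> \<le> G * c\<^sup>2 * m\<^sup>2"
  proof -
    have "\<bar>g (x + k) q q\<bar> \<le> G * (norm q * norm q)"
      using g_le[OF x(2), of q q] by (simp add: mult_ac)
    also have "\<dots> \<le> G * ((c * m) * (c * m))"
      using k m c G_pos by (intro mult_left_mono mult_mono) auto
    finally show ?thesis by (simp add: power2_eq_square mult_ac)
  qed
  have "g (x + k) (v + q) (v + q) + 1 - (dg x v v k + 2 * g x v q)
      = (g (x + k) v v - g x v v - dg x v v k) + 2 * (g (x + k) v q - g x v q) + g (x + k) q q"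
    using v(2) sym[OF xU(2), of q v] by (simp add: g_simps[OF xU(2)])
  moreover have "\<bar>(g (x + k) v v - g x v v - dg x v v k) + 2 * (g (x + k) v q - g x v q) + g (x + k) q q\<bar>
    \<le> G * N\<^sup>2 * m\<^sup>2 + 2 * (G * N * c * m\<^sup>2) + G * c\<^sup>2 * m\<^sup>2"
    by (intro abs_leI) (use e1 e2 e3 in \<open>simp_all add: abs_le_iff\<close>)
  ultimately show "\<bar>g (x + k) (v + q) (v + q) + 1 - (dg x v v k + 2 * g x v q)\<bar>
      \<le> (G * N\<^sup>2 + 2 * G * N * c + G * c\<^sup>2) * m\<^sup>2"
    by (simp add: algebra_simps)
  have f1: "\<bar>dg x v v k\<bar> \<le> G * N\<^sup>2 * m"
  proof -
    have "\<bar>dg x v v k\<bar> \<le> G * ((norm v * norm v) * norm k)"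
      using dg_le[OF x(1), of v v k] by (simp add: mult_ac)
    also have "\<dots> \<le> G * (N\<^sup>2 * m)"
      using vv k G_pos by (intro mult_left_mono mult_mono) auto
    finally show ?thesis by (simp add: mult_ac)
  qed
  have f2: "\<bar>g x v q\<bar> \<le> G * N * c * m"
  proof -
    have "\<bar>g x v q\<bar> \<le> G * (norm v * norm q)"
      using g_le[OF x(1), of v q] by (simp add: mult_ac)
    also have "\<dots> \<le> G * (N * (c * m))"
      using v k m N c G_pos by (intro mult_left_mono mult_mono) auto
    finally show ?thesis by (simp add: mult_ac)
  qed
  show "\<bar>dg x v v k + 2 * g x v q\<bar> \<le> (G * N\<^sup>2 + 2 * G * N * c) * m"
    by (intro abs_leI) (use f1 f2 in \<open>simp_all add: abs_le_iff algebra_simps\<close>)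
qed

end

section \<open>Causal patches and length comparison\<close>

text \<open>\<open>X\<close> plays the role of the time orientation and \<open>u\<close> that of the time separation from the
  hypersurface in a chart; \<open>chain\<close> is the reverse triangle inequality, with the length of the
  curve bounded below through an antiderivative.\<close>

locale causal_patch = lorentz_patch U g for U :: "'e::euclidean_space set" and g +
  fixes X :: "'e \<Rightarrow> 'e" and u :: "'e \<Rightarrow> ennreal"
  assumes X_continuous: "continuous_on U X"
    and X_timelike: "x \<in> U \<Longrightarrow> g x (X x) (X x) < 0"
    and chain: "\<lbrakk>a < b; \<And>r. r \<in> {a..b} \<Longrightarrow> y r \<in> U;
      \<And>r. r \<in> {a..b} \<Longrightarrow> (y has_vector_derivative y' r) (at r within {a..b}); continuous_on {a..b} y';
      \<And>r. r \<in> {a..b} \<Longrightarrow> g (y r) (y' r) (y' r) < 0;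
      \<And>r. r \<in> {a..b} \<Longrightarrow> g (y r) (X (y r)) (y' r) < 0;
      \<And>r. r \<in> {a..b} \<Longrightarrow> (f has_real_derivative f' r) (at r within {a..b});
      \<And>r. r \<in> {a..b} \<Longrightarrow> f' r \<le> sqrt (- g (y r) (y' r) (y' r)); 0 < u (y a)\<rbrakk>
      \<Longrightarrow> u (y a) + ennreal (f b - f a) \<le> u (y b)"
begin

text \<open>The Euclidean bound \<open>N\<close> is part of the notion because the normalisation -1
  of an indefinite form does not bound the coordinate velocity.\<close>

definition unit_arc :: "real \<Rightarrow> (real \<Rightarrow> 'e) \<Rightarrow> (real \<Rightarrow> 'e) \<Rightarrow> real set \<Rightarrow> bool" where
  "unit_arc N z v T \<longleftrightarrow> geodesic_arc z v T \<and>
     (\<forall>r\<in>T. norm (v r) \<le> N \<and> g (z r) (v r) (v r) = -1 \<and> g (z r) (X (z r)) (v r) < 0)"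

lemma unit_arc_subset: "unit_arc N z v T \<Longrightarrow> T' \<subseteq> T \<Longrightarrow> unit_arc N z v T'"
  using geodesic_arc_subset unfolding unit_arc_def by blast

text \<open>Two timelike vectors are never orthogonal, so along a segment of timelike vectors the
  product with \<open>X\<close> cannot change sign, by the intermediate value theorem.\<close>

lemma future_persists:
  assumes seg: "\<And>\<theta>. \<theta> \<in> {0..1} \<Longrightarrow> x + \<theta> *\<^sub>R k \<in> U \<and> g (x + \<theta> *\<^sub>R k) (v + \<theta> *\<^sub>R q) (v + \<theta> *\<^sub>R q) < 0"
    and "g x (X x) v < 0"
  shows "g (x + k) (X (x + k)) (v + q) < 0"
proof (rule ccontr)
  define \<phi> where "\<phi> \<theta> = g (x + \<theta> *\<^sub>R k) (X (x + \<theta> *\<^sub>R k)) (v + \<theta> *\<^sub>R q)" for \<theta> :: real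
  have "continuous_on {0..1} \<phi>"
    unfolding \<phi>_def
    by (intro continuous_on_g continuous_on_compose2[OF X_continuous] continuous_intros) (use seg in auto)
  moreover assume "\<not> ?thesis"
  then have "\<phi> 0 \<le> 0" "0 \<le> \<phi> 1"
    using assms(2) by (auto simp: \<phi>_def)
  ultimately obtain \<theta> where \<theta>: "\<theta> \<in> {0..1}" "\<phi> \<theta> = 0"
    using IVT'[of \<phi> 0 0 1] by auto
  then show False
    using timelike_nonzero[OF _ X_timelike, of "x + \<theta> *\<^sub>R k"] seg by (auto simp: \<phi>_def)
qed

end

locale causal_ball = causal_patch U g X u + lorentz_ball U g Q G \<kappa>
  for U :: "'e::euclidean_space set" and g X u Q G \<kappa>
begin

text \<open>The endpoints of a unit speed geodesic are displaced by \<open>h0\<close> and \<open>h1\<close>, interpolating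
  affinely in between. To first order the length changes by the boundary terms of the first
  variation formula only, and the remainder is quadratic with uniform constants.\<close>

lemma support:
  assumes N: "0 \<le> N" and l: "0 < l" and \<rho>0: "0 < \<rho>0"
  obtains C \<rho> where "0 \<le> C" "0 < \<rho>"
    "\<And>z v a b h0 h1. \<lbrakk>unit_arc N z v {a..b}; \<And>r. r \<in> {a..b} \<Longrightarrow> cball (z r) \<rho>0 \<subseteq> Q;
      l \<le> b - a; norm h0 + norm h1 \<le> \<rho>; 0 < u (z a + h0)\<rbrakk> \<Longrightarrow>
      0 \<le> (b - a) - g (z b) (v b) h1 + g (z a) (v a) h0 - C * (norm h0 + norm h1)\<^sup>2 * (b - a) \<and>
      u (z a + h0) + ennreal ((b - a) - g (z b) (v b) h1 + g (z a) (v a) h0 - C * (norm h0 + norm h1)\<^sup>2 * (b - a))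
        \<le> u (z b + h1)"
proof -
  \<comment> \<open>The interpolation has constant slope \<open>q\<close> of norm at most
    \<open>(norm h0 + norm h1) / (b - a)\<close>, and \<open>l\<close> bounds \<open>b - a\<close>
    from below; so the displacement of the velocity is at most \<open>c\<close> times the total
    displacement \<open>m\<close>.\<close>
  define c where "c = 1 / l"
  have c: "0 < c" using l by (simp add: c_def)
  define C1 where "C1 = G * N\<^sup>2 + 2 * G * N * c + G * c\<^sup>2"
  define C2 where "C2 = G * N\<^sup>2 + 2 * G * N * c"
  have C12: "0 \<le> C1" "0 \<le> C2"
    using G_pos N c by (auto simp: C1_def C2_def)
  \<comment> \<open>\<open>C1 / 2\<close> absorbs the quadratic remainder of the squared speed, and
    \<open>(C1 + C2)^2 / 2\<close> the quadratic term of \<open>sqrt_one_minus_ge\<close>.\<close>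
  define C where "C = C1 / 2 + (C1 + C2)\<^sup>2 / 2"
  have C: "0 \<le> C" using C12 by (simp add: C_def)
  \<comment> \<open>The bound 1 gives \<open>m^2 \<le> m\<close>, the bound \<open>\<rho>0\<close>
    keeps the displaced curve in \<open>Q\<close>, and the third makes the corrections so small that
    the curve stays timelike and the lower bound for its speed stays nonnegative.\<close>
  define \<rho> where "\<rho> = min (min 1 \<rho>0) (1 / (2 * (C1 + C2 + 2 * C + 1)))"
  have pos: "0 < 2 * (C1 + C2 + 2 * C + 1)"
    using C12 C by simp
  have \<rho>: "0 < \<rho>" using \<rho>0 pos by (simp add: \<rho>_def)
  show ?thesis
  proof (rule that[OF C \<rho>])
    fix z v :: "real \<Rightarrow> 'e" and a b :: real and h0 h1 :: 'e
    assume arc: "unit_arc N z v {a..b}" and inQ: "\<And>r. r \<in> {a..b} \<Longrightarrow> cball (z r) \<rho>0 \<subseteq> Q"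
      and ab: "l \<le> b - a" and h: "norm h0 + norm h1 \<le> \<rho>" and ua: "0 < u (z a + h0)"
    define m where "m = norm h0 + norm h1"
    have m: "0 \<le> m" "m \<le> 1" "m \<le> \<rho>0" "m * (2 * (C1 + C2 + 2 * C + 1)) \<le> 1"
    proof -
      show "0 \<le> m" "m \<le> 1" "m \<le> \<rho>0"
        using h by (auto simp: m_def \<rho>_def)
      have "m \<le> 1 / (2 * (C1 + C2 + 2 * C + 1))"
        using h by (auto simp: m_def \<rho>_def)
      then show "m * (2 * (C1 + C2 + 2 * C + 1)) \<le> 1"
        using pos by (simp add: pos_le_divide_eq)
    qed
    have mm: "m\<^sup>2 \<le> m"
      using m by (simp add: power2_eq_square mult_left_le)
    have small: "(C1 + C2) * m \<le> 1 / 2" "C * m\<^sup>2 \<le> 1 / 4"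
    proof -
      have prods: "0 \<le> C1 * m" "0 \<le> C2 * m" "0 \<le> C * m"
        using C12 C m by auto
      then show "(C1 + C2) * m \<le> 1 / 2"
        using m(1,4) by (simp add: algebra_simps)
      have "C * m\<^sup>2 \<le> C * m"
        using mm C by (rule mult_left_mono)
      then show "C * m\<^sup>2 \<le> 1 / 4"
        using prods m(1,4) by (simp add: algebra_simps)
    qed
    have alb: "a < b" using ab l by simp
    define q where "q = (h1 - h0) /\<^sub>R (b - a)"
    define k where "k r = h0 + (r - a) *\<^sub>R q" for r
    have ka: "k a = h0" and kb: "k b = h1"
      using alb by (auto simp: k_def q_def)
    have q: "norm q \<le> c * m"
    proof -
      have "norm q = norm (h1 - h0) / (b - a)"
        using alb by (simp add: q_def divide_inverse mult.commute)
      also have "\<dots> \<le> norm (h1 - h0) / l"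
        using ab l by (intro frac_le) auto
      also have "\<dots> \<le> m / l"
        using norm_triangle_ineq4[of h1 h0] l by (intro divide_right_mono) (auto simp: m_def)
      finally show ?thesis by (simp add: c_def)
    qed
    have k: "norm (k r) \<le> m" if "r \<in> {a..b}" for r
    proof -
      define \<theta> where "\<theta> = (r - a) / (b - a)"
      have \<theta>: "0 \<le> \<theta>" "\<theta> \<le> 1"
        using that alb by (auto simp: \<theta>_def)
      have "k r = (1 - \<theta>) *\<^sub>R h0 + \<theta> *\<^sub>R h1"
        by (simp add: k_def q_def \<theta>_def algebra_simps divide_inverse)
      then have "norm (k r) \<le> (1 - \<theta>) * norm h0 + \<theta> * norm h1"
        using norm_triangle_ineq[of "(1 - \<theta>) *\<^sub>R h0" "\<theta> *\<^sub>R h1"] \<theta> by simp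
      also have "\<dots> \<le> 1 * norm h0 + 1 * norm h1"
        using \<theta> by (intro add_mono mult_right_mono) auto
      finally show ?thesis by (simp add: m_def)
    qed
    have arcr: "z r \<in> U" "norm (v r) \<le> N" "g (z r) (v r) (v r) = -1" "g (z r) (X (z r)) (v r) < 0"
      "(z has_vector_derivative v r) (at r within {a..b})" if "r \<in> {a..b}" for r
      using arc that by (auto simp: unit_arc_def geodesic_arc_def)
    have zQ: "z r + w \<in> Q" if "r \<in> {a..b}" "norm w \<le> m" for r w
      using inQ[OF that(1)] that(2) m(3) by (auto simp: subset_iff dist_norm)
    define lin where "lin r = dg (z r) (v r) (v r) (k r) + 2 * g (z r) (v r) q" for r
    \<comment> \<open>The value 1 of \<open>\<theta>\<close> belongs to the displaced curve; the
      intermediate values supply the segment needed in \<open>future_persists\<close>.\<close>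
    have speed: "\<bar>g (z r + \<theta> *\<^sub>R k r) (v r + \<theta> *\<^sub>R q) (v r + \<theta> *\<^sub>R q) + 1 - \<theta> * lin r\<bar> \<le> C1 * m\<^sup>2"
      "\<bar>\<theta> * lin r\<bar> \<le> C2 * m"
      if "r \<in> {a..b}" "\<theta> \<in> {0..1}" for r \<theta>
    proof -
      have 1: "norm (\<theta> *\<^sub>R k r) \<le> m" "norm (\<theta> *\<^sub>R q) \<le> c * m"
        using that k[OF that(1)] q mult_left_le_one_le[of "norm (k r)" \<theta>] mult_left_le_one_le[of "norm q" \<theta>]
        by auto
      have 2: "dg (z r) (v r) (v r) (\<theta> *\<^sub>R k r) + 2 * g (z r) (v r) (\<theta> *\<^sub>R q) = \<theta> * lin r"
        using arcr(1)[OF that(1)] by (simp add: lin_def dg_simps g_simps distrib_left)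
      show "\<bar>g (z r + \<theta> *\<^sub>R k r) (v r + \<theta> *\<^sub>R q) (v r + \<theta> *\<^sub>R q) + 1 - \<theta> * lin r\<bar> \<le> C1 * m\<^sup>2"
        "\<bar>\<theta> * lin r\<bar> \<le> C2 * m"
        using perturbed_speed[OF _ _ arcr(2)[OF that(1)] arcr(3)[OF that(1)] 1] c
          zQ[OF that(1) 1(1)] zQ[OF that(1), of 0] m(1)
        unfolding 2 C1_def C2_def by auto
    qed
    have timelike: "g (z r + \<theta> *\<^sub>R k r) (v r + \<theta> *\<^sub>R q) (v r + \<theta> *\<^sub>R q) \<le> - 1 / 2"
      if "r \<in> {a..b}" "\<theta> \<in> {0..1}" for r \<theta>
    proof -
      have "C1 * m\<^sup>2 \<le> C1 * m"
        using mm C12 by (intro mult_left_mono) auto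
      then have "C1 * m\<^sup>2 + C2 * m \<le> 1 / 2"
        using small(1) by (simp add: distrib_right)
      then show ?thesis
        using speed[OF that] by (simp add: abs_le_iff)
    qed
    define y where "y r = z r + k r" for r
    \<comment> \<open>By the momentum equation the pairing \<open>g (z r) (v r) (k r)\<close> has
      derivative \<open>lin r / 2\<close>. So \<open>f\<close> is the antiderivative of the
      linearised speed minus the margin \<open>C * m^2\<close>, and its increments contain nothing
      but boundary terms and the quadratic error.\<close>
    define f where "f r = r - g (z r) (v r) (k r) - C * m\<^sup>2 * r" for r
    have kder: "(k has_vector_derivative q) (at r within {a..b})" for r
      unfolding k_def by (auto intro!: derivative_eq_intros)
    have fder: "(f has_real_derivative 1 - lin r / 2 - C * m\<^sup>2) (at r within {a..b})" if "r \<in> {a..b}" for r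
    proof -
      have "((\<lambda>s. g (z s) (v s) (k s)) has_real_derivative lin r / 2) (at r within {a..b})"
        by (rule DERIV_cong[OF geodesic_arc_momentum[OF _ that kder]])
          (use arc in \<open>auto simp: unit_arc_def lin_def\<close>)
      then show ?thesis
        unfolding f_def by (auto intro!: derivative_eq_intros)
    qed
    have flen: "1 - lin r / 2 - C * m\<^sup>2 \<le> sqrt (- g (y r) (v r + q) (v r + q))"
      and fpos: "0 \<le> 1 - lin r / 2 - C * m\<^sup>2" if r: "r \<in> {a..b}" for r
    proof -
      define s where "s = g (y r) (v r + q) (v r + q) + 1"
      have sp: "\<bar>s - lin r\<bar> \<le> C1 * m\<^sup>2" "\<bar>lin r\<bar> \<le> C2 * m"
        using speed[OF r, of 1] by (auto simp: s_def y_def)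
      have "s \<le> 1"
        using timelike[OF r, of 1] by (auto simp: s_def y_def)
      have "\<bar>s\<bar> \<le> C1 * m + C2 * m"
        using sp mult_left_mono[OF mm C12(1)] by linarith
      then have "s\<^sup>2 \<le> ((C1 + C2) * m)\<^sup>2"
        by (simp add: abs_le_square_iff[symmetric] distrib_right)
      then have "s\<^sup>2 \<le> (C1 + C2)\<^sup>2 * m\<^sup>2"
        by (simp add: power_mult_distrib)
      then have "1 - lin r / 2 - C * m\<^sup>2 \<le> 1 - s / 2 - s\<^sup>2 / 2"
        using sp(1) by (simp add: C_def distrib_right abs_le_iff)
      also have "\<dots> \<le> sqrt (1 - s)"
        by (rule sqrt_one_minus_ge) fact
      finally show "1 - lin r / 2 - C * m\<^sup>2 \<le> sqrt (- g (y r) (v r + q) (v r + q))"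
        by (simp add: s_def)
      have "C2 * m \<le> (C1 + C2) * m"
        using C12 m by (intro mult_right_mono) auto
      then have "C2 * m \<le> 1 / 2"
        using small(1) by linarith
      then show "0 \<le> 1 - lin r / 2 - C * m\<^sup>2"
        using sp(2) small(2) by (simp add: abs_le_iff)
    qed
    have fab: "f b - f a = (b - a) - g (z b) (v b) h1 + g (z a) (v a) h0 - C * m\<^sup>2 * (b - a)"
      by (simp add: f_def ka kb algebra_simps)
    \<comment> \<open>Recorded because \<open>ennreal\<close> truncates negative numbers: without
      the sign the resulting inequality could not be converted back to real numbers.\<close>
    have "f a \<le> f b"
      by (rule nondecreasing_within[OF _ fder fpos]) (use alb in auto)
    have chain': "u (y a) + ennreal (f b - f a) \<le> u (y b)"
    proof (rule chain[OF alb, of y "\<lambda>r. v r + q" f "\<lambda>r. 1 - lin r / 2 - C * m\<^sup>2"])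
      fix r assume r: "r \<in> {a..b}"
      show "y r \<in> U"
        using zQ[OF r k[OF r]] Q by (auto simp: y_def)
      show "(y has_vector_derivative v r + q) (at r within {a..b})"
        unfolding y_def by (intro has_vector_derivative_add arcr[OF r] kder)
      show "g (y r) (v r + q) (v r + q) < 0"
        using timelike[OF r, of 1] by (simp add: y_def)
      show "g (y r) (X (y r)) (v r + q) < 0"
        unfolding y_def
      proof (rule future_persists)
        fix \<theta> :: real assume \<theta>: "\<theta> \<in> {0..1}"
        have "norm (\<theta> *\<^sub>R k r) \<le> m"
          using k[OF r] \<theta> mult_left_le_one_le[of "norm (k r)" \<theta>] by auto
        from zQ[OF r this] timelike[OF r \<theta>] Q
        show "z r + \<theta> *\<^sub>R k r \<in> U \<and> g (z r + \<theta> *\<^sub>R k r) (v r + \<theta> *\<^sub>R q) (v r + \<theta> *\<^sub>R q) < 0"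
          by auto
      qed (rule arcr[OF r])
    next
      show "continuous_on {a..b} (\<lambda>r. v r + q)"
        using geodesic_arc_continuous(2) arc by (auto simp: unit_arc_def intro!: continuous_intros)
    qed (use fder flen ua in \<open>auto simp: y_def ka\<close>)
    show "0 \<le> (b - a) - g (z b) (v b) h1 + g (z a) (v a) h0 - C * (norm h0 + norm h1)\<^sup>2 * (b - a) \<and>
      u (z a + h0) + ennreal ((b - a) - g (z b) (v b) h1 + g (z a) (v a) h0 - C * (norm h0 + norm h1)\<^sup>2 * (b - a))
        \<le> u (z b + h1)"
      using chain' \<open>f a \<le> f b\<close> fab unfolding m_def[symmetric] by (simp add: y_def ka kb)
  qed
qed

end

section \<open>Maximal rays are touched from both sides\<close>

text \<open>The value at \<open>y2 + h\<close> with \<open>norm h = \<eta>\<close> is expanded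
  around both points. Seen from \<open>y1\<close> the displacement has norm at most
  \<open>2 * \<eta>\<close>, so the errors are \<open>C * \<eta>^2\<close> twice and
  \<open>4 * C * \<eta>^2\<close> once, which sums to 6. Scaling then treats arbitrary
  \<open>w\<close>. Since \<open>\<eta>\<close> is only an upper bound for the distance, the case
  \<open>y1 = y2\<close> is included.\<close>

lemma quadratic_touching_gradient:
  fixes f :: "'e::real_normed_vector \<Rightarrow> real"
  assumes lin: "linear \<xi>1" "linear \<xi>2"
    and t1: "\<And>h. norm h \<le> \<rho> \<Longrightarrow> \<bar>f (y1 + h) - f y1 - \<xi>1 h\<bar> \<le> C * (norm h)\<^sup>2"
    and t2: "\<And>h. norm h \<le> \<rho> \<Longrightarrow> \<bar>f (y2 + h) - f y2 - \<xi>2 h\<bar> \<le> C * (norm h)\<^sup>2"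
    and C: "0 \<le> C" and d: "norm (y2 - y1) \<le> \<eta>" and \<eta>: "0 < \<eta>" "2 * \<eta> \<le> \<rho>"
  shows "\<bar>\<xi>2 w - \<xi>1 w\<bar> \<le> 6 * C * \<eta> * norm w"
proof -
  define D where "D = y2 - y1"
  have upper: "\<xi>2 h - \<xi>1 h \<le> 6 * C * \<eta>\<^sup>2" if h: "norm h = \<eta>" for h
  proof -
    have sq: "C * (norm x)\<^sup>2 \<le> C * c\<^sup>2" if "norm x \<le> c" for c and x :: 'e
      using that C by (intro mult_left_mono power_mono) auto
    have nD: "norm D \<le> \<eta>" "norm (D + h) \<le> 2 * \<eta>"
      using d h norm_triangle_ineq[of D h] by (auto simp: D_def)
    have "f (y2 + h) - f y2 - \<xi>2 h \<ge> - (C * \<eta>\<^sup>2)"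
      using t2[of h] h \<eta> by (simp add: abs_le_iff)
    moreover have "f (y1 + (D + h)) - f y1 - \<xi>1 (D + h) \<le> C * (2 * \<eta>)\<^sup>2"
      using t1[of "D + h"] sq[OF nD(2)] nD(2) \<eta> by (simp add: abs_le_iff)
    moreover have "f (y1 + D) - f y1 - \<xi>1 D \<ge> - (C * \<eta>\<^sup>2)"
      using t1[of D] sq[OF nD(1)] nD(1) \<eta> by (simp add: abs_le_iff)
    moreover have "y1 + (D + h) = y2 + h" "y1 + D = y2" "\<xi>1 (D + h) = \<xi>1 D + \<xi>1 h"
      using linear_add[OF lin(1)] by (auto simp: D_def)
    ultimately show ?thesis by (simp add: power2_eq_square)
  qed
  have bound: "\<xi>2 w - \<xi>1 w \<le> 6 * C * \<eta> * norm w" for w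
  proof (cases "w = 0")
    case True
    then show ?thesis using linear_0[OF lin(1)] linear_0[OF lin(2)] by simp
  next
    case False
    define c where "c = \<eta> / norm w"
    have c: "0 < c" "c * norm w = \<eta>" using False \<eta> by (auto simp: c_def)
    have "c * (\<xi>2 w - \<xi>1 w) \<le> 6 * C * \<eta>\<^sup>2"
      using upper[of "c *\<^sub>R w"] c linear_cmul[OF lin(1), of c w] linear_cmul[OF lin(2), of c w]
      by (simp add: right_diff_distrib)
    also have "\<dots> = c * (6 * C * \<eta> * norm w)"
      by (simp add: c(2)[symmetric] power2_eq_square mult_ac)
    finally show ?thesis using c(1) by simp
  qed
  show ?thesis
    using bound[of w] bound[of "- w"] linear_neg[OF lin(1), of w] linear_neg[OF lin(2), of w]
    by (intro abs_leI) auto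
qed

context causal_ball
begin

text \<open>The offset \<open>\<alpha>\<close> allows the parameter to be shifted:
  \<open>\<alpha> + r\<close> is the time separation at \<open>r\<close>. The condition on
  \<open>\<alpha> + a\<close> makes this positive inside, so that \<open>ennreal\<close> loses
  nothing. Values are prescribed only in the open interval because an endpoint may be a cut point or
  the limit of such.\<close>

definition maximal_ray :: "real \<Rightarrow> real \<Rightarrow> (real \<Rightarrow> 'e) \<Rightarrow> (real \<Rightarrow> 'e) \<Rightarrow> real \<Rightarrow> real \<Rightarrow> real \<Rightarrow> bool" where
  "maximal_ray N \<rho>0 z v \<alpha> a b \<longleftrightarrow> unit_arc N z v {a..b} \<and> (\<forall>r\<in>{a..b}. cball (z r) \<rho>0 \<subseteq> Q) \<and>
     0 \<le> \<alpha> + a \<and> (\<forall>r\<in>{a<..<b}. u (z r) = ennreal (\<alpha> + r))"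

lemma maximal_ray_mem: "0 < \<rho>0 \<Longrightarrow> maximal_ray N \<rho>0 z v \<alpha> a b \<Longrightarrow> r \<in> {a..b} \<Longrightarrow> z r \<in> Q"
  unfolding maximal_ray_def by (meson centre_in_cball less_imp_le subsetD)

text \<open>Running from \<open>z (r - l)\<close> to the displaced point bounds \<open>u\<close>
  there from below; running from the displaced point to \<open>z (r + l)\<close>, where
  \<open>u\<close> is known, bounds it from above. The boundary terms at \<open>z r\<close> agree in
  both comparisons, hence the common linear part. The margin \<open>2 * l\<close> keeps both
  auxiliary points strictly inside the ray.\<close>

lemma two_sided:
  assumes N: "0 \<le> N" and l: "0 < l" and \<rho>0: "0 < \<rho>0"
  obtains C \<rho> where "0 \<le> C" "0 < \<rho>"
    "\<And>z v \<alpha> a b r h. \<lbrakk>maximal_ray N \<rho>0 z v \<alpha> a b; a + 2 * l \<le> r; r + 2 * l \<le> b; norm h \<le> \<rho>\<rbrakk> \<Longrightarrow>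
      (\<exists>w>0. u (z r + h) = ennreal w \<and> \<bar>w - (\<alpha> + r) - (- g (z r) (v r) h)\<bar> \<le> C * (norm h)\<^sup>2)"
proof -
  obtain C \<rho> where C: "0 \<le> C" and \<rho>: "0 < \<rho>" and
    sup: "\<And>z v a b h0 h1. \<lbrakk>unit_arc N z v {a..b}; \<And>r. r \<in> {a..b} \<Longrightarrow> cball (z r) \<rho>0 \<subseteq> Q;
      l \<le> b - a; norm h0 + norm h1 \<le> \<rho>; 0 < u (z a + h0)\<rbrakk> \<Longrightarrow>
      0 \<le> (b - a) - g (z b) (v b) h1 + g (z a) (v a) h0 - C * (norm h0 + norm h1)\<^sup>2 * (b - a) \<and>
      u (z a + h0) + ennreal ((b - a) - g (z b) (v b) h1 + g (z a) (v a) h0 - C * (norm h0 + norm h1)\<^sup>2 * (b - a))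
        \<le> u (z b + h1)"
    using support[OF N l \<rho>0] by blast
  show ?thesis
  proof (rule that[of "C * l" \<rho>])
    fix z v :: "real \<Rightarrow> 'e" and \<alpha> a b r :: real and h :: 'e
    assume ray: "maximal_ray N \<rho>0 z v \<alpha> a b" and r: "a + 2 * l \<le> r" "r + 2 * l \<le> b"
      and h: "norm h \<le> \<rho>"
    have arc: "unit_arc N z v {a..b}" and inQ: "\<And>r. r \<in> {a..b} \<Longrightarrow> cball (z r) \<rho>0 \<subseteq> Q"
      and \<alpha>: "0 \<le> \<alpha> + a" and max: "\<And>r. a < r \<Longrightarrow> r < b \<Longrightarrow> u (z r) = ennreal (\<alpha> + r)"
      using ray by (auto simp: maximal_ray_def)
    have zU: "z s \<in> U" if "s \<in> {a..b}" for s
      using arc that by (auto simp: unit_arc_def geodesic_arc_def)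
    \<comment> \<open>\<open>?D\<close> is the gain guaranteed between \<open>z (r - l)\<close> and
      the displaced point, \<open>?E\<close> the gain guaranteed between the displaced point and
      \<open>z (r + l)\<close>.\<close>
    let ?D = "l - g (z r) (v r) h - C * (norm h)\<^sup>2 * l"
    let ?E = "l + g (z r) (v r) h - C * (norm h)\<^sup>2 * l"
    have "0 < u (z (r - l) + 0)"
      using max[of "r - l"] r l \<alpha> by simp
    then have "0 \<le> ?D \<and> u (z (r - l) + 0) + ennreal ?D \<le> u (z r + h)"
      using sup[of z v "r - l" r 0 h, OF unit_arc_subset[OF arc] inQ] r l h
        bilinear_rzero[OF bil[OF zU[of "r - l"]]] by auto
    then have D: "0 \<le> ?D" "ennreal (\<alpha> + (r - l) + ?D) \<le> u (z r + h)"
      using max[of "r - l"] r l \<alpha> by (auto simp: ennreal_plus[symmetric] simp del: ennreal_plus)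
    have pos: "0 < \<alpha> + (r - l)" using r l \<alpha> by simp
    then have "0 < ennreal (\<alpha> + (r - l) + ?D)"
      using D(1) by (intro iffD2[OF ennreal_less_zero_iff]) linarith
    \<comment> \<open>\<open>chain\<close> starts only at points with positive \<open>u\<close>; the
      lower estimate provides this for the upper one.\<close>
    then have u0: "0 < u (z r + h)"
      using D(2) by (rule less_le_trans)
    have "0 \<le> ?E \<and> u (z r + h) + ennreal ?E \<le> u (z (r + l) + 0)"
      using sup[of z v r "r + l" h 0, OF unit_arc_subset[OF arc] inQ] r l h u0
        bilinear_rzero[OF bil[OF zU[of "r + l"]]] by auto
    then have E: "0 \<le> ?E" "u (z r + h) + ennreal ?E \<le> ennreal (\<alpha> + (r + l))"
      using max[of "r + l"] r l by auto
    \<comment> \<open>The upper comparison also excludes the value \<open>top\<close>, so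
      \<open>u\<close> is real valued near the ray.\<close>
    have "u (z r + h) \<le> u (z r + h) + ennreal ?E"
      by simp
    with E(2) have "u (z r + h) \<noteq> top"
      by (metis ennreal_neq_top neq_top_trans)
    then obtain w where w: "0 \<le> w" "u (z r + h) = ennreal w"
      by (cases "u (z r + h)") auto
    have "\<alpha> + (r - l) + ?D \<le> w"
      using D(2) w by (simp add: ennreal_le_iff)
    moreover have "w + ?E \<le> \<alpha> + (r + l)"
    proof -
      have "ennreal (w + ?E) \<le> ennreal (\<alpha> + (r + l))"
        using E w by (simp add: ennreal_plus[symmetric] del: ennreal_plus)
      then show ?thesis
        using pos l by (subst (asm) ennreal_le_iff) auto
    qed
    ultimately have "\<bar>w - (\<alpha> + r) - (- g (z r) (v r) h)\<bar> \<le> C * l * (norm h)\<^sup>2"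
      by (intro abs_leI) (simp_all add: mult_ac)
    moreover have "0 < w"
      using u0 w by (simp add: ennreal_less_zero_iff)
    ultimately show "\<exists>w>0. u (z r + h) = ennreal w \<and> \<bar>w - (\<alpha> + r) - (- g (z r) (v r) h)\<bar> \<le> C * l * (norm h)\<^sup>2"
      using w by blast
  qed (use C l \<rho> in auto)
qed

text \<open>The covector \<open>- g (z r) (v r)\<close> is the derivative of \<open>u\<close> at
  \<open>z r\<close>, and two-sided quadratic touching makes this derivative Lipschitz. Coercivity
  returns from covectors to velocities, at the price of moving the base point of \<open>g\<close>.
  In particular, maximal rays meeting at points of this kind share velocity and time value.\<close>

lemma maximal_velocity_lipschitz:
  assumes N: "0 \<le> N" and l: "0 < l" and \<rho>0: "0 < \<rho>0"
  obtains C \<rho> where "0 \<le> C" "0 < \<rho>"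
    "\<And>z1 v1 \<alpha>1 a1 b1 z2 v2 \<alpha>2 a2 b2 r s. \<lbrakk>maximal_ray N \<rho>0 z1 v1 \<alpha>1 a1 b1; maximal_ray N \<rho>0 z2 v2 \<alpha>2 a2 b2;
      a1 + 2 * l \<le> r; r + 2 * l \<le> b1; a2 + 2 * l \<le> s; s + 2 * l \<le> b2; norm (z1 r - z2 s) \<le> \<rho>\<rbrakk> \<Longrightarrow>
      norm (v1 r - v2 s) \<le> C * norm (z1 r - z2 s) \<and> \<bar>(\<alpha>1 + r) - (\<alpha>2 + s)\<bar> \<le> C * norm (z1 r - z2 s)"
proof -
  obtain C \<rho> where C: "0 \<le> C" and \<rho>: "0 < \<rho>" and
    two: "\<And>z v \<alpha> a b r h. \<lbrakk>maximal_ray N \<rho>0 z v \<alpha> a b; a + 2 * l \<le> r; r + 2 * l \<le> b; norm h \<le> \<rho>\<rbrakk> \<Longrightarrow>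
      (\<exists>w>0. u (z r + h) = ennreal w \<and> \<bar>w - (\<alpha> + r) - (- g (z r) (v r) h)\<bar> \<le> C * (norm h)\<^sup>2)"
    using two_sided[OF N l \<rho>0] by blast
  define K1 where "K1 = (6 * C + G * N) / \<kappa>"
  define K2 where "K2 = G * N + C * \<rho>"
  have K: "0 \<le> K1" "0 \<le> K2"
    using C G_pos N \<kappa>_pos \<rho> by (auto simp: K1_def K2_def)
  define f where "f = (\<lambda>x. enn2real (u x))"
  show ?thesis
  \<comment> \<open>The third of \<open>\<rho>\<close> leaves room for a bound \<open>\<eta>\<close>
    slightly above the distance with \<open>2 * \<eta> \<le> \<rho>\<close>.\<close>
  proof (rule that[of "K1 + K2" "\<rho> / 3"])
    fix z1 v1 z2 v2 :: "real \<Rightarrow> 'e" and \<alpha>1 a1 b1 \<alpha>2 a2 b2 r s :: real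
    assume ray1: "maximal_ray N \<rho>0 z1 v1 \<alpha>1 a1 b1" and ray2: "maximal_ray N \<rho>0 z2 v2 \<alpha>2 a2 b2"
      and r: "a1 + 2 * l \<le> r" "r + 2 * l \<le> b1" and s: "a2 + 2 * l \<le> s" "s + 2 * l \<le> b2"
      and close: "norm (z1 r - z2 s) \<le> \<rho> / 3"
    have f0: "f (z r) = \<alpha> + r"
      if "maximal_ray N \<rho>0 z v \<alpha> a b" "a + 2 * l \<le> r" "r + 2 * l \<le> b" for z v \<alpha> a b r
      using that l by (auto simp: f_def maximal_ray_def)
    have touch: "\<bar>f (z r + h) - f (z r) - (- g (z r) (v r) h)\<bar> \<le> C * (norm h)\<^sup>2"
      if "maximal_ray N \<rho>0 z v \<alpha> a b" "a + 2 * l \<le> r" "r + 2 * l \<le> b" "norm h \<le> \<rho>" for z v \<alpha> a b r h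
      using two[OF that] f0[OF that(1-3)] by (auto simp: f_def)
    have mem: "r \<in> {a1..b1}" "s \<in> {a2..b2}" using r s l by auto
    have facts1: "z1 r \<in> U" "norm (v1 r) \<le> N" "z1 r \<in> Q"
      using ray1 mem maximal_ray_mem[OF \<rho>0 ray1]
      by (auto simp: maximal_ray_def unit_arc_def geodesic_arc_def)
    have facts2: "z2 s \<in> U" "norm (v2 s) \<le> N" "z2 s \<in> Q"
      using ray2 mem maximal_ray_mem[OF \<rho>0 ray2]
      by (auto simp: maximal_ray_def unit_arc_def geodesic_arc_def)
    have lin: "linear (\<lambda>h. - g x V h)" if "x \<in> U" for x V
      using bil[OF that] by (auto simp: bilinear_def intro: linear_compose_neg)
    have vel: "norm (v1 r - v2 s) \<le> K1 * \<eta>" if \<eta>: "norm (z1 r - z2 s) \<le> \<eta>" "0 < \<eta>" "2 * \<eta> \<le> \<rho>" for \<eta>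
    proof -
      have "\<kappa> * norm (v1 r - v2 s) \<le> (6 * C + G * N) * \<eta>"
      proof (rule g_coercive[OF facts1(3)])
        fix w
        have "\<bar>(- g (z2 s) (v2 s) w) - (- g (z1 r) (v1 r) w)\<bar> \<le> 6 * C * \<eta> * norm w"
          by (rule quadratic_touching_gradient[OF lin[OF facts1(1)] lin[OF facts2(1)]
              touch[OF ray1 r] touch[OF ray2 s] C _ \<eta>(2,3)])
            (use \<eta>(1) in \<open>simp_all add: norm_minus_commute\<close>)
        then have 1: "\<bar>g (z1 r) (v1 r) w - g (z2 s) (v2 s) w\<bar> \<le> 6 * C * \<eta> * norm w"
          by simp
        have "\<bar>g (z2 s) (v2 s) w - g (z1 r) (v2 s) w\<bar> \<le> G * (norm (z1 r - z2 s) * norm (v2 s)) * norm w"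
          using g_lip[OF facts2(3) facts1(3)] by (simp add: mult.assoc norm_minus_commute)
        also have "\<dots> \<le> G * (\<eta> * N) * norm w"
          using \<eta> facts2(2) G_pos N by (intro mult_right_mono mult_left_mono mult_mono) auto
        finally have 2: "\<bar>g (z2 s) (v2 s) w - g (z1 r) (v2 s) w\<bar> \<le> G * (\<eta> * N) * norm w" .
        have "\<bar>g (z1 r) (v1 r - v2 s) w\<bar>
            \<le> \<bar>g (z1 r) (v1 r) w - g (z2 s) (v2 s) w\<bar> + \<bar>g (z2 s) (v2 s) w - g (z1 r) (v2 s) w\<bar>"
          by (simp add: g_simps[OF facts1(1)])
        also have "\<dots> \<le> (6 * C + G * N) * \<eta> * norm w"
          using add_mono[OF 1 2] by (simp add: algebra_simps)
        finally show "\<bar>g (z1 r) (v1 r - v2 s) w\<bar> \<le> (6 * C + G * N) * \<eta> * norm w" .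
      qed
      then show ?thesis
        using \<kappa>_pos by (simp add: K1_def field_simps)
    qed
    let ?d = "norm (z1 r - z2 s)"
    \<comment> \<open>\<open>vel\<close> wants a positive \<open>\<eta>\<close>, while the distance
      may be 0; so \<open>\<eta>\<close> exceeds the distance by \<open>\<mu>\<close>, which is made
      arbitrarily small.\<close>
    have v: "norm (v1 r - v2 s) \<le> K1 * ?d"
    proof (rule field_le_epsilon)
      fix e :: real assume e: "0 < e"
      define \<mu> where "\<mu> = min (\<rho> / 6) (e / (K1 + 1))"
      have \<mu>: "0 < \<mu>" "6 * \<mu> \<le> \<rho>" "\<mu> \<le> e / (K1 + 1)"
        using \<rho> e K(1) by (auto simp: \<mu>_def)
      have "3 * ?d \<le> \<rho>" using close by simp
      with \<mu>(1,2) have "norm (v1 r - v2 s) \<le> K1 * (?d + \<mu>)"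
        by (intro vel) (auto intro: add_nonneg_pos)
      also have "\<dots> \<le> K1 * ?d + K1 * (e / (K1 + 1))"
        unfolding distrib_left by (intro add_left_mono mult_left_mono K \<mu>)
      also have "K1 * (e / (K1 + 1)) \<le> e"
        using K(1) e by (simp add: field_simps)
      finally show "norm (v1 r - v2 s) \<le> K1 * ?d + e" by simp
    qed
    have "\<bar>(\<alpha>1 + r) - (\<alpha>2 + s)\<bar> \<le> K2 * ?d"
    proof -
      have "norm (z1 r - z2 s) \<le> \<rho>"
        using close norm_ge_zero[of "z1 r - z2 s"] by linarith
      then have "\<bar>f (z1 r) - f (z2 s) - (- g (z2 s) (v2 s) (z1 r - z2 s))\<bar> \<le> C * ?d\<^sup>2"
        using touch[OF ray2 s, of "z1 r - z2 s"] by simp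
      moreover have "C * ?d\<^sup>2 \<le> C * \<rho> * ?d"
        using \<open>?d \<le> \<rho>\<close> C by (simp add: power2_eq_square mult.assoc mult_left_mono mult_right_mono)
      moreover have "\<bar>g (z2 s) (v2 s) (z1 r - z2 s)\<bar> \<le> G * N * ?d"
      proof -
        have "\<bar>g (z2 s) (v2 s) (z1 r - z2 s)\<bar> \<le> G * norm (v2 s) * ?d"
          by (rule g_le[OF facts2(3)])
        also have "\<dots> \<le> G * N * ?d"
          using facts2(2) G_pos by (intro mult_right_mono mult_left_mono) auto
        finally show ?thesis .
      qed
      ultimately have "\<bar>f (z1 r) - f (z2 s)\<bar> \<le> K2 * ?d"
        unfolding K2_def by (simp add: distrib_right abs_le_iff)
      then show ?thesis
        by (simp add: f0[OF ray1 r] f0[OF ray2 s])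
    qed
    then show "norm (v1 r - v2 s) \<le> (K1 + K2) * ?d \<and> \<bar>(\<alpha>1 + r) - (\<alpha>2 + s)\<bar> \<le> (K1 + K2) * ?d"
      using v mult_right_mono[of K1 "K1 + K2" ?d] mult_right_mono[of K2 "K1 + K2" ?d] K by auto
  qed (use K \<rho> in auto)
qed

end

section \<open>Cut points in a chart\<close>

text \<open>Term by term differentiation in the form needed to pass to the limit in both equations
  of the geodesic system.\<close>

lemma has_vector_derivative_uniform_limit:
  fixes f :: "nat \<Rightarrow> real \<Rightarrow> 'a::banach"
  assumes der: "\<And>n r. r \<in> {a..b} \<Longrightarrow> (f n has_vector_derivative f' n r) (at r within {a..b})"
    and unif: "\<And>e. e > 0 \<Longrightarrow> \<forall>\<^sub>F n in sequentially. \<forall>r\<in>{a..b}. norm (f' n r - g' r) \<le> e"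
    and lim: "\<And>r. r \<in> {a..b} \<Longrightarrow> (\<lambda>n. f n r) \<longlonglongrightarrow> g r"
    and r: "r \<in> {a..b}"
  shows "(g has_vector_derivative g' r) (at r within {a..b})"
proof -
  have "\<exists>G. \<forall>x\<in>{a..b}. (\<lambda>n. f n x) \<longlonglongrightarrow> G x \<and>
      (G has_derivative (\<lambda>h. h *\<^sub>R g' x)) (at x within {a..b})"
  proof (rule has_derivative_sequence[where f = f and f' = "\<lambda>n x h. h *\<^sub>R f' n x" and ?x0.0 = r and l = "g r"])
    show "(f n has_derivative (\<lambda>h. h *\<^sub>R f' n x)) (at x within {a..b})" if "x \<in> {a..b}" for n x
      using der[OF that] by (simp add: has_vector_derivative_def)
    fix e :: real assume "e > 0"
    from unif[OF this]
    show "\<forall>\<^sub>F n in sequentially. \<forall>x\<in>{a..b}. \<forall>h. norm (h *\<^sub>R f' n x - h *\<^sub>R g' x) \<le> e * norm h"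
    proof (rule eventually_mono)
      fix n assume n: "\<forall>r\<in>{a..b}. norm (f' n r - g' r) \<le> e"
      show "\<forall>x\<in>{a..b}. \<forall>h. norm (h *\<^sub>R f' n x - h *\<^sub>R g' x) \<le> e * norm h"
      proof (intro ballI allI)
        fix x h assume "x \<in> {a..b}"
        with n have "\<bar>h\<bar> * norm (f' n x - g' x) \<le> \<bar>h\<bar> * e"
          by (intro mult_left_mono) auto
        then show "norm (h *\<^sub>R f' n x - h *\<^sub>R g' x) \<le> e * norm h"
          by (simp add: scaleR_diff_right[symmetric] mult.commute)
      qed
    qed
  next
    show "convex {a..b}" by (rule convex_real_interval)
    show "r \<in> {a..b}" by (rule r)
    show "(\<lambda>n. f n r) \<longlonglongrightarrow> g r" by (rule lim[OF r])
  qed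
  then obtain G where G: "\<And>x. x \<in> {a..b} \<Longrightarrow> (\<lambda>n. f n x) \<longlonglongrightarrow> G x"
    "\<And>x. x \<in> {a..b} \<Longrightarrow> (G has_derivative (\<lambda>h. h *\<^sub>R g' x)) (at x within {a..b})"
    by blast
  have eq: "G x = g x" if "x \<in> {a..b}" for x
    using LIMSEQ_unique[OF G(1)[OF that] lim[OF that]] .
  have "(g has_derivative (\<lambda>h. h *\<^sub>R g' r)) (at r within {a..b})"
    by (rule has_derivative_transform[OF r eq[symmetric] G(2)[OF r]])
  then show ?thesis
    by (simp add: has_vector_derivative_def)
qed

text \<open>The sets in question are pairwise disjoint fibres of a measurable function, so at most
  countably many of them have positive measure.\<close>

lemma exists_negligible_level:
  fixes Y :: "real \<Rightarrow> 'e::euclidean_space set"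
  assumes closed: "\<And>d. 0 < d \<Longrightarrow> closed (Y d)"
    and anti: "\<And>d d'. 0 < d \<Longrightarrow> d \<le> d' \<Longrightarrow> Y d' \<subseteq> Y d"
    and bounded: "\<And>d. 0 < d \<Longrightarrow> Y d \<subseteq> cball 0 R" and e: "0 < e"
  obtains d where "0 < d" "d < e" "negligible (Y d - (\<Union>d'\<in>{d<..}. Y d'))"
proof -
  \<comment> \<open>\<open>a y\<close> is the largest level of \<open>y\<close>, cut off at
    \<open>e\<close>; inserting 0 keeps the set nonempty.\<close>
  define a where "a y = Sup (insert 0 {d. 0 < d \<and> d < e \<and> y \<in> Y d})" for y
  have bdd: "bdd_above (insert 0 {d. 0 < d \<and> d < e \<and> y \<in> Y d})" for y
    by (rule bdd_aboveI[of _ e]) (use e in auto)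
  \<comment> \<open>Antitonicity allows the level to be lowered to a rational one, so superlevel
    sets of \<open>a\<close> become countable unions of closed sets.\<close>
  have less_a: "c < a y \<longleftrightarrow> c < 0 \<or> (\<exists>q\<in>\<rat>. c < q \<and> 0 < q \<and> q < e \<and> y \<in> Y q)" for c y
  proof
    assume "c < a y"
    then obtain d where d: "d = 0 \<or> (0 < d \<and> d < e \<and> y \<in> Y d)" "c < d"
      unfolding a_def using less_cSup_iff[OF _ bdd, of y c] by auto
    show "c < 0 \<or> (\<exists>q\<in>\<rat>. c < q \<and> 0 < q \<and> q < e \<and> y \<in> Y q)"
    proof (cases "c < 0")
      case False
      with d have d: "0 < d" "d < e" "y \<in> Y d" "c < d" by auto
      obtain q where "q \<in> \<rat>" "c < q" "q < d"
        using Rats_dense_in_real[OF d(4)] by blast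
      with d False anti[of q d] show ?thesis by force
    qed simp
  next
    assume "c < 0 \<or> (\<exists>q\<in>\<rat>. c < q \<and> 0 < q \<and> q < e \<and> y \<in> Y q)"
    then have "\<exists>d\<in>insert 0 {d. 0 < d \<and> d < e \<and> y \<in> Y d}. c < d" by auto
    then show "c < a y"
      unfolding a_def using less_cSup_iff[OF _ bdd, of y c] by auto
  qed
  have meas: "a \<in> borel_measurable borel"
  proof (rule borel_measurable_iff_greater[THEN iffD2], rule allI)
    fix c
    have "{y. c < a y} = (if c < 0 then UNIV else (\<Union>q\<in>{q\<in>\<rat>. c < q \<and> 0 < q \<and> q < e}. Y q))"
      by (auto simp: less_a)
    also have "\<dots> \<in> sets borel"
    proof -
      have "countable {q\<in>\<rat>. c < q \<and> 0 < q \<and> q < e}"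
        by (rule countable_subset[OF _ countable_rat]) auto
      then have "(\<Union>q\<in>{q\<in>\<rat>. c < q \<and> 0 < q \<and> q < e}. Y q) \<in> sets borel"
        by (rule sets.countable_UN') (use closed in auto)
      then show ?thesis by simp
    qed
    finally show "{w \<in> space borel. c < a w} \<in> sets borel" by simp
  qed
  \<comment> \<open>The image under \<open>a\<close> of Lebesgue measure on a ball is a finite
    measure on the line, so it has at most countably many atoms; any other \<open>d\<close> in the
    interval has a null fibre.\<close>
  define Mm where "Mm = distr (restrict_space lborel (cball (0::'e) R)) borel a"
  have ma: "a \<in> measurable (restrict_space lborel (cball 0 R)) borel"
    using meas by (intro measurable_restrict_space1) simp
  interpret finite_measure Mm
  proof
    have "emeasure Mm (space Mm) = emeasure lborel (cball (0::'e) R)"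
      unfolding Mm_def using ma
      by (subst emeasure_distr) (auto simp: space_restrict_space emeasure_restrict_space)
    also have "\<dots> < \<infinity>"
      by (rule emeasure_lborel_cball_finite)
    finally show "emeasure Mm (space Mm) \<noteq> \<infinity>" by simp
  qed
  have "uncountable {0<..<e}"
    using e by (simp add: uncountable_open_interval)
  then have "\<not> {0<..<e} \<subseteq> {d. measure Mm {d} \<noteq> 0}"
    using countable_subset[OF _ countable_support] by metis
  then obtain d where d: "d \<in> {0<..<e}" "measure Mm {d} = 0"
    by blast
  have "emeasure Mm {d} = 0"
    using d(2) by (simp add: emeasure_eq_measure)
  then have 0: "emeasure lborel (a -` {d} \<inter> cball 0 R) = 0"
    unfolding Mm_def using ma
    by (subst (asm) emeasure_distr) (auto simp: space_restrict_space emeasure_restrict_space)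
  moreover have "a -` {d} \<inter> cball 0 R \<in> sets lborel"
    using measurable_sets[OF meas, of "{d}"] by simp
  ultimately have neg: "negligible (a -` {d} \<inter> cball 0 R)"
    by (simp add: negligible_iff_null_sets null_sets_completionI null_setsI)
  have "Y d - (\<Union>d'\<in>{d<..}. Y d') \<subseteq> a -` {d} \<inter> cball 0 R"
  proof
    fix y assume y: "y \<in> Y d - (\<Union>d'\<in>{d<..}. Y d')"
    have "a y = d"
      unfolding a_def
    proof (rule cSup_eq_maximum)
      fix x assume "x \<in> insert 0 {d. 0 < d \<and> d < e \<and> y \<in> Y d}"
      then show "x \<le> d"
        using y d(1) by (auto simp: not_less[symmetric])
    qed (use y d(1) in auto)
    then show "y \<in> a -` {d} \<inter> cball 0 R"
      using y bounded[of d] d(1) by auto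
  qed
  with neg have "negligible (Y d - (\<Union>d'\<in>{d<..}. Y d'))"
    by (rule negligible_subset)
  with d(1) show ?thesis
    by (intro that[of d]) auto
qed

context causal_ball
begin

lemma maximal_ray_subset:
  assumes "maximal_ray N \<rho>0 z v \<alpha> a b" "a \<le> a'" "b' \<le> b"
  shows "maximal_ray N \<rho>0 z v \<alpha> a' b'"
proof -
  have "{a'..b'} \<subseteq> {a..b}" "{a'<..<b'} \<subseteq> {a<..<b}"
    using assms(2,3) by auto
  then show ?thesis
    using assms unit_arc_subset[of N z v "{a..b}" "{a'..b'}"]
    unfolding maximal_ray_def by (auto simp: subset_iff)
qed

text \<open>The velocity at parameter 0 is a Lipschitz function of the start because 0 lies inside
  the ray, and Gronwall's inequality transports this along the flow. The estimate thus reaches the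
  endpoints \<open>a\<close> and \<open>b\<close>, where no touching functions are
  available.\<close>

lemma maximal_ray_lipschitz:
  assumes N: "0 \<le> N" and ab: "a < 0" "0 < b" and \<rho>0: "0 < \<rho>0"
  obtains K \<rho> where "0 \<le> K" "0 < \<rho>"
    "\<And>z1 v1 \<alpha>1 z2 v2 \<alpha>2 t. \<lbrakk>maximal_ray N \<rho>0 z1 v1 \<alpha>1 a b; maximal_ray N \<rho>0 z2 v2 \<alpha>2 a b;
      norm (z1 0 - z2 0) \<le> \<rho>; t \<in> {a..b}\<rbrakk> \<Longrightarrow>
      norm (z1 t - z2 t) \<le> K * norm (z1 0 - z2 0) \<and> norm (v1 t - v2 t) \<le> K * norm (z1 0 - z2 0) \<and>
      \<bar>\<alpha>1 - \<alpha>2\<bar> \<le> K * norm (z1 0 - z2 0)"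
proof -
  \<comment> \<open>Half the smaller distance from 0 to the endpoints, so that 0 has the margin
    \<open>2 * l\<close> on both sides.\<close>
  define l where "l = min (- a) b / 2"
  have l: "0 < l" "a + 2 * l \<le> 0" "0 + 2 * l \<le> b"
    using ab by (auto simp: l_def)
  obtain C \<rho> where C: "0 \<le> C" and \<rho>: "0 < \<rho>" and
    vel: "\<And>z1 v1 \<alpha>1 a1 b1 z2 v2 \<alpha>2 a2 b2 r s. \<lbrakk>maximal_ray N \<rho>0 z1 v1 \<alpha>1 a1 b1; maximal_ray N \<rho>0 z2 v2 \<alpha>2 a2 b2;
      a1 + 2 * l \<le> r; r + 2 * l \<le> b1; a2 + 2 * l \<le> s; s + 2 * l \<le> b2; norm (z1 r - z2 s) \<le> \<rho>\<rbrakk> \<Longrightarrow>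
      norm (v1 r - v2 s) \<le> C * norm (z1 r - z2 s) \<and> \<bar>(\<alpha>1 + r) - (\<alpha>2 + s)\<bar> \<le> C * norm (z1 r - z2 s)"
    using maximal_velocity_lipschitz[OF N l(1) \<rho>0] by blast
  obtain L where flow: "\<And>z1 v1 z2 v2 a b s t. \<lbrakk>geodesic_arc z1 v1 {a..b}; geodesic_arc z2 v2 {a..b};
      \<And>r. r \<in> {a..b} \<Longrightarrow> z1 r \<in> Q \<and> z2 r \<in> Q \<and> norm (v1 r) \<le> N \<and> norm (v2 r) \<le> N;
      s \<in> {a..b}; t \<in> {a..b}\<rbrakk>
    \<Longrightarrow> norm (z1 t - z2 t, v1 t - v2 t) \<le> exp (L * \<bar>t - s\<bar>) * norm (z1 s - z2 s, v1 s - v2 s)"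
    using geodesic_flow_lipschitz by blast
  define E where "E = exp (\<bar>L\<bar> * (b - a))"
  \<comment> \<open>\<open>E * (1 + C)\<close> controls the flow from initial data whose velocity
    part is \<open>C\<close> times the position part; the extra \<open>C\<close> controls the
    offsets.\<close>
  define K where "K = E * (1 + C) + C"
  have E: "1 \<le> E" using ab by (simp add: E_def)
  have K: "0 \<le> K" using E C by (simp add: K_def)
  show ?thesis
  proof (rule that[OF K \<rho>])
    fix z1 v1 z2 v2 :: "real \<Rightarrow> 'e" and \<alpha>1 \<alpha>2 t :: real
    assume rays: "maximal_ray N \<rho>0 z1 v1 \<alpha>1 a b" "maximal_ray N \<rho>0 z2 v2 \<alpha>2 a b"
      and close: "norm (z1 0 - z2 0) \<le> \<rho>" and t: "t \<in> {a..b}"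
    let ?d = "norm (z1 0 - z2 0)"
    have v0: "norm (v1 0 - v2 0) \<le> C * ?d" "\<bar>\<alpha>1 - \<alpha>2\<bar> \<le> C * ?d"
      using vel[OF rays l(2,3) l(2,3) close] by auto
    have "norm (z1 t - z2 t, v1 t - v2 t) \<le> exp (L * \<bar>t - 0\<bar>) * norm (z1 0 - z2 0, v1 0 - v2 0)"
      by (rule flow[of z1 v1 a b z2 v2 0 t])
        (use rays t ab maximal_ray_mem[OF \<rho>0] in \<open>auto simp: maximal_ray_def unit_arc_def\<close>)
    also have "\<dots> \<le> E * (?d + C * ?d)"
    proof (intro mult_mono)
      have "L * \<bar>t - 0\<bar> \<le> \<bar>L\<bar> * (b - a)"
        using t ab by (intro mult_mono) auto
      then show "exp (L * \<bar>t - 0\<bar>) \<le> E" by (simp add: E_def)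
      show "norm (z1 0 - z2 0, v1 0 - v2 0) \<le> ?d + C * ?d"
        using norm_Pair_le[of "z1 0 - z2 0" "v1 0 - v2 0"] v0 by linarith
    qed (use E in auto)
    also have "\<dots> \<le> K * ?d"
      using C by (simp add: K_def algebra_simps)
    finally have flowed: "norm (z1 t - z2 t, v1 t - v2 t) \<le> K * ?d" .
    have "C * ?d \<le> K * ?d"
      using E C by (intro mult_right_mono) (auto simp: K_def)
    then show "norm (z1 t - z2 t) \<le> K * ?d \<and> norm (v1 t - v2 t) \<le> K * ?d \<and> \<bar>\<alpha>1 - \<alpha>2\<bar> \<le> K * ?d"
      using flowed norm_fst_le[of "z1 t - z2 t" "v1 t - v2 t"] norm_snd_le[of "v1 t - v2 t" "z1 t - z2 t"] v0
      by auto
  qed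
qed

text \<open>If the starts converge, positions, velocities and offsets are uniformly Cauchy by the
  Lipschitz estimate, without any passage to subsequences. The limit solves the geodesic equation
  because \<open>Gam\<close> is Lipschitz.\<close>

lemma closed_maximal_ray_starts:
  assumes N: "0 \<le> N" and ab: "a < 0" "0 < b" and \<rho>0: "0 < \<rho>0"
  shows "closed {z 0 |z v \<alpha>. maximal_ray N \<rho>0 z v \<alpha> a b}"
  unfolding closed_sequential_limits
proof (intro allI impI, elim conjE)
  fix y y0 assume "\<forall>n. y n \<in> {z 0 |z v \<alpha>. maximal_ray N \<rho>0 z v \<alpha> a b}" and lim: "y \<longlonglongrightarrow> y0"
  then have "\<forall>n. \<exists>z v \<alpha>. y n = z 0 \<and> maximal_ray N \<rho>0 z v \<alpha> a b"
    by (simp only: mem_Collect_eq) simp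
  then obtain z v \<alpha> where rays: "\<And>n. maximal_ray N \<rho>0 (z n) (v n) (\<alpha> n) a b" and z0: "\<And>n. z n 0 = y n"
    unfolding choice_iff by fastforce
  obtain K \<rho> where K: "0 \<le> K" and \<rho>: "0 < \<rho>" and
    lip: "\<And>z1 v1 \<alpha>1 z2 v2 \<alpha>2 t. \<lbrakk>maximal_ray N \<rho>0 z1 v1 \<alpha>1 a b; maximal_ray N \<rho>0 z2 v2 \<alpha>2 a b;
      norm (z1 0 - z2 0) \<le> \<rho>; t \<in> {a..b}\<rbrakk> \<Longrightarrow>
      norm (z1 t - z2 t) \<le> K * norm (z1 0 - z2 0) \<and> norm (v1 t - v2 t) \<le> K * norm (z1 0 - z2 0) \<and>
      \<bar>\<alpha>1 - \<alpha>2\<bar> \<le> K * norm (z1 0 - z2 0)"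
    using maximal_ray_lipschitz[OF N ab \<rho>0] by blast
  have close: "\<forall>\<^sub>F n in sequentially. \<forall>m\<ge>n. norm (y n - y m) \<le> \<epsilon>" if pos: "0 < \<epsilon>" for \<epsilon>
  proof -
    obtain n0 where "\<And>m n. m \<ge> n0 \<Longrightarrow> n \<ge> n0 \<Longrightarrow> dist (y m) (y n) < \<epsilon>"
      using LIMSEQ_imp_Cauchy[OF lim] pos unfolding Cauchy_def by blast
    then show ?thesis
      unfolding eventually_sequentially dist_norm by (meson less_imp_le order_trans)
  qed
  \<comment> \<open>One Cauchy argument for positions, velocities and offsets, all of which are
    dominated by the distances of the starts.\<close>
  have conv: "convergent (\<lambda>n. f n)"
    if f: "\<And>n m. norm (y n - y m) \<le> \<rho> \<Longrightarrow> norm (f n - f m) \<le> K * norm (y n - y m)" for f :: "nat \<Rightarrow> 'x::banach"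
  proof -
    have "Cauchy f"
    proof (rule metric_CauchyI)
      fix e :: real assume e: "0 < e"
      have pos: "0 < min \<rho> (e / (K + 1))" using \<rho> e K by simp
      obtain n0 where n0: "\<And>m n. m \<ge> n0 \<Longrightarrow> n \<ge> n0 \<Longrightarrow> dist (y m) (y n) < min \<rho> (e / (K + 1))"
        using LIMSEQ_imp_Cauchy[OF lim] pos unfolding Cauchy_def by blast
      have "dist (f m) (f n) < e" if mn: "m \<ge> n0" "n \<ge> n0" for m n
      proof -
        have "norm (y m - y n) < min \<rho> (e / (K + 1))"
          using n0[OF mn] by (simp add: dist_norm)
        then have "norm (f m - f n) \<le> K * norm (y m - y n)" "(K + 1) * norm (y m - y n) < e"
          using f[of m n] K by (auto simp: pos_less_divide_eq mult.commute)
        moreover have "K * norm (y m - y n) \<le> (K + 1) * norm (y m - y n)"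
          by (intro mult_right_mono) auto
        ultimately show ?thesis by (simp add: dist_norm)
      qed
      then show "\<exists>M. \<forall>m\<ge>M. \<forall>n\<ge>M. dist (f m) (f n) < e" by blast
    qed
    then show ?thesis by (simp add: Cauchy_convergent_iff)
  qed
  have lipn: "norm (z n t - z m t) \<le> K * norm (y n - y m)" "norm (v n t - v m t) \<le> K * norm (y n - y m)"
    "norm (\<alpha> n - \<alpha> m) \<le> K * norm (y n - y m)"
    if "norm (y n - y m) \<le> \<rho>" "t \<in> {a..b}" for n m t
    using lip[OF rays[of n] rays[of m], of t] that by (auto simp: z0)
  have "\<exists>l. (\<lambda>n. z n t) \<longlonglongrightarrow> l" "\<exists>l. (\<lambda>n. v n t) \<longlonglongrightarrow> l" if "t \<in> {a..b}" for t
    using conv[of "\<lambda>n. z n t"] conv[of "\<lambda>n. v n t"] lipn that by (auto simp: convergent_def)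
  then obtain Z V where Z: "\<And>t. t \<in> {a..b} \<Longrightarrow> (\<lambda>n. z n t) \<longlonglongrightarrow> Z t"
    and V: "\<And>t. t \<in> {a..b} \<Longrightarrow> (\<lambda>n. v n t) \<longlonglongrightarrow> V t"
    by metis
  have "convergent \<alpha>"
    using conv[of \<alpha>] lipn(3)[of _ _ 0] ab by auto
  then obtain \<alpha>0 where \<alpha>0: "\<alpha> \<longlonglongrightarrow> \<alpha>0"
    by (auto simp: convergent_def)
  have unif: "\<forall>\<^sub>F n in sequentially. \<forall>t\<in>{a..b}. norm (z n t - Z t) \<le> \<epsilon> \<and> norm (v n t - V t) \<le> \<epsilon>"
    if \<epsilon>: "0 < \<epsilon>" for \<epsilon>
  proof -
    have "0 < min \<rho> (\<epsilon> / (K + 1))" using \<rho> \<epsilon> K by simp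
    from close[OF this] show ?thesis
    proof (rule eventually_mono, intro ballI)
      fix n t assume n: "\<forall>m\<ge>n. norm (y n - y m) \<le> min \<rho> (\<epsilon> / (K + 1))" and t: "t \<in> {a..b}"
      have "K * norm (y n - y m) \<le> \<epsilon>" if "m \<ge> n" for m
      proof -
        have "K * norm (y n - y m) \<le> (K + 1) * norm (y n - y m)"
          by (intro mult_right_mono) auto
        also have "\<dots> \<le> \<epsilon>"
          using n that K by (auto simp: pos_le_divide_eq mult.commute)
        finally show ?thesis .
      qed
      then have bd: "norm (z n t - z m t) \<le> \<epsilon>" "norm (v n t - v m t) \<le> \<epsilon>" if "m \<ge> n" for m
        using lipn(1,2)[of n m t] n t that by (auto intro: order_trans)
      have "(\<lambda>m. norm (z n t - z m t)) \<longlonglongrightarrow> norm (z n t - Z t)"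
        "(\<lambda>m. norm (v n t - v m t)) \<longlonglongrightarrow> norm (v n t - V t)"
        by (intro tendsto_intros Z[OF t] V[OF t])+
      then show "norm (z n t - Z t) \<le> \<epsilon> \<and> norm (v n t - V t) \<le> \<epsilon>"
        using bd by (auto intro: LIMSEQ_le_const2)
    qed
  qed
  have arcn: "z n t \<in> U" "z n t \<in> Q" "norm (v n t) \<le> N" "g (z n t) (v n t) (v n t) = -1"
    "g (z n t) (X (z n t)) (v n t) < 0" "cball (z n t) \<rho>0 \<subseteq> Q"
    "(z n has_vector_derivative v n t) (at t within {a..b})"
    "(v n has_vector_derivative - Gam (z n t) (v n t) (v n t)) (at t within {a..b})" if "t \<in> {a..b}" for n t
    using rays[of n] that maximal_ray_mem[OF \<rho>0 rays[of n] that]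
    by (auto simp: maximal_ray_def unit_arc_def geodesic_arc_def)
  have closedQ: "closed Q" using Q by (simp add: compact_imp_closed)
  have ZQ: "Z t \<in> Q" if "t \<in> {a..b}" for t
    by (rule closed_sequentially[OF closedQ _ Z[OF that]]) (rule arcn(2)[OF that])
  have ZU: "Z t \<in> U" if "t \<in> {a..b}" for t
    using ZQ[OF that] Q by auto
  have Vn: "norm (V t) \<le> N" if "t \<in> {a..b}" for t
    by (rule LIMSEQ_le_const2[OF tendsto_norm[OF V[OF that]]]) (use arcn(3)[OF that] in blast)
  have glim: "(\<lambda>n. g (z n t) (A n) (B n)) \<longlonglongrightarrow> g (Z t) A0 B0"
    if t: "t \<in> {a..b}" and AB: "A \<longlonglongrightarrow> A0" "B \<longlonglongrightarrow> B0" for t A A0 B B0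
  proof -
    have gc: "(\<lambda>n. g (z n t) i j) \<longlonglongrightarrow> g (Z t) i j" for i j
      using isCont_tendsto_compose[OF has_derivative_continuous[OF has_derivative_g[OF ZU[OF t]]] Z[OF t]] .
    have "(\<lambda>n. \<Sum>i\<in>Basis. \<Sum>j\<in>Basis. (A n \<bullet> i) * (B n \<bullet> j) * g (z n t) i j)
        \<longlonglongrightarrow> (\<Sum>i\<in>Basis. \<Sum>j\<in>Basis. (A0 \<bullet> i) * (B0 \<bullet> j) * g (Z t) i j)"
      by (intro tendsto_intros AB gc)
    then show ?thesis
      unfolding g_expand[OF arcn(1)[OF t], symmetric] g_expand[OF ZU[OF t], symmetric] .
  qed
  have speed: "g (Z t) (V t) (V t) = -1" if "t \<in> {a..b}" for t
    using LIMSEQ_unique[OF glim[OF that V[OF that] V[OF that]]] arcn(4)[OF that] by simp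
  have future: "g (Z t) (X (Z t)) (V t) < 0" if t: "t \<in> {a..b}" for t
  proof -
    have "isCont X (Z t)"
      using X_continuous open_U ZU[OF t] by (simp add: continuous_on_eq_continuous_at)
    then have "(\<lambda>n. X (z n t)) \<longlonglongrightarrow> X (Z t)"
      by (rule isCont_tendsto_compose[OF _ Z[OF t]])
    from glim[OF t this V[OF t]] have "g (Z t) (X (Z t)) (V t) \<le> 0"
      by (rule LIMSEQ_le_const2) (use arcn(5)[OF t] in \<open>auto intro: less_imp_le\<close>)
    \<comment> \<open>Strictness is lost in the limit and regained because a timelike vector is not
      orthogonal to \<open>X\<close>.\<close>
    moreover have "g (Z t) (X (Z t)) (V t) \<noteq> 0"
      using speed[OF t] by (intro timelike_nonzero ZU[OF t] X_timelike) simp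
    ultimately show ?thesis by simp
  qed
  have Zder: "(Z has_vector_derivative V t) (at t within {a..b})" if "t \<in> {a..b}" for t
  proof (rule has_vector_derivative_uniform_limit[of a b z v V Z, OF arcn(7) _ Z that])
    show "\<forall>\<^sub>F n in sequentially. \<forall>r\<in>{a..b}. norm (v n r - V r) \<le> e" if "0 < e" for e
      using unif[OF that] by (rule eventually_mono) simp
  qed
  have Vder: "(V has_vector_derivative - Gam (Z t) (V t) (V t)) (at t within {a..b})" if "t \<in> {a..b}" for t
  proof (rule has_vector_derivative_uniform_limit[of a b v "\<lambda>n t. - Gam (z n t) (v n t) (v n t)", OF arcn(8) _ V that])
    fix e :: real assume e: "0 < e"
    define A where "A = 3 * G * N"
    define B where "B = 3 / 2 * G * N\<^sup>2 + G * (3 / 2 * G * N\<^sup>2 / \<kappa>)"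
    have AB: "0 \<le> A" "0 \<le> B" using G_pos N \<kappa>_pos by (auto simp: A_def B_def)
    \<comment> \<open>Chosen so that the bound of \<open>Gam_diff_le\<close> is at most
      \<open>\<kappa> * e\<close>; the summand 1 keeps the denominator positive.\<close>
    define \<epsilon> where "\<epsilon> = \<kappa> * e / (A + B + 1)"
    have \<epsilon>: "0 < \<epsilon>" using AB \<kappa>_pos e by (simp add: \<epsilon>_def)
    have \<epsilon>2: "A * \<epsilon> + B * \<epsilon> \<le> \<kappa> * e"
    proof -
      have "(A + B + 1) * \<epsilon> = \<kappa> * e" using AB by (simp add: \<epsilon>_def)
      then show ?thesis using \<epsilon> by (simp add: distrib_right)
    qed
    from unif[OF \<epsilon>]
    show "\<forall>\<^sub>F n in sequentially. \<forall>r\<in>{a..b}. norm (- Gam (z n r) (v n r) (v n r) - - Gam (Z r) (V r) (V r)) \<le> e"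
    proof (rule eventually_mono, intro ballI)
      fix n r assume n: "\<forall>t\<in>{a..b}. norm (z n t - Z t) \<le> \<epsilon> \<and> norm (v n t - V t) \<le> \<epsilon>" and r: "r \<in> {a..b}"
      have "\<kappa> * norm (Gam (z n r) (v n r) (v n r) - Gam (Z r) (V r) (V r))
          \<le> A * norm (v n r - V r) + B * norm (z n r - Z r)"
        unfolding A_def B_def by (rule Gam_diff_le[OF arcn(2)[OF r] ZQ[OF r] arcn(3)[OF r] Vn[OF r]])
      also have "\<dots> \<le> A * \<epsilon> + B * \<epsilon>"
        using n r AB by (intro add_mono mult_left_mono) auto
      also note \<epsilon>2
      finally have "norm (Gam (z n r) (v n r) (v n r) - Gam (Z r) (V r) (V r)) \<le> e"
        using \<kappa>_pos by simp
      then show "norm (- Gam (z n r) (v n r) (v n r) - - Gam (Z r) (V r) (V r)) \<le> e"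
        by (simp add: norm_minus_commute)
    qed
  qed
  have ball: "cball (Z t) \<rho>0 \<subseteq> Q" if t: "t \<in> {a..b}" for t
  proof
    fix x assume x: "x \<in> cball (Z t) \<rho>0"
    have "(\<lambda>n. z n t + (x - Z t)) \<longlonglongrightarrow> Z t + (x - Z t)"
      by (intro tendsto_intros Z[OF t])
    moreover have "z n t + (x - Z t) \<in> Q" for n
      using arcn(6)[OF t, of n] x by (auto simp: subset_iff dist_norm norm_minus_commute)
    ultimately show "x \<in> Q"
      using closed_sequentially[OF closedQ] by fastforce
  qed
  have \<alpha>a: "0 \<le> \<alpha>0 + a"
    by (rule LIMSEQ_le_const[OF tendsto_add[OF \<alpha>0 tendsto_const]])
      (use rays in \<open>auto simp: maximal_ray_def\<close>)
  \<comment> \<open>Continuity of \<open>u\<close> is not invoked: \<open>Z r\<close> is regarded as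
    a small displacement of \<open>z n r\<close>, and the two-sided estimate on the
    \<open>n\<close>-th ray, with constants independent of \<open>n\<close>, gives the value in the
    limit.\<close>
  have max: "u (Z r) = ennreal (\<alpha>0 + r)" if r: "r \<in> {a<..<b}" for r
  proof -
    define l where "l = min (r - a) (b - r) / 2"
    have l: "0 < l" "a + 2 * l \<le> r" "r + 2 * l \<le> b" using r by (auto simp: l_def)
    have r': "r \<in> {a..b}" using r by auto
    obtain C \<rho>' where C: "0 \<le> C" and \<rho>': "0 < \<rho>'" and
      two: "\<And>z v \<alpha> a b r h. \<lbrakk>maximal_ray N \<rho>0 z v \<alpha> a b; a + 2 * l \<le> r; r + 2 * l \<le> b; norm h \<le> \<rho>'\<rbrakk> \<Longrightarrow>
      (\<exists>w>0. u (z r + h) = ennreal w \<and> \<bar>w - (\<alpha> + r) - (- g (z r) (v r) h)\<bar> \<le> C * (norm h)\<^sup>2)"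
      using two_sided[OF N l(1) \<rho>0] by blast
    define w where "w = enn2real (u (Z r))"
    have ev: "\<forall>\<^sub>F n in sequentially. u (Z r) = ennreal w \<and>
        \<bar>w - (\<alpha> n + r) - (- g (z n r) (v n r) (Z r - z n r))\<bar> \<le> C * (norm (Z r - z n r))\<^sup>2"
      using unif[OF \<rho>']
    proof (rule eventually_mono)
      fix n assume "\<forall>t\<in>{a..b}. norm (z n t - Z t) \<le> \<rho>' \<and> norm (v n t - V t) \<le> \<rho>'"
      then have "norm (Z r - z n r) \<le> \<rho>'"
        using r' by (simp add: norm_minus_commute)
      from two[OF rays[of n] l(2,3) this]
      show "u (Z r) = ennreal w \<and>
        \<bar>w - (\<alpha> n + r) - (- g (z n r) (v n r) (Z r - z n r))\<bar> \<le> C * (norm (Z r - z n r))\<^sup>2"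
        by (auto simp: w_def)
    qed
    have h0: "(\<lambda>n. Z r - z n r) \<longlonglongrightarrow> 0"
      using tendsto_diff[OF tendsto_const[of "Z r"] Z[OF r']] by simp
    have t1: "(\<lambda>n. \<bar>w - (\<alpha> n + r) - (- g (z n r) (v n r) (Z r - z n r))\<bar>)
        \<longlonglongrightarrow> \<bar>w - (\<alpha>0 + r) - (- g (Z r) (V r) 0)\<bar>"
      by (intro tendsto_intros \<alpha>0 glim[OF r' V[OF r'] h0])
    have t2: "(\<lambda>n. C * (norm (Z r - z n r))\<^sup>2) \<longlonglongrightarrow> C * (norm (0::'e))\<^sup>2"
      by (intro tendsto_intros h0)
    have "\<bar>w - (\<alpha>0 + r) - (- g (Z r) (V r) 0)\<bar> \<le> C * (norm (0::'e))\<^sup>2"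
      by (rule tendsto_le[OF sequentially_bot t2 t1]) (use ev in \<open>auto elim: eventually_mono\<close>)
    then have "w = \<alpha>0 + r"
      using g_simps(10)[OF ZU[OF r']] by simp
    moreover have "u (Z r) = ennreal w"
      using eventually_happens[OF ev] by auto
    ultimately show ?thesis by simp
  qed
  have "maximal_ray N \<rho>0 Z V \<alpha>0 a b"
    unfolding maximal_ray_def unit_arc_def geodesic_arc_def
    using ZU Zder Vder Vn speed future ball \<alpha>a max by auto
  moreover have "Z 0 = y0"
  proof (rule LIMSEQ_unique[OF _ lim])
    show "y \<longlonglongrightarrow> Z 0"
      using Z[of 0] ab by (simp add: z0)
  qed
  ultimately show "y0 \<in> {z 0 |z v \<alpha>. maximal_ray N \<rho>0 z v \<alpha> a b}"
    by blast
qed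

lemma unit_arc_shift:
  assumes "unit_arc N z v {c + a..c + b}"
  shows "unit_arc N (\<lambda>r. z (c + r)) (\<lambda>r. v (c + r)) {a..b}"
proof -
  have shift: "((\<lambda>r. f (c + r)) has_vector_derivative f') (at r within {a..b})"
    if "(f has_vector_derivative f') (at (c + r) within {c + a..c + b})" for f f' and r :: real
  proof -
    have "((\<lambda>r. c + r) has_vector_derivative 1) (at r within {a..b})"
      by (auto intro!: derivative_eq_intros)
    from vector_diff_chain_within[OF this, of f f'] that show ?thesis
      by (simp add: o_def add.commute[of c])
  qed
  show ?thesis
    using assms unfolding unit_arc_def geodesic_arc_def by (auto intro!: shift)
qed

text \<open>Fix \<open>d\<close> such that the set of points from which the maximal ray continues exactly up to
  parameter \<open>d\<close> is negligible. Every cut point is reached from such a point by flowing for time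
  \<open>d\<close>, and on maximal rays this flow is Lipschitz in the starting point alone.\<close>

lemma negligible_cut_points:
  assumes N: "0 \<le> N" and e: "0 < e" and \<rho>0: "0 < \<rho>0"
  shows "negligible {x s |x v s \<eta>. 0 < \<eta> \<and> 2 * e \<le> s \<and> unit_arc N x v {s - 2 * e..s + \<eta>} \<and>
    (\<forall>r\<in>{s - 2 * e..s + \<eta>}. cball (x r) \<rho>0 \<subseteq> Q) \<and>
    (\<forall>r\<in>{s - 2 * e<..<s}. u (x r) = ennreal r) \<and> (\<forall>r\<in>{s<..s + \<eta>}. u (x r) \<noteq> ennreal r)}"
    (is "negligible ?cut")
proof -
  \<comment> \<open>Starts of maximal rays with room \<open>e\<close> in the past and
    \<open>d\<close> in the future. A start in \<open>Y d\<close> but in no later set is a point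
    whose remaining time is exactly \<open>d\<close>.\<close>
  define Y where "Y d = {z 0 |z v \<alpha>. maximal_ray N \<rho>0 z v \<alpha> (- e) d}" for d
  obtain R where R: "Q \<subseteq> cball 0 R"
    using compact_imp_bounded[OF Q(1)] unfolding bounded_iff by (auto simp: subset_iff)
  obtain d where d: "0 < d" "d < e" "negligible (Y d - (\<Union>d'\<in>{d<..}. Y d'))"
  proof (rule exists_negligible_level[of Y R e])
    show "closed (Y d)" if "0 < d" for d
      unfolding Y_def using N that e \<rho>0 by (intro closed_maximal_ray_starts) auto
    show "Y d' \<subseteq> Y d" if "0 < d" "d \<le> d'" for d d'
      unfolding Y_def using maximal_ray_subset[OF _ order_refl that(2)] by blast
    show "Y d \<subseteq> cball 0 R" if "0 < d" for d
      unfolding Y_def using R e that maximal_ray_mem[OF \<rho>0, where r = 0] by fastforce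
  qed (use e in auto)
  let ?K = "Y d - (\<Union>d'\<in>{d<..}. Y d')"
  have de: "- e < 0" "0 < d" using d e by auto
  obtain K \<rho> where K: "0 \<le> K" and \<rho>: "0 < \<rho>" and
    lip: "\<And>z1 v1 \<alpha>1 z2 v2 \<alpha>2 t. \<lbrakk>maximal_ray N \<rho>0 z1 v1 \<alpha>1 (- e) d; maximal_ray N \<rho>0 z2 v2 \<alpha>2 (- e) d;
      norm (z1 0 - z2 0) \<le> \<rho>; t \<in> {- e..d}\<rbrakk> \<Longrightarrow>
      norm (z1 t - z2 t) \<le> K * norm (z1 0 - z2 0) \<and> norm (v1 t - v2 t) \<le> K * norm (z1 0 - z2 0) \<and>
      \<bar>\<alpha>1 - \<alpha>2\<bar> \<le> K * norm (z1 0 - z2 0)"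
    using maximal_ray_lipschitz[OF N de \<rho>0] by blast
  have "\<forall>y\<in>?K. \<exists>p z v \<alpha>. maximal_ray N \<rho>0 z v \<alpha> (- e) d \<and> z 0 = y \<and> z d = p"
    by (auto simp: Y_def)
  \<comment> \<open>\<open>F y\<close> is the end of some ray of length \<open>d\<close> from
    \<open>y\<close>. By the Lipschitz estimate two rays with the same start have the same end, so
    the choice is immaterial.\<close>
  from bchoice[OF this] obtain F where F: "\<And>y. y \<in> ?K \<Longrightarrow> \<exists>z v \<alpha>. maximal_ray N \<rho>0 z v \<alpha> (- e) d \<and> z 0 = y \<and> z d = F y"
    by blast
  have negF: "negligible (F ` ?K)"
  proof (rule negligible_locally_Lipschitz_image[OF order_refl d(3)])
    fix y assume y: "y \<in> ?K"
    have "norm (F y' - F y) \<le> K * norm (y' - y)" if y': "y' \<in> ?K" "y' \<in> ball y \<rho>" for y'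
    proof -
      obtain z v \<alpha> where 1: "maximal_ray N \<rho>0 z v \<alpha> (- e) d" "z 0 = y" "z d = F y"
        using F[OF y] by blast
      obtain z' v' \<alpha>' where 2: "maximal_ray N \<rho>0 z' v' \<alpha>' (- e) d" "z' 0 = y'" "z' d = F y'"
        using F[OF y'(1)] by blast
      show ?thesis
        using lip[OF 2(1) 1(1), of d] y'(2) d e 1 2 by (auto simp: dist_norm norm_minus_commute)
    qed
    then show "\<exists>T B. open T \<and> y \<in> T \<and> (\<forall>y'\<in>?K \<inter> T. norm (F y' - F y) \<le> B * norm (y' - y))"
      using \<rho> by (intro exI[of _ "ball y \<rho>"] exI[of _ K]) auto
  qed
  have "?cut \<subseteq> F ` ?K"
  proof
    fix p assume "p \<in> ?cut"
    then obtain x v s \<eta> where p: "p = x s" and \<eta>: "0 < \<eta>" and s: "2 * e \<le> s"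
      and arc: "unit_arc N x v {s - 2 * e..s + \<eta>}"
      and inQ: "\<And>r. r \<in> {s - 2 * e..s + \<eta>} \<Longrightarrow> cball (x r) \<rho>0 \<subseteq> Q"
      and max: "\<And>r. r \<in> {s - 2 * e<..<s} \<Longrightarrow> u (x r) = ennreal r"
      and cut: "\<And>r. r \<in> {s<..s + \<eta>} \<Longrightarrow> u (x r) \<noteq> ennreal r"
      by blast
    \<comment> \<open>Reparametrised so that the cut point sits at parameter \<open>d\<close> and
      the offset is \<open>s - d\<close>. Since \<open>d < e\<close>, the room \<open>2 * e\<close>
      before \<open>s\<close> covers the time \<open>d\<close> back and the past \<open>e\<close>
      required of a ray.\<close>
    define z w where "z r = x ((s - d) + r)" and "w r = v ((s - d) + r)" for r
    have sub: "{(s - d) + - e..(s - d) + (d + \<eta>)} \<subseteq> {s - 2 * e..s + \<eta>}"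
      using d by auto
    have arcz: "unit_arc N z w {- e..d + \<eta>}"
      unfolding z_def w_def by (intro unit_arc_shift unit_arc_subset[OF arc sub])
    have zQ: "cball (z r) \<rho>0 \<subseteq> Q" if "r \<in> {- e..d + \<eta>}" for r
      unfolding z_def using that d by (intro inQ) auto
    have ray: "maximal_ray N \<rho>0 z w (s - d) (- e) d"
      unfolding maximal_ray_def
    proof (intro conjI ballI)
      show "unit_arc N z w {- e..d}"
        by (rule unit_arc_subset[OF arcz]) (use \<eta> in auto)
      show "cball (z r) \<rho>0 \<subseteq> Q" if "r \<in> {- e..d}" for r
        using that \<eta> by (intro zQ) auto
      show "0 \<le> s - d + - e" using s d by simp
      show "u (z r) = ennreal (s - d + r)" if "r \<in> {- e<..<d}" for r
        unfolding z_def using that d by (intro max) auto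
    qed
    \<comment> \<open>A longer ray from \<open>z 0\<close> would have the same velocity and offset
      there, hence coincide with \<open>z\<close> beyond \<open>d\<close> and realise
      \<open>u\<close> after the cut point.\<close>
    have "z 0 \<notin> Y d'" if d': "d < d'" for d'
    proof
      assume "z 0 \<in> Y d'"
      then obtain z' w' \<alpha>' where ray': "maximal_ray N \<rho>0 z' w' \<alpha>' (- e) d'" and z'0: "z' 0 = z 0"
        by (auto simp: Y_def)
      have ray'd: "maximal_ray N \<rho>0 z' w' \<alpha>' (- e) d"
        using ray' d' by (intro maximal_ray_subset[OF ray']) auto
      have eq: "w' 0 = w 0" "\<alpha>' = s - d"
        using lip[OF ray'd ray, of 0] z'0 \<rho> de by auto
      \<comment> \<open>Up to \<open>d''\<close> both arcs exist; the midpoint \<open>r\<close> lies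
        strictly after \<open>d\<close>, where \<open>cut\<close> applies, and strictly before
        \<open>d'\<close>, where the other ray is maximal.\<close>
      define d'' where "d'' = min d' (d + \<eta>)"
      have d'': "d < d''" "d'' \<le> d'" "d'' \<le> d + \<eta>"
        using d' \<eta> by (auto simp: d''_def)
      have arcs: "unit_arc N z w {- e..d''}" "unit_arc N z' w' {- e..d''}"
        using unit_arc_subset[OF arcz] ray' d'' unfolding maximal_ray_def
        by (auto intro: unit_arc_subset)
      define r where "r = (d + d'') / 2"
      have r: "d < r" "r < d''" using d'' by (auto simp: r_def)
      obtain L where flow: "\<And>z1 v1 z2 v2 a b s t. \<lbrakk>geodesic_arc z1 v1 {a..b}; geodesic_arc z2 v2 {a..b};
          \<And>r. r \<in> {a..b} \<Longrightarrow> z1 r \<in> Q \<and> z2 r \<in> Q \<and> norm (v1 r) \<le> N \<and> norm (v2 r) \<le> N;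
          s \<in> {a..b}; t \<in> {a..b}\<rbrakk>
        \<Longrightarrow> norm (z1 t - z2 t, v1 t - v2 t) \<le> exp (L * \<bar>t - s\<bar>) * norm (z1 s - z2 s, v1 s - v2 s)"
        using geodesic_flow_lipschitz by blast
      have "norm (z r - z' r, w r - w' r) \<le> exp (L * \<bar>r - 0\<bar>) * norm (z 0 - z' 0, w 0 - w' 0)"
      proof (rule flow[of z w "- e" d'' z' w' 0 r])
        fix t assume t: "t \<in> {- e..d''}"
        have "z t \<in> Q"
          using zQ[of t] t d'' \<rho>0 by (meson atLeastAtMost_iff centre_in_cball less_imp_le order_trans subsetD)
        moreover have "z' t \<in> Q"
          using maximal_ray_mem[OF \<rho>0 ray', of t] t d'' by auto
        ultimately show "z t \<in> Q \<and> z' t \<in> Q \<and> norm (w t) \<le> N \<and> norm (w' t) \<le> N"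
          using arcs t by (auto simp: unit_arc_def)
      qed (use arcs r d e in \<open>auto simp: unit_arc_def\<close>)
      then have "z r = z' r"
        using z'0 eq by (simp add: zero_prod_def)
      moreover have "u (z' r) = ennreal (\<alpha>' + r)"
        using ray' r d'' de by (auto simp: maximal_ray_def)
      moreover have "u (z r) \<noteq> ennreal (s - d + r)"
        unfolding z_def using r d'' by (intro cut) auto
      ultimately show False using eq by simp
    qed
    then have y: "z 0 \<in> ?K"
      using ray by (auto simp: Y_def)
    obtain z' v' \<alpha>' where ray': "maximal_ray N \<rho>0 z' v' \<alpha>' (- e) d" "z' 0 = z 0" "z' d = F (z 0)"
      using F[OF y] by blast
    have "F (z 0) = z d"
      using lip[OF ray'(1) ray, of d] ray'(2,3) de \<rho> by auto
    then have "p = F (z 0)"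
      by (simp add: p z_def)
    with y show "p \<in> F ` ?K" by blast
  qed
  with negF show ?thesis by (rule negligible_subset)
qed

end

section \<open>Exhaustion of the cut set in a chart\<close>

context causal_patch
begin

text \<open>Negligibility is a local property, so a small ball around a given cut point suffices.
  There every cut point has some bound on its velocity and some room before it, and these are made
  uniform by a countable index.\<close>

theorem negligible_cut_locus:
  "negligible {x s |x v s \<eta>. 0 < \<eta> \<and> \<eta> < s \<and> geodesic_arc x v {s - \<eta><..<s + \<eta>} \<and>
    (\<forall>r\<in>{s - \<eta><..<s + \<eta>}. g (x r) (v r) (v r) = -1 \<and> g (x r) (X (x r)) (v r) < 0) \<and>
    (\<forall>r\<in>{s - \<eta><..<s}. u (x r) = ennreal r) \<and> (\<forall>r\<in>{s<..<s + \<eta>}. u (x r) \<noteq> ennreal r)}"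
    (is "negligible ?cut")
  unfolding locally_negligible_alt[of ?cut]
proof
  fix p assume p: "p \<in> ?cut"
  then have "p \<in> U"
    by (auto simp: geodesic_arc_def)
  then obtain R0 where R0: "0 < R0" "cball p R0 \<subseteq> U"
    using open_U open_contains_cball by blast
  \<comment> \<open>Balls of radius \<open>R\<close> around points of \<open>ball p R\<close> stay
    in \<open>cball p (2 * R)\<close>; this is the room \<open>\<rho>0\<close> for
    displacements.\<close>
  define R where "R = R0 / 2"
  have R: "0 < R" "cball p (2 * R) \<subseteq> U" using R0 by (auto simp: R_def)
  obtain G \<kappa> where "lorentz_ball U g (cball p (2 * R)) G \<kappa>"
    using ball_constants[OF compact_cball convex_cball R(2)] .
  then interpret lorentz_ball U g "cball p (2 * R)" G \<kappa> .
  interpret causal_ball U g X u "cball p (2 * R)" G \<kappa> ..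
  \<comment> \<open>One index serves two purposes: the room \<open>2 * e n\<close> shrinks to 0
    while the velocity bound \<open>n\<close> grows.\<close>
  define e where "e n = 1 / (real n + 1)" for n :: nat
  have e: "0 < e n" for n by (simp add: e_def)
  define C where "C n = {x s |x v s \<eta>. 0 < \<eta> \<and> 2 * e n \<le> s \<and> unit_arc (real n) x v {s - 2 * e n..s + \<eta>} \<and>
    (\<forall>r\<in>{s - 2 * e n..s + \<eta>}. cball (x r) R \<subseteq> cball p (2 * R)) \<and>
    (\<forall>r\<in>{s - 2 * e n<..<s}. u (x r) = ennreal r) \<and> (\<forall>r\<in>{s<..s + \<eta>}. u (x r) \<noteq> ennreal r)}" for n
  have "negligible (\<Union>n. C n)"
    unfolding C_def by (intro negligible_Union_nat negligible_cut_points e R) simp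
  moreover have "?cut \<inter> ball p R \<subseteq> (\<Union>n. C n)"
  proof
    fix q assume q: "q \<in> ?cut \<inter> ball p R"
    then obtain x v s \<eta> where qx: "q = x s" and \<eta>: "0 < \<eta>" "\<eta> < s"
      and arc: "geodesic_arc x v {s - \<eta><..<s + \<eta>}"
      and unit: "\<And>r. r \<in> {s - \<eta><..<s + \<eta>} \<Longrightarrow> g (x r) (v r) (v r) = -1 \<and> g (x r) (X (x r)) (v r) < 0"
      and max: "\<And>r. r \<in> {s - \<eta><..<s} \<Longrightarrow> u (x r) = ennreal r"
      and cut: "\<And>r. r \<in> {s<..<s + \<eta>} \<Longrightarrow> u (x r) \<noteq> ennreal r"
      by blast
    have "isCont x s"
      using geodesic_arc_continuous(1)[OF arc] \<eta> by (simp add: continuous_on_eq_continuous_at)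
    moreover have "x s \<in> ball p R" using q qx by simp
    ultimately have "\<forall>\<^sub>F r in at s. x r \<in> ball p R"
      unfolding isCont_def using open_ball topological_tendstoD by blast
    then obtain \<delta>0 where \<delta>0: "0 < \<delta>0" "\<And>r. r \<noteq> s \<Longrightarrow> dist r s < \<delta>0 \<Longrightarrow> x r \<in> ball p R"
      unfolding eventually_at by blast
    define \<delta> where "\<delta> = min \<delta>0 \<eta> / 2"
    have \<delta>: "0 < \<delta>" "\<delta> < \<eta>" "\<delta> < \<delta>0" using \<delta>0 \<eta> by (auto simp: \<delta>_def)
    have near: "x r \<in> ball p R" if "r \<in> {s - \<delta>..s + \<delta>}" for r
      using \<delta>0(2)[of r] \<open>x s \<in> ball p R\<close> that \<delta> by (cases "r = s") (auto simp: dist_real_def)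
    have sub: "{s - \<delta>..s + \<delta>} \<subseteq> {s - \<eta><..<s + \<eta>}" using \<delta> by auto
    have "compact (v ` {s - \<delta>..s + \<delta>})"
      using geodesic_arc_continuous(2)[OF geodesic_arc_subset[OF arc sub]]
      by (intro compact_continuous_image) auto
    then have "bounded (v ` {s - \<delta>..s + \<delta>})"
      by (rule compact_imp_bounded)
    then obtain N where N: "\<And>r. r \<in> {s - \<delta>..s + \<delta>} \<Longrightarrow> norm (v r) \<le> N"
      unfolding bounded_iff by (metis image_eqI)
    obtain n :: nat where n: "max N (2 / \<delta>) < real n"
      using reals_Archimedean2 by blast
    have en: "2 * e n \<le> \<delta>"
    proof -
      have "2 / \<delta> < real n + 1" using n by simp
      then show ?thesis using \<delta> by (simp add: e_def field_simps)
    qed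
    have sub2: "{s - 2 * e n..s + \<delta>} \<subseteq> {s - \<delta>..s + \<delta>}" using en by auto
    have "q \<in> C n"
      unfolding C_def mem_Collect_eq
    proof (intro exI conjI ballI)
      show "q = x s" by (rule qx)
      show "0 < \<delta>" by fact
      show "2 * e n \<le> s" using en \<delta> \<eta> by simp
      show "unit_arc (real n) x v {s - 2 * e n..s + \<delta>}"
        unfolding unit_arc_def
      proof (intro conjI ballI)
        show "geodesic_arc x v {s - 2 * e n..s + \<delta>}"
          using sub sub2 by (intro geodesic_arc_subset[OF arc]) blast
        fix r assume r: "r \<in> {s - 2 * e n..s + \<delta>}"
        show "norm (v r) \<le> real n" using N[of r] r sub2 n by fastforce
        show "g (x r) (v r) (v r) = -1" "g (x r) (X (x r)) (v r) < 0"
          using unit[of r] r \<delta>(2) en by auto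
      qed
      show "cball (x r) R \<subseteq> cball p (2 * R)" if "r \<in> {s - 2 * e n..s + \<delta>}" for r
      proof -
        have "dist p (x r) \<le> R" using near[of r] that sub2 by auto
        then show ?thesis
          using dist_triangle[of p _ "x r"] by (auto simp: subset_iff) (smt (verit))
      qed
      show "u (x r) = ennreal r" if "r \<in> {s - 2 * e n<..<s}" for r
        using that en \<delta> by (intro max) auto
      show "u (x r) \<noteq> ennreal r" if "r \<in> {s<..s + \<delta>}" for r
        using that \<delta> by (intro cut) auto
    qed
    then show "q \<in> (\<Union>n. C n)" by blast
  qed
  ultimately have "negligible (?cut \<inter> ball p R)"
    by (rule negligible_subset)
  moreover have "openin (top_of_set ?cut) (?cut \<inter> ball p R)" "p \<in> ?cut \<inter> ball p R"
    using p R(1) by (auto simp: openin_open_Int)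
  ultimately show "\<exists>V. openin (top_of_set ?cut) V \<and> p \<in> V \<and> negligible V"
    by blast
qed

end

section \<open>Calculus of locally Lipschitz maps\<close>

lemma Ck_on_locally_lipschitz:
  fixes f :: "'a::euclidean_space \<Rightarrow> 'b::real_normed_vector"
  assumes f: "Ck_on (Suc 0) f W" and W: "open W"
  shows "locally_lipschitz_on f W"
  unfolding locally_lipschitz_on_def
proof
  fix x assume "x \<in> W"
  then obtain r where r: "0 < r" "cball x r \<subseteq> W"
    using W open_contains_cball by blast
  have der: "(f has_derivative frechet_derivative f (at y)) (at y)" if "y \<in> W" for y
    using f that by (simp add: frechet_derivative_works[symmetric])
  have "\<exists>B. \<forall>y\<in>cball x r. norm (frechet_derivative f (at y) v) \<le> B" for v
  proof -
    have "continuous_on (cball x r) (\<lambda>y. frechet_derivative f (at y) v)"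
      using f r(2) by (auto intro: continuous_on_subset)
    from compact_imp_bounded[OF compact_continuous_image[OF this compact_cball]]
    show ?thesis by (auto simp: bounded_iff)
  qed
  then obtain B where B: "\<And>v y. y \<in> cball x r \<Longrightarrow> norm (frechet_derivative f (at y) v) \<le> B v"
    by metis
  \<comment> \<open>\<open>Ck_on\<close> controls each directional derivative separately; summing
    the bounds over a basis controls the operator norm.\<close>
  define L where "L = (\<Sum>i\<in>Basis. \<bar>B i\<bar>)"
  have on: "onorm (frechet_derivative f (at y)) \<le> L" if y: "y \<in> cball x r" for y
  proof (rule onorm_le)
    fix v :: 'a
    have lin: "linear (frechet_derivative f (at y))"
      using der y r(2) has_derivative_linear by blast
    have "frechet_derivative f (at y) v = (\<Sum>i\<in>Basis. (v \<bullet> i) *\<^sub>R frechet_derivative f (at y) i)"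
      using linear_sum[OF lin, of "\<lambda>i. (v \<bullet> i) *\<^sub>R i" Basis] linear_cmul[OF lin]
      by (simp add: euclidean_representation)
    also have "norm \<dots> \<le> (\<Sum>i\<in>Basis. norm v * \<bar>B i\<bar>)"
    proof (rule sum_norm_le)
      fix i :: 'a assume "i \<in> Basis"
      then show "norm ((v \<bullet> i) *\<^sub>R frechet_derivative f (at y) i) \<le> norm v * \<bar>B i\<bar>"
        using B[OF y, of i] by (auto intro!: mult_mono Basis_le_norm)
    qed
    finally show "norm (frechet_derivative f (at y) v) \<le> L * norm v"
      by (simp add: L_def sum_distrib_left mult.commute)
  qed
  have "L-lipschitz_on (cball x r) f"
  proof (rule lipschitz_onI)
    fix y z assume "y \<in> cball x r" "z \<in> cball x r"
    moreover have "(f has_derivative frechet_derivative f (at w)) (at w within cball x r)" if "w \<in> cball x r" for w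
      by (rule has_derivative_at_withinI[OF der]) (use that r(2) in blast)
    ultimately show "dist (f y) (f z) \<le> L * dist y z"
      unfolding dist_norm by (intro differentiable_bound[OF convex_cball _ on])
  qed (simp add: L_def sum_nonneg)
  then have "L-lipschitz_on (cball x r \<inter> W) f"
    by (rule lipschitz_on_subset) auto
  with r(1) show "\<exists>r>0. \<exists>L. L-lipschitz_on (cball x r \<inter> W) f"
    by blast
qed

lemma locally_lipschitz_on_compose:
  assumes f: "locally_lipschitz_on f S" and h: "locally_lipschitz_on h T"
    and fT: "f ` S \<subseteq> T"
  shows "locally_lipschitz_on (h \<circ> f) S"
  unfolding locally_lipschitz_on_def
proof
  fix x assume x: "x \<in> S"
  obtain r L where r: "0 < r" and L: "L-lipschitz_on (cball x r \<inter> S) f"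
    using f x unfolding locally_lipschitz_on_def by blast
  obtain r' L' where r': "0 < r'" and L': "L'-lipschitz_on (cball (f x) r' \<inter> T) h"
    using h x fT unfolding locally_lipschitz_on_def by blast
  have L0: "0 \<le> L" using L by (rule lipschitz_on_nonneg)
  \<comment> \<open>Shrunk so that \<open>f\<close> stays in the ball on which \<open>h\<close> is
    Lipschitz; \<open>L + 1\<close> keeps the quotient meaningful for \<open>L = 0\<close>.\<close>
  define \<delta> where "\<delta> = min r (r' / (L + 1))"
  have \<delta>: "0 < \<delta>" "\<delta> \<le> r" "\<delta> \<le> r' / (L + 1)"
    using r r' L0 by (auto simp: \<delta>_def)
  then have \<delta>': "(L + 1) * \<delta> \<le> r'"
    using L0 by (simp add: pos_le_divide_eq mult.commute)
  have sub: "f ` (cball x \<delta> \<inter> S) \<subseteq> cball (f x) r' \<inter> T"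
  proof (intro subsetI, elim imageE)
    fix z y assume z: "z = f y" and y: "y \<in> cball x \<delta> \<inter> S"
    have "dist (f x) (f y) \<le> L * dist x y"
      by (rule lipschitz_onD[OF L]) (use x y r \<delta> in auto)
    also have "\<dots> \<le> (L + 1) * \<delta>"
      using y L0 \<delta> by (intro mult_mono) auto
    finally show "z \<in> cball (f x) r' \<inter> T"
      using z y \<delta>' fT by auto
  qed
  have "(L' * L)-lipschitz_on (cball x \<delta> \<inter> S) (h \<circ> f)"
    by (rule lipschitz_on_compose[OF lipschitz_on_subset[OF L] lipschitz_on_subset[OF L' sub]])
      (use \<delta> in auto)
  with \<delta>(1) show "\<exists>r>0. \<exists>L. L-lipschitz_on (cball x r \<inter> S) (h \<circ> f)"
    by blast
qed

lemma locally_lipschitz_on_cong: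
  assumes "locally_lipschitz_on f S" "\<And>x. x \<in> S \<Longrightarrow> f x = h x"
  shows "locally_lipschitz_on h S"
  using assms unfolding locally_lipschitz_on_def lipschitz_on_def by (metis IntD2)

lemma locally_lipschitz_on_subset:
  "locally_lipschitz_on f S \<Longrightarrow> T \<subseteq> S \<Longrightarrow> locally_lipschitz_on f T"
  unfolding locally_lipschitz_on_def by (meson Int_mono lipschitz_on_subset order_refl subsetD)

text \<open>For points on different sides of \<open>b\<close> the distance on the line splits at
  \<open>b\<close>, so the two Lipschitz bounds add up.\<close>

lemma locally_lipschitz_on_glue:
  fixes f :: "real \<Rightarrow> 'a::metric_space"
  assumes l: "locally_lipschitz_on f (S \<inter> {..b})" and r: "locally_lipschitz_on f (S \<inter> {b..})"
  shows "locally_lipschitz_on f S"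
  unfolding locally_lipschitz_on_def
proof
  fix x assume x: "x \<in> S"
  consider "x < b" | "b < x" | "x = b" by linarith
  then show "\<exists>r>0. \<exists>L. L-lipschitz_on (cball x r \<inter> S) f"
  proof cases
    case 1
    then obtain \<delta> L where \<delta>: "0 < \<delta>" "L-lipschitz_on (cball x \<delta> \<inter> (S \<inter> {..b})) f"
      using l x unfolding locally_lipschitz_on_def by force
    have "L-lipschitz_on (cball x (min \<delta> (b - x)) \<inter> S) f"
      by (rule lipschitz_on_subset[OF \<delta>(2)]) (auto simp: dist_real_def)
    then show ?thesis using \<delta>(1) 1 by (intro exI[of _ "min \<delta> (b - x)"]) auto
  next
    case 2
    then obtain \<delta> L where \<delta>: "0 < \<delta>" "L-lipschitz_on (cball x \<delta> \<inter> (S \<inter> {b..})) f"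
      using r x unfolding locally_lipschitz_on_def by force
    have "L-lipschitz_on (cball x (min \<delta> (x - b)) \<inter> S) f"
      by (rule lipschitz_on_subset[OF \<delta>(2)]) (auto simp: dist_real_def)
    then show ?thesis using \<delta>(1) 2 by (intro exI[of _ "min \<delta> (x - b)"]) auto
  next
    case 3
    obtain \<delta>1 L1 where 1: "0 < \<delta>1" "L1-lipschitz_on (cball x \<delta>1 \<inter> (S \<inter> {..b})) f"
      using l x 3 unfolding locally_lipschitz_on_def by force
    obtain \<delta>2 L2 where 2: "0 < \<delta>2" "L2-lipschitz_on (cball x \<delta>2 \<inter> (S \<inter> {b..})) f"
      using r x 3 unfolding locally_lipschitz_on_def by force
    define \<delta> where "\<delta> = min \<delta>1 \<delta>2"
    define L where "L = L1 + L2"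
    have L: "0 \<le> L1" "0 \<le> L2" using 1 2 lipschitz_on_nonneg by blast+
    have left: "dist (f s) (f t) \<le> L * dist s t" if "s \<in> cball x \<delta> \<inter> S" "t \<in> cball x \<delta> \<inter> S" "s \<le> b" "t \<le> b" for s t
    proof -
      have "dist (f s) (f t) \<le> L1 * dist s t"
        by (rule lipschitz_onD[OF 1(2)]) (use that in \<open>auto simp: \<delta>_def\<close>)
      also have "\<dots> \<le> L * dist s t" using L by (intro mult_right_mono) (auto simp: L_def)
      finally show ?thesis .
    qed
    have right: "dist (f s) (f t) \<le> L * dist s t" if "s \<in> cball x \<delta> \<inter> S" "t \<in> cball x \<delta> \<inter> S" "b \<le> s" "b \<le> t" for s t
    proof -
      have "dist (f s) (f t) \<le> L2 * dist s t"
        by (rule lipschitz_onD[OF 2(2)]) (use that in \<open>auto simp: \<delta>_def\<close>)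
      also have "\<dots> \<le> L * dist s t" using L by (intro mult_right_mono) (auto simp: L_def)
      finally show ?thesis .
    qed
    have bm: "b \<in> cball x \<delta> \<inter> S" using x 3 1 2 by (simp add: \<delta>_def)
    have mixed: "dist (f s) (f t) \<le> L * dist s t"
      if "s \<in> cball x \<delta> \<inter> S" "t \<in> cball x \<delta> \<inter> S" "s \<le> b" "b \<le> t" for s t
    proof -
      have "dist (f s) (f t) \<le> dist (f s) (f b) + dist (f b) (f t)"
        by (rule dist_triangle)
      also have "\<dots> \<le> L * dist s b + L * dist b t"
        by (intro add_mono left right) (use that bm in auto)
      also have "\<dots> = L * dist s t"
        using that by (simp add: dist_real_def algebra_simps)
      finally show ?thesis .
    qed
    have "L-lipschitz_on (cball x \<delta> \<inter> S) f"
    proof (rule lipschitz_onI)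
      fix s t assume st: "s \<in> cball x \<delta> \<inter> S" "t \<in> cball x \<delta> \<inter> S"
      show "dist (f s) (f t) \<le> L * dist s t"
        using left[OF st] right[OF st] mixed[OF st] mixed[OF st(2,1)]
        by (cases "s \<le> b"; cases "t \<le> b") (auto simp: dist_commute)
    qed (use L in \<open>simp add: L_def\<close>)
    then show ?thesis using 1(1) 2(1) by (intro exI[of _ \<delta>]) (auto simp: \<delta>_def)
  qed
qed

section \<open>Charts and tangent vectors\<close>

locale spacetime_setting =
  fixes M :: "('m::{t2_space, second_countable_topology}, 'e::euclidean_space) spacetime"
  assumes smooth: "smooth_structure (atlas M)"
    and lorentzian: "lorentzian_metric M"
    and C11: "C11_metric M"
    and oriented: "time_oriented M"
begin

lemma chart:
  assumes "c \<in> atlas M"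
  shows open_dom: "open (chart_dom c)" and open_img: "open (chart_img c)"
    and cont_map: "continuous_on (chart_dom c) (chart_map c)"
    and cont_inv: "continuous_on (chart_img c) (chart_inv c)"
    and inv_map: "p \<in> chart_dom c \<Longrightarrow> chart_inv c (chart_map c p) = p"
    and map_inv: "x \<in> chart_img c \<Longrightarrow> chart_map c (chart_inv c x) = x"
    and inv_dom: "x \<in> chart_img c \<Longrightarrow> chart_inv c x \<in> chart_dom c"
    and map_img: "p \<in> chart_dom c \<Longrightarrow> chart_map c p \<in> chart_img c"
proof -
  have "is_chart c"
    using smooth assms unfolding smooth_structure_def by blast
  then have 1: "open (chart_dom c)" "open (chart_img c)"
    and h: "homeomorphism (chart_dom c) (chart_img c) (chart_map c) (chart_inv c)"
    by (auto simp: is_chart_def)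
  show "open (chart_dom c)" "open (chart_img c)" by (fact 1)+
  show "continuous_on (chart_dom c) (chart_map c)" "continuous_on (chart_img c) (chart_inv c)"
    "p \<in> chart_dom c \<Longrightarrow> chart_inv c (chart_map c p) = p"
    "x \<in> chart_img c \<Longrightarrow> chart_map c (chart_inv c x) = x"
    "x \<in> chart_img c \<Longrightarrow> chart_inv c x \<in> chart_dom c"
    "p \<in> chart_dom c \<Longrightarrow> chart_map c p \<in> chart_img c"
    using h by (auto simp: homeomorphism_def)
qed

lemma charts_atD: "c \<in> charts_at (atlas M) p \<Longrightarrow> c \<in> atlas M" "c \<in> charts_at (atlas M) p \<Longrightarrow> p \<in> chart_dom c"
  by (auto simp: charts_at_def)

lemma charts_atI: "c \<in> atlas M \<Longrightarrow> p \<in> chart_dom c \<Longrightarrow> c \<in> charts_at (atlas M) p"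
  by (auto simp: charts_at_def)

lemma exists_chart: obtains c where "c \<in> charts_at (atlas M) p"
proof -
  have "p \<in> (\<Union>c\<in>atlas M. chart_dom c)"
    using smooth unfolding smooth_structure_def by blast
  then show ?thesis using that charts_atI by blast
qed

definition overlap :: "('m, 'e) chart \<Rightarrow> ('m, 'e) chart \<Rightarrow> 'e set" where
  "overlap c d = chart_map c ` (chart_dom c \<inter> chart_dom d)"

lemma overlap_eq:
  assumes "c \<in> atlas M" "d \<in> atlas M"
  shows "overlap c d = {x \<in> chart_img c. chart_inv c x \<in> chart_dom d}"
  using inv_map[OF assms(1)] map_inv[OF assms(1)] inv_dom[OF assms(1)] map_img[OF assms(1)]
  unfolding overlap_def by (auto simp: image_iff) (metis Int_iff)

lemma open_overlap:
  assumes "c \<in> atlas M" "d \<in> atlas M"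
  shows "open (overlap c d)"
proof -
  have "overlap c d = chart_img c \<inter> chart_inv c -` chart_dom d"
    by (auto simp: overlap_eq[OF assms])
  then show ?thesis
    using continuous_open_preimage[OF cont_inv[OF assms(1)] open_img[OF assms(1)] open_dom[OF assms(2)]]
    by simp
qed

lemma in_overlap: "c \<in> charts_at (atlas M) p \<Longrightarrow> d \<in> charts_at (atlas M) p \<Longrightarrow> chart_map c p \<in> overlap c d"
  by (auto simp: overlap_def charts_at_def)

lemma transition_C1:
  assumes "c \<in> atlas M" "d \<in> atlas M"
  shows "Ck_on (Suc 0) (transition c d) (overlap c d)"
  using smooth assms unfolding smooth_structure_def smoothly_compatible_def smooth_on_def overlap_def
  by blast

abbreviation dtr :: "('m, 'e) chart \<Rightarrow> ('m, 'e) chart \<Rightarrow> 'e \<Rightarrow> 'e \<Rightarrow> 'e" where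
  "dtr c d x \<equiv> frechet_derivative (transition c d) (at x)"

lemma transition_derivative:
  assumes "c \<in> charts_at (atlas M) p" "d \<in> charts_at (atlas M) p"
  shows "(transition c d has_derivative dtr c d (chart_map c p)) (at (chart_map c p))"
  using transition_C1[of c d] in_overlap[OF assms] charts_atD[OF assms(1)] charts_atD[OF assms(2)]
  by (simp add: frechet_derivative_works[symmetric])

lemma transition_map: "c \<in> atlas M \<Longrightarrow> p \<in> chart_dom c \<Longrightarrow> transition c d (chart_map c p) = chart_map d p"
  by (simp add: transition_def inv_map)

lemma dtr_self:
  assumes "c \<in> charts_at (atlas M) p"
  shows "dtr c c (chart_map c p) u = u"
proof -
  have c: "c \<in> atlas M" "p \<in> chart_dom c" using charts_atD[OF assms] by auto
  have "((\<lambda>x. x) has_derivative (\<lambda>x. x)) (at (chart_map c p))"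
    by (rule has_derivative_ident)
  then have "(transition c c has_derivative (\<lambda>x. x)) (at (chart_map c p))"
    by (rule has_derivative_transform_within_open[OF _ open_img[OF c(1)] map_img[OF c]])
      (simp add: transition_def map_inv[OF c(1)])
  then show ?thesis
    using has_derivative_unique[OF transition_derivative[OF assms assms]] by metis
qed

text \<open>The chain rule for transition maps; it makes the family defined by
  \<open>tvec_of\<close> consistent across all charts.\<close>

lemma dtr_compose:
  assumes c: "c \<in> charts_at (atlas M) p" and d: "d \<in> charts_at (atlas M) p" and e: "e \<in> charts_at (atlas M) p"
  shows "dtr d e (chart_map d p) (dtr c d (chart_map c p) u) = dtr c e (chart_map c p) u"
proof -
  note cA = charts_atD[OF c] and dA = charts_atD[OF d] and eA = charts_atD[OF e]
  have "(transition d e has_derivative dtr d e (chart_map d p)) (at (transition c d (chart_map c p)))"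
    using transition_derivative[OF d e] transition_map[OF cA] by simp
  from diff_chain_at[OF transition_derivative[OF c d] this]
  have "((transition d e \<circ> transition c d) has_derivative
      (dtr d e (chart_map d p) \<circ> dtr c d (chart_map c p))) (at (chart_map c p))" .
  then have "(transition c e has_derivative
      (dtr d e (chart_map d p) \<circ> dtr c d (chart_map c p))) (at (chart_map c p))"
  proof (rule has_derivative_transform_within_open[OF _ open_overlap[OF cA(1) dA(1)] in_overlap[OF c d]])
    fix x assume "x \<in> overlap c d"
    then show "(transition d e \<circ> transition c d) x = transition c e x"
      using cA dA by (auto simp: overlap_def transition_def inv_map)
  qed
  from has_derivative_unique[OF this transition_derivative[OF c e]]
  show ?thesis by (metis comp_apply)
qed

lemma tvec_of_in:
  assumes "c \<in> charts_at (atlas M) p"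
  shows "tvec_of (atlas M) c p u \<in> tangent_space (atlas M) p"
  unfolding tangent_space_def tvec_of_def using dtr_compose[OF assms] by auto

lemma tvec_of_chart: "c \<in> charts_at (atlas M) p \<Longrightarrow> tvec_of (atlas M) c p u c = u"
  by (simp add: tvec_of_def dtr_self)

lemma tvec_of_coord:
  assumes "c \<in> charts_at (atlas M) p" "v \<in> tangent_space (atlas M) p"
  shows "tvec_of (atlas M) c p (v c) = v"
proof
  fix d
  show "tvec_of (atlas M) c p (v c) d = v d"
  proof (cases "d \<in> charts_at (atlas M) p")
    case True
    with assms have "v d = dtr c d (chart_map c p) (v c)"
      unfolding tangent_space_def by blast
    with True show ?thesis by (simp add: tvec_of_def)
  next
    case False
    with assms have "v d = 0" unfolding tangent_space_def by blast
    with False show ?thesis by (simp add: tvec_of_def)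
  qed
qed

lemma tangent_eqI:
  assumes "c \<in> charts_at (atlas M) p" "v \<in> tangent_space (atlas M) p" "w \<in> tangent_space (atlas M) p" "v c = w c"
  shows "v = w"
  using tvec_of_coord[OF assms(1)] assms by metis

lemma metric_chart:
  assumes "c \<in> charts_at (atlas M) p" "v \<in> tangent_space (atlas M) p" "w \<in> tangent_space (atlas M) p"
  shows "metric M p v w = metric_in M c (chart_map c p) (v c) (w c)"
  using assms inv_map charts_atD[OF assms(1)] by (simp add: metric_in_def tvec_of_coord)

lemma patch: "c \<in> atlas M \<Longrightarrow> lorentz_patch (chart_img c) (metric_in M c)"
  by unfold_locales (use open_img lorentzian C11 in \<open>auto simp: lorentzian_metric_def C11_metric_def\<close>)

lemma christoffel_Gam: "c \<in> atlas M \<Longrightarrow> christoffel M c = lorentz_patch.Gam (metric_in M c)"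
  by (intro ext) (simp add: christoffel_def lorentz_patch.Gam_def[OF patch] lorentz_patch.dg_def[OF patch])

lemma has_velocity_unique:
  assumes "has_velocity (atlas M) \<gamma> t v" "has_velocity (atlas M) \<gamma> t w"
  shows "v = w"
proof -
  obtain c where c: "c \<in> charts_at (atlas M) (\<gamma> t)" by (rule exists_chart)
  then have "v c = w c"
    using assms vector_derivative_unique_at unfolding has_velocity_def by blast
  then show ?thesis
    using assms tangent_eqI[OF c] unfolding has_velocity_def by blast
qed

lemma velocity_eq: "has_velocity (atlas M) \<gamma> t v \<Longrightarrow> velocity (atlas M) \<gamma> t = v"
  unfolding velocity_def using has_velocity_unique by blast

text \<open>One chart suffices, by the chain rule through the transition maps. \<open>near\<close>
  keeps the curve in the domain of \<open>c\<close>, outside of which \<open>chart_map c\<close> has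
  no meaning.\<close>

lemma has_velocityI:
  assumes c: "c \<in> charts_at (atlas M) (\<gamma> t)"
    and near: "\<forall>\<^sub>F s in at t. \<gamma> s \<in> chart_dom c"
    and der: "((chart_map c \<circ> \<gamma>) has_vector_derivative w) (at t)"
  shows "has_velocity (atlas M) \<gamma> t (tvec_of (atlas M) c (\<gamma> t) w)"
  unfolding has_velocity_def
proof (intro conjI ballI tvec_of_in c)
  fix d assume d: "d \<in> charts_at (atlas M) (\<gamma> t)"
  have "((transition c d \<circ> (chart_map c \<circ> \<gamma>)) has_vector_derivative dtr c d (chart_map c (\<gamma> t)) w) (at t)"
    by (rule vector_derivative_diff_chain_within[OF der])
      (use has_derivative_at_withinI[OF transition_derivative[OF c d]] in simp)
  moreover have "\<forall>\<^sub>F s in at t. (transition c d \<circ> (chart_map c \<circ> \<gamma>)) s = (chart_map d \<circ> \<gamma>) s"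
    using near by eventually_elim (use charts_atD[OF c] in \<open>simp add: transition_map\<close>)
  moreover have "(transition c d \<circ> (chart_map c \<circ> \<gamma>)) t = (chart_map d \<circ> \<gamma>) t"
    using charts_atD[OF c] by (simp add: transition_map)
  ultimately have "((chart_map d \<circ> \<gamma>) has_vector_derivative dtr c d (chart_map c (\<gamma> t)) w) (at t)"
    unfolding has_vector_derivative_def by (rule has_derivative_transform_eventually) simp
  then show "((chart_map d \<circ> \<gamma>) has_vector_derivative tvec_of (atlas M) c (\<gamma> t) w d) (at t)"
    using d by (simp add: tvec_of_def)
qed

lemma has_velocity_cong:
  assumes "\<forall>\<^sub>F s in at t. \<gamma>1 s = \<gamma>2 s" "\<gamma>1 t = \<gamma>2 t"
  shows "has_velocity (atlas M) \<gamma>1 t v \<longleftrightarrow> has_velocity (atlas M) \<gamma>2 t v"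
proof -
  have "((chart_map c \<circ> \<gamma>1) has_vector_derivative w) (at t) \<longleftrightarrow> ((chart_map c \<circ> \<gamma>2) has_vector_derivative w) (at t)"
    for c :: "('m, 'e) chart" and w
    by (rule has_vector_derivative_cong_ev) (use assms in \<open>auto simp: eventually_at_filter elim: eventually_mono\<close>)
  then show ?thesis
    using assms(2) unfolding has_velocity_def by simp
qed

lemma velocity_cong:
  assumes "\<forall>\<^sub>F s in at t. \<gamma>1 s = \<gamma>2 s" "\<gamma>1 t = \<gamma>2 t"
  shows "velocity (atlas M) \<gamma>1 t = velocity (atlas M) \<gamma>2 t"
  unfolding velocity_def has_velocity_cong[OF assms] ..

lemma has_velocity_shift:
  assumes "has_velocity (atlas M) \<gamma> (t - b) v"
  shows "has_velocity (atlas M) (\<lambda>t. \<gamma> (t - b)) t v"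
proof -
  have "((\<lambda>s. f (s - b)) has_vector_derivative w) (at t)"
    if "(f has_vector_derivative w) (at (t - b))" for f :: "real \<Rightarrow> 'e" and w
  proof -
    have "((\<lambda>s. s - b) has_vector_derivative 1) (at t)"
      by (auto intro!: derivative_eq_intros)
    from vector_diff_chain_at[OF this that] show ?thesis
      by (simp add: o_def)
  qed
  then show ?thesis
    using assms unfolding has_velocity_def o_def by blast
qed

text \<open>One chart around each point suffices because transition maps are C1, hence locally
  Lipschitz; continuity of the curve keeps nearby parameters in that chart.\<close>

lemma locally_lipschitz_curveI:
  assumes cont: "continuous_on I \<gamma>"
    and loc: "\<And>t. t \<in> I \<Longrightarrow> \<exists>c\<in>charts_at (atlas M) (\<gamma> t).
      locally_lipschitz_on (chart_map c \<circ> \<gamma>) (I \<inter> \<gamma> -` chart_dom c)"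
  shows "locally_lipschitz_curve M I \<gamma>"
  unfolding locally_lipschitz_curve_def
proof (intro conjI ballI cont)
  fix d assume d: "d \<in> atlas M"
  show "locally_lipschitz_on (chart_map d \<circ> \<gamma>) (I \<inter> \<gamma> -` chart_dom d)"
    unfolding locally_lipschitz_on_def
  proof
    fix t assume t: "t \<in> I \<inter> \<gamma> -` chart_dom d"
    obtain c where c: "c \<in> charts_at (atlas M) (\<gamma> t)"
      and ll: "locally_lipschitz_on (chart_map c \<circ> \<gamma>) (I \<inter> \<gamma> -` chart_dom c)"
      using loc[of t] t by blast
    note cA = charts_atD[OF c]
    let ?S = "I \<inter> \<gamma> -` (chart_dom c \<inter> chart_dom d)"
    have "locally_lipschitz_on (transition c d \<circ> (chart_map c \<circ> \<gamma>)) ?S"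
    proof (rule locally_lipschitz_on_compose)
      show "locally_lipschitz_on (chart_map c \<circ> \<gamma>) ?S"
        by (rule locally_lipschitz_on_subset[OF ll]) auto
      show "locally_lipschitz_on (transition c d) (overlap c d)"
        by (rule Ck_on_locally_lipschitz[OF transition_C1[OF cA(1) d] open_overlap[OF cA(1) d]])
    qed (auto simp: overlap_def)
    then have "locally_lipschitz_on (chart_map d \<circ> \<gamma>) ?S"
      by (rule locally_lipschitz_on_cong) (use cA in \<open>auto simp: transition_map\<close>)
    then obtain r L where r: "0 < r" "L-lipschitz_on (cball t r \<inter> ?S) (chart_map d \<circ> \<gamma>)"
      using t cA unfolding locally_lipschitz_on_def by blast
    have "openin (top_of_set I) (I \<inter> \<gamma> -` chart_dom c)"
      by (rule continuous_openin_preimage_gen[OF cont open_dom[OF cA(1)]])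
    then obtain \<delta> where \<delta>: "0 < \<delta>" "cball t \<delta> \<inter> I \<subseteq> \<gamma> -` chart_dom c"
      using t cA unfolding openin_contains_cball by blast
    have "L-lipschitz_on (cball t (min r \<delta>) \<inter> (I \<inter> \<gamma> -` chart_dom d)) (chart_map d \<circ> \<gamma>)"
      by (rule lipschitz_on_subset[OF r(2)]) (use \<delta> in auto)
    then show "\<exists>r>0. \<exists>L. L-lipschitz_on (cball t r \<inter> (I \<inter> \<gamma> -` chart_dom d)) (chart_map d \<circ> \<gamma>)"
      using r(1) \<delta>(1) by (intro exI[of _ "min r \<delta>"]) auto
  qed
qed

lemma locally_lipschitz_curve_glue:
  assumes l: "locally_lipschitz_curve M {a..b} \<gamma>" and r: "locally_lipschitz_curve M {b..d} \<gamma>"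
    and ab: "a \<le> b" "b \<le> d"
  shows "locally_lipschitz_curve M {a..d} \<gamma>"
  unfolding locally_lipschitz_curve_def
proof (intro conjI ballI)
  have eq: "{a..d} = {a..b} \<union> {b..d}" using ab by auto
  show "continuous_on {a..d} \<gamma>"
    unfolding eq using l r by (intro continuous_on_closed_Un) (auto simp: locally_lipschitz_curve_def)
  fix c assume c: "c \<in> atlas M"
  show "locally_lipschitz_on (chart_map c \<circ> \<gamma>) ({a..d} \<inter> \<gamma> -` chart_dom c)"
  proof (rule locally_lipschitz_on_glue[where b = b])
    have "{a..d} \<inter> \<gamma> -` chart_dom c \<inter> {..b} = {a..b} \<inter> \<gamma> -` chart_dom c"
      "{a..d} \<inter> \<gamma> -` chart_dom c \<inter> {b..} = {b..d} \<inter> \<gamma> -` chart_dom c"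
      using ab by auto
    then show "locally_lipschitz_on (chart_map c \<circ> \<gamma>) ({a..d} \<inter> \<gamma> -` chart_dom c \<inter> {..b})"
      "locally_lipschitz_on (chart_map c \<circ> \<gamma>) ({a..d} \<inter> \<gamma> -` chart_dom c \<inter> {b..})"
      using l r c by (auto simp: locally_lipschitz_curve_def)
  qed
qed

lemma locally_lipschitz_curve_shift:
  assumes "locally_lipschitz_curve M {a..d} \<gamma>"
  shows "locally_lipschitz_curve M {a + b..d + b} (\<lambda>t. \<gamma> (t - b))"
  unfolding locally_lipschitz_curve_def
proof (intro conjI ballI)
  show "continuous_on {a + b..d + b} (\<lambda>t. \<gamma> (t - b))"
    by (rule continuous_on_compose2[of "{a..d}" \<gamma>])
      (use assms in \<open>auto simp: locally_lipschitz_curve_def intro!: continuous_intros\<close>)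
  fix c assume "c \<in> atlas M"
  then have ll: "locally_lipschitz_on (chart_map c \<circ> \<gamma>) ({a..d} \<inter> \<gamma> -` chart_dom c)"
    using assms by (auto simp: locally_lipschitz_curve_def)
  have id: "locally_lipschitz_on (\<lambda>t. t - b) S" for S
    unfolding locally_lipschitz_on_def lipschitz_on_def
    by (intro ballI exI[of _ 1] conjI) (auto simp: dist_real_def)
  have "locally_lipschitz_on ((chart_map c \<circ> \<gamma>) \<circ> (\<lambda>t. t - b)) ({a + b..d + b} \<inter> (\<lambda>t. \<gamma> (t - b)) -` chart_dom c)"
    by (rule locally_lipschitz_on_compose[OF id ll]) auto
  then show "locally_lipschitz_on (chart_map c \<circ> (\<lambda>t. \<gamma> (t - b))) ({a + b..d + b} \<inter> (\<lambda>t. \<gamma> (t - b)) -` chart_dom c)"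
    by (simp add: o_def)
qed

lemma locally_lipschitz_curve_cong:
  assumes "locally_lipschitz_curve M I \<gamma>1" "\<And>t. t \<in> I \<Longrightarrow> \<gamma>1 t = \<gamma>2 t"
  shows "locally_lipschitz_curve M I \<gamma>2"
  unfolding locally_lipschitz_curve_def
proof (intro conjI ballI)
  show "continuous_on I \<gamma>2"
    using assms continuous_on_cong[of I I \<gamma>1 \<gamma>2] by (auto simp: locally_lipschitz_curve_def)
  fix c assume "c \<in> atlas M"
  then have "locally_lipschitz_on (chart_map c \<circ> \<gamma>1) (I \<inter> \<gamma>1 -` chart_dom c)"
    using assms by (auto simp: locally_lipschitz_curve_def)
  moreover have "I \<inter> \<gamma>1 -` chart_dom c = I \<inter> \<gamma>2 -` chart_dom c"
    using assms(2) by auto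
  ultimately have "locally_lipschitz_on (chart_map c \<circ> \<gamma>1) (I \<inter> \<gamma>2 -` chart_dom c)"
    by simp
  then show "locally_lipschitz_on (chart_map c \<circ> \<gamma>2) (I \<inter> \<gamma>2 -` chart_dom c)"
    by (rule locally_lipschitz_on_cong) (use assms(2) in simp)
qed

end

section \<open>The reverse triangle inequality\<close>

lemma AE_lebesgue_not_finite:
  fixes N :: "real set"
  assumes "finite N"
  shows "AE t in lebesgue. t \<notin> N"
  by (rule AE_not_in) (use assms in \<open>simp add: negligible_iff_null_sets[symmetric] negligible_finite\<close>)

context spacetime_setting
begin

definition speed :: "(real \<Rightarrow> 'm) \<Rightarrow> real \<Rightarrow> real" where
  "speed \<gamma> t = sqrt \<bar>metric M (\<gamma> t) (velocity (atlas M) \<gamma> t) (velocity (atlas M) \<gamma> t)\<bar>"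

lemma speed_cong:
  "\<forall>\<^sub>F s in at t. \<gamma>1 s = \<gamma>2 s \<Longrightarrow> \<gamma>1 t = \<gamma>2 t \<Longrightarrow> speed \<gamma>1 t = speed \<gamma>2 t"
  using velocity_cong[of \<gamma>1 \<gamma>2 t] by (simp add: speed_def)

lemma curve_length_speed: "curve_length M a b \<gamma> = (LINT t:{a..b}|lebesgue. speed \<gamma> t)"
  by (simp add: curve_length_def speed_def)

text \<open>The class of curves by which competitors are prolonged. Velocities are asked for at
  interior parameters only, the endpoints being null, and \<open>\<phi>\<close> extends the speed
  continuously to the closed interval so that the length is the integral of a continuous
  function.\<close>

definition smooth_causal :: "real \<Rightarrow> (real \<Rightarrow> 'm) \<Rightarrow> (real \<Rightarrow> real) \<Rightarrow> bool" where
  "smooth_causal l \<gamma> \<phi> \<longleftrightarrow> 0 < l \<and> locally_lipschitz_curve M {0..l} \<gamma> \<and> continuous_on {0..l} \<phi> \<and>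
     (\<forall>t\<in>{0<..<l}. \<exists>w. has_velocity (atlas M) \<gamma> t w \<and> future_pointing M (\<gamma> t) w \<and>
        sqrt \<bar>metric M (\<gamma> t) w w\<bar> = \<phi> t)"

lemma smooth_causal_fd:
  assumes "smooth_causal l \<gamma> \<phi>"
  shows "fd_causal_curve_from_to M 0 l \<gamma> (\<gamma> 0) (\<gamma> l)"
proof -
  have "AE t in lebesgue. t \<notin> {0, l}"
    by (rule AE_lebesgue_not_finite) simp
  then have "AE t\<in>{0..l} in lebesgue. \<exists>v. has_velocity (atlas M) \<gamma> t v \<and> future_pointing M (\<gamma> t) v"
    by eventually_elim (use assms in \<open>force simp: smooth_causal_def\<close>)
  then show ?thesis
    using assms by (auto simp: smooth_causal_def fd_causal_curve_from_to_def fd_causal_curve_def is_interval_cc)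
qed

text \<open>\<open>\<sigma>\<close> is an arbitrary causal curve, and the Bochner integral of a
  function that is not integrable is 0. Positive length thus certifies that the speed of
  \<open>\<sigma>\<close> is integrable, which additivity of the length requires.\<close>

lemma concatenation:
  assumes \<sigma>: "fd_causal_curve_from_to M a b \<sigma> q (\<gamma> 0)" and len: "0 < curve_length M a b \<sigma>"
    and \<gamma>: "smooth_causal l \<gamma> \<phi>"
  shows "\<exists>\<eta>. fd_causal_curve_from_to M a (b + l) \<eta> q (\<gamma> l) \<and>
    curve_length M a (b + l) \<eta> = curve_length M a b \<sigma> + integral {0..l} \<phi>"
proof -
  have ab: "a < b" and \<sigma>ab: "\<sigma> a = q" "\<sigma> b = \<gamma> 0" and \<sigma>fd: "fd_causal_curve M {a..b} \<sigma>"
    using \<sigma> by (auto simp: fd_causal_curve_from_to_def)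
  have l: "0 < l" and \<gamma>lip: "locally_lipschitz_curve M {0..l} \<gamma>" and \<phi>: "continuous_on {0..l} \<phi>"
    and vel: "\<And>t. t \<in> {0<..<l} \<Longrightarrow> \<exists>w. has_velocity (atlas M) \<gamma> t w \<and> future_pointing M (\<gamma> t) w \<and>
        sqrt \<bar>metric M (\<gamma> t) w w\<bar> = \<phi> t"
    using \<gamma> by (auto simp: smooth_causal_def)
  define \<eta> where "\<eta> t = (if t \<le> b then \<sigma> t else \<gamma> (t - b))" for t
  have \<eta>1: "\<eta> t = \<sigma> t" if "t \<le> b" for t using that by (simp add: \<eta>_def)
  have \<eta>2: "\<eta> t = \<gamma> (t - b)" if "b \<le> t" for t using that \<sigma>ab by (auto simp: \<eta>_def)
  have ev1: "\<forall>\<^sub>F s in at t. \<sigma> s = \<eta> s" if "t < b" for t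
  proof -
    have "\<forall>\<^sub>F s in nhds t. s \<in> {..<b}"
      by (rule eventually_nhds_in_open) (use that in auto)
    then show ?thesis
      unfolding eventually_at_filter by eventually_elim (simp add: \<eta>1)
  qed
  have ev2: "\<forall>\<^sub>F s in at t. \<gamma> (s - b) = \<eta> s" if "b < t" for t
  proof -
    have "\<forall>\<^sub>F s in nhds t. s \<in> {b<..}"
      by (rule eventually_nhds_in_open) (use that in auto)
    then show ?thesis
      unfolding eventually_at_filter by eventually_elim (simp add: \<eta>2)
  qed
  have vel\<eta>: "\<exists>w. has_velocity (atlas M) \<eta> t w \<and> future_pointing M (\<eta> t) w \<and> sqrt \<bar>metric M (\<eta> t) w w\<bar> = \<phi> (t - b)"
    if t: "t \<in> {b<..<b + l}" for t
  proof -
    obtain w where w: "has_velocity (atlas M) \<gamma> (t - b) w" "future_pointing M (\<gamma> (t - b)) w"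
      "sqrt \<bar>metric M (\<gamma> (t - b)) w w\<bar> = \<phi> (t - b)"
      using vel[of "t - b"] t by auto
    have "has_velocity (atlas M) \<eta> t w"
      using has_velocity_cong[OF ev2, of t w] has_velocity_shift[OF w(1)] \<eta>2[of t] t by simp
    then show ?thesis using w(2,3) \<eta>2[of t] t by auto
  qed
  have "locally_lipschitz_curve M {a..b + l} \<eta>"
  proof (rule locally_lipschitz_curve_glue[where b = b])
    show "locally_lipschitz_curve M {a..b} \<eta>"
      by (rule locally_lipschitz_curve_cong[of _ \<sigma>]) (use \<sigma>fd \<eta>1 in \<open>auto simp: fd_causal_curve_def\<close>)
    show "locally_lipschitz_curve M {b..b + l} \<eta>"
    proof (rule locally_lipschitz_curve_cong)
      show "locally_lipschitz_curve M {b..b + l} (\<lambda>t. \<gamma> (t - b))"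
        using locally_lipschitz_curve_shift[OF \<gamma>lip, of b] by (simp add: add.commute)
      show "\<gamma> (t - b) = \<eta> t" if "t \<in> {b..b + l}" for t
        using \<eta>2[of t] that by simp
    qed
  qed (use ab l in auto)
  moreover have "AE t\<in>{a..b + l} in lebesgue. \<exists>v. has_velocity (atlas M) \<eta> t v \<and> future_pointing M (\<eta> t) v"
  proof -
    have "AE t in lebesgue. t \<notin> {b, b + l}"
      by (rule AE_lebesgue_not_finite) simp
    moreover have "AE t\<in>{a..b} in lebesgue. \<exists>v. has_velocity (atlas M) \<sigma> t v \<and> future_pointing M (\<sigma> t) v"
      using \<sigma>fd by (simp add: fd_causal_curve_def)
    ultimately show ?thesis
    proof eventually_elim
      case (elim t)
      show ?case
      proof
        assume t: "t \<in> {a..b + l}"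
        consider "t < b" | "b < t" "t < b + l" using t elim(1) by fastforce
        then show "\<exists>v. has_velocity (atlas M) \<eta> t v \<and> future_pointing M (\<eta> t) v"
        proof cases
          case 1
          then show ?thesis
            using elim(2) t has_velocity_cong[OF ev1, of t] \<eta>1[of t] by auto
        next
          case 2
          then show ?thesis using vel\<eta>[of t] by auto
        qed
      qed
    qed
  qed
  ultimately have "fd_causal_curve_from_to M a (b + l) \<eta> q (\<gamma> l)"
    using ab l \<sigma>ab \<eta>1[of a] \<eta>2[of "b + l"]
    by (auto simp: fd_causal_curve_from_to_def fd_causal_curve_def is_interval_cc)
  moreover have "curve_length M a (b + l) \<eta> = curve_length M a b \<sigma> + integral {0..l} \<phi>"
  proof -
    have int\<sigma>: "set_integrable lebesgue {a..b} (speed \<sigma>)"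
      using len not_integrable_integral_eq
      unfolding curve_length_speed set_lebesgue_integral_def set_integrable_def by fastforce
    have cont: "continuous_on {b..b + l} (\<lambda>t. \<phi> (t - b))"
      by (rule continuous_on_compose2[OF \<phi>]) (auto intro!: continuous_intros)
    have int\<phi>: "set_integrable lebesgue {b..b + l} (\<lambda>t. \<phi> (t - b))"
      by (rule absolutely_integrable_continuous_real[OF cont])
    \<comment> \<open>Away from the junction \<open>b\<close> and the end \<open>b + l\<close> the
      integrand for \<open>\<eta>\<close> equals \<open>F\<close>; these two parameters are
      null.\<close>
    define F where "F t = indicator {a..b} t *\<^sub>R speed \<sigma> t + indicator {b..b + l} t *\<^sub>R \<phi> (t - b)" for t
    have "(LINT t|lebesgue. indicator {a..b + l} t *\<^sub>R speed \<eta> t) = (LINT t|lebesgue. F t)"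
    proof (rule integral_discrete_difference[where X = "{b, b + l}"])
      fix t assume t: "t \<notin> {b, b + l}"
      show "indicator {a..b + l} t *\<^sub>R speed \<eta> t = F t"
      proof (cases "t < b")
        case True
        then have "speed \<eta> t = speed \<sigma> t"
          using speed_cong[OF ev1] \<eta>1[of t] by (metis less_imp_le)
        with True l show ?thesis by (auto simp: F_def indicator_def)
      next
        case False
        show ?thesis
        proof (cases "t < b + l")
          case True
          with False t obtain w where w: "has_velocity (atlas M) \<eta> t w" "sqrt \<bar>metric M (\<eta> t) w w\<bar> = \<phi> (t - b)"
            using vel\<eta>[of t] by auto
          have "speed \<eta> t = \<phi> (t - b)"
            using velocity_eq[OF w(1)] w(2) by (simp add: speed_def)
          with False True t ab show ?thesis by (auto simp: F_def indicator_def)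
        next
          case False
          with t l ab show ?thesis by (auto simp: F_def indicator_def)
        qed
      qed
    qed auto
    also have "\<dots> = curve_length M a b \<sigma> + (LINT t:{b..b + l}|lebesgue. \<phi> (t - b))"
      using int\<sigma> int\<phi> unfolding F_def curve_length_speed set_lebesgue_integral_def set_integrable_def
      by (rule Bochner_Integration.integral_add)
    also have "(LINT t:{b..b + l}|lebesgue. \<phi> (t - b)) = integral {b..b + l} (\<lambda>t. \<phi> (t - b))"
      by (rule set_lebesgue_integral_eq_integral(2)[OF int\<phi>])
    also have "\<dots> = integral {0..l} \<phi>"
      using integral_shift_Icc_real[of b "b + l" \<phi> "- b"] by (simp add: o_def)
    finally show ?thesis
      by (simp add: curve_length_speed set_lebesgue_integral_def)
  qed
  ultimately show ?thesis by blast
qed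

text \<open>A positive time separation at \<open>\<gamma> 0\<close> is approached by curves of
  positive length, and exactly these can be prolonged by \<open>concatenation\<close>.
  \<open>D\<close> is any lower bound for the length of the prolongation.\<close>

lemma reverse_triangle:
  assumes \<gamma>: "smooth_causal l \<gamma> \<phi>" and pos: "0 < time_separation_from M S (\<gamma> 0)"
    and D: "D \<le> integral {0..l} \<phi>" "0 \<le> integral {0..l} \<phi>"
  shows "time_separation_from M S (\<gamma> 0) + ennreal D \<le> time_separation_from M S (\<gamma> l)"
proof -
  let ?T = "time_separation_from M S (\<gamma> l)"
  have step: "ennreal x + ennreal D \<le> ?T"
    if st: "q \<in> S" "fd_causal_curve_from_to M a b \<sigma> q (\<gamma> 0)" "x = curve_length M a b \<sigma>" "0 < x" for q a b \<sigma> x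
  proof -
    obtain \<eta> where \<eta>: "fd_causal_curve_from_to M a (b + l) \<eta> q (\<gamma> l)"
      "curve_length M a (b + l) \<eta> = x + integral {0..l} \<phi>"
      using concatenation[OF st(2) _ \<gamma>] st(3,4) by auto
    have "ennreal x + ennreal D \<le> ennreal x + ennreal (integral {0..l} \<phi>)"
      using D by (intro add_left_mono ennreal_leI)
    also have "\<dots> = ennreal (curve_length M a (b + l) \<eta>)"
      using \<eta>(2) st(4) D(2) by simp
    also have "\<dots> \<le> time_separation M q (\<gamma> l)"
      unfolding time_separation_def using \<eta>(1) by (intro Sup_upper) blast
    also have "\<dots> \<le> ?T"
      unfolding time_separation_from_def using st(1) by (intro SUP_upper)
    finally show ?thesis .
  qed
  have lengths: "\<exists>q a b \<sigma> x. q \<in> S \<and> fd_causal_curve_from_to M a b \<sigma> q (\<gamma> 0) \<and> x = curve_length M a b \<sigma> \<and> 0 < x \<and> y < ennreal x"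
    if y: "y < time_separation_from M S (\<gamma> 0)" for y
  proof -
    obtain q where q: "q \<in> S" "y < time_separation M q (\<gamma> 0)"
      using y unfolding time_separation_from_def less_SUP_iff by blast
    from q(2) obtain a b \<sigma> where "fd_causal_curve_from_to M a b \<sigma> q (\<gamma> 0)" "y < ennreal (curve_length M a b \<sigma>)"
      unfolding time_separation_def less_Sup_iff by blast
    moreover from this(2) have "0 < curve_length M a b \<sigma>"
      by (metis ennreal_less_zero_iff not_less_zero order_le_less_trans zero_le)
    ultimately show ?thesis using q(1) by blast
  qed
  \<comment> \<open>Needed for subtracting \<open>D\<close> in \<open>ennreal\<close> and adding it
    back without truncation.\<close>
  have DT: "ennreal D \<le> ?T"
  proof -
    obtain q a b \<sigma> x where "q \<in> S" "fd_causal_curve_from_to M a b \<sigma> q (\<gamma> 0)" "x = curve_length M a b \<sigma>" "0 < x"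
      using lengths[OF pos] by blast
    from step[OF this] show ?thesis
      by (meson add_increasing order_refl order_trans zero_le)
  qed
  \<comment> \<open>Moving \<open>D\<close> to the other side isolates the supremum, which may then
    be approached by smaller values; this covers an infinite supremum too.\<close>
  have "time_separation_from M S (\<gamma> 0) \<le> ?T - ennreal D"
  proof (rule dense_le)
    fix y assume "y < time_separation_from M S (\<gamma> 0)"
    then obtain q a b \<sigma> x where *: "q \<in> S" "fd_causal_curve_from_to M a b \<sigma> q (\<gamma> 0)" "x = curve_length M a b \<sigma>" "0 < x"
      and y: "y < ennreal x"
      using lengths by blast
    have "ennreal x \<le> ?T - ennreal D"
      using step[OF *] by (intro ennreal_le_minus_iff[THEN iffD2]) (auto simp: add.commute)
    with y show "y \<le> ?T - ennreal D" by simp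
  qed
  then have "time_separation_from M S (\<gamma> 0) + ennreal D \<le> (?T - ennreal D) + ennreal D"
    by (rule add_right_mono)
  also have "\<dots> = ?T"
    using DT by (rule diff_add_cancel_ennreal)
  finally show ?thesis .
qed

section \<open>Charts as causal patches\<close>

definition coord_time :: "('m, 'e) chart \<Rightarrow> 'e \<Rightarrow> 'e" where
  "coord_time c x = time_field M (chart_inv c x) c"

lemma time_field_in: "time_field M p \<in> tangent_space (atlas M) p"
  and time_field_timelike: "metric M p (time_field M p) (time_field M p) < 0"
  using oriented by (auto simp: time_oriented_def)

lemma coord_time: "c \<in> charts_at (atlas M) p \<Longrightarrow> coord_time c (chart_map c p) = time_field M p c"
  using inv_map charts_atD by (simp add: coord_time_def)

lemma future_pointingI:
  assumes c: "c \<in> charts_at (atlas M) p" and v: "v \<in> tangent_space (atlas M) p"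
    and g: "metric_in M c (chart_map c p) (v c) (v c) < 0"
    and t: "metric_in M c (chart_map c p) (coord_time c (chart_map c p)) (v c) < 0"
  shows "future_pointing M p v"
proof -
  interpret lorentz_patch "chart_img c" "metric_in M c"
    by (rule patch[OF charts_atD(1)[OF c]])
  have "chart_map c p \<in> chart_img c"
    using map_img charts_atD[OF c] by blast
  then have "v \<noteq> (\<lambda>_. 0)"
    using g by (auto simp: g_simps)
  then show ?thesis
    using g t v time_field_in metric_chart[OF c v v] metric_chart[OF c time_field_in v]
    by (simp add: future_pointing_def causal_vector_def coord_time[OF c])
qed

text \<open>The curve \<open>y\<close> of coordinates is lifted to \<open>M\<close>, where it
  qualifies for \<open>reverse_triangle\<close>; the bound on \<open>f'\<close> and the fundamental
  theorem of calculus bound \<open>f b - f a\<close> by the integral of the speed.\<close>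

lemma causal_patch:
  assumes c: "c \<in> atlas M"
  shows "causal_patch (chart_img c) (metric_in M c) (coord_time c) (\<lambda>x. time_separation_from M S (chart_inv c x))"
proof -
  interpret lorentz_patch "chart_img c" "metric_in M c"
    by (rule patch[OF c])
  show ?thesis
  proof
    show "continuous_on (chart_img c) (coord_time c)"
      using oriented c unfolding time_oriented_def coord_time_def by auto
  next
    fix x assume x: "x \<in> chart_img c"
    then have "c \<in> charts_at (atlas M) (chart_inv c x)"
      using inv_dom[OF c] by (simp add: charts_at_def c)
    from metric_chart[OF this time_field_in time_field_in] time_field_timelike[of "chart_inv c x"]
    show "metric_in M c x (coord_time c x) (coord_time c x) < 0"
      using x by (simp add: coord_time_def map_inv[OF c])
  next
    fix a b :: real and y y' :: "real \<Rightarrow> 'e" and f f' :: "real \<Rightarrow> real"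
    assume ab: "a < b" and yU: "\<And>r. r \<in> {a..b} \<Longrightarrow> y r \<in> chart_img c"
      and der: "\<And>r. r \<in> {a..b} \<Longrightarrow> (y has_vector_derivative y' r) (at r within {a..b})"
      and y'c: "continuous_on {a..b} y'"
      and tl: "\<And>r. r \<in> {a..b} \<Longrightarrow> metric_in M c (y r) (y' r) (y' r) < 0"
      and fut: "\<And>r. r \<in> {a..b} \<Longrightarrow> metric_in M c (y r) (coord_time c (y r)) (y' r) < 0"
      and f: "\<And>r. r \<in> {a..b} \<Longrightarrow> (f has_real_derivative f' r) (at r within {a..b})"
      and f': "\<And>r. r \<in> {a..b} \<Longrightarrow> f' r \<le> sqrt (- metric_in M c (y r) (y' r) (y' r))"
      and pos: "0 < time_separation_from M S (chart_inv c (y a))"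
    define \<gamma> where "\<gamma> t = chart_inv c (y (a + t))" for t
    define \<psi> where "\<psi> r = sqrt (- metric_in M c (y r) (y' r) (y' r))" for r
    define l where "l = b - a"
    have l: "0 < l" "a + l = b" using ab by (auto simp: l_def)
    have \<gamma>c: "c \<in> charts_at (atlas M) (\<gamma> t)" and y\<gamma>: "chart_map c (\<gamma> t) = y (a + t)" if "t \<in> {0..l}" for t
      using yU[of "a + t"] that l inv_dom[OF c] map_inv[OF c] by (auto simp: \<gamma>_def charts_at_def c)
    have yc: "continuous_on {a..b} y"
      using der by (rule continuous_on_vector_derivative)
    have y0c: "continuous_on {0..l} (\<lambda>t. y (a + t))"
      by (rule continuous_on_compose2[OF yc]) (auto intro!: continuous_intros simp: l_def)
    have \<gamma>cont: "continuous_on {0..l} \<gamma>"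
      unfolding \<gamma>_def
      by (rule continuous_on_compose2[OF cont_inv[OF c] y0c]) (use yU l in auto)
    have \<psi>c: "continuous_on {a..b} \<psi>"
      unfolding \<psi>_def by (intro continuous_intros continuous_on_g yc y'c) (use yU in auto)
    have lip: "locally_lipschitz_curve M {0..l} \<gamma>"
    proof (rule locally_lipschitz_curveI[OF \<gamma>cont])
      fix t assume t: "t \<in> {0..l}"
      have "bounded (y' ` {a..b})"
        by (intro compact_imp_bounded compact_continuous_image y'c) simp
      then obtain B where B: "\<And>r. r \<in> {a..b} \<Longrightarrow> norm (y' r) \<le> B"
        unfolding bounded_iff by (metis image_eqI)
      have B0: "0 \<le> B" using order_trans[OF norm_ge_zero B[of a]] ab by simp
      have ylip: "B-lipschitz_on {a..b} y"
      proof (rule lipschitz_onI[OF _ B0])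
        fix r s assume "r \<in> {a..b}" "s \<in> {a..b}"
        moreover have "(y has_derivative (\<lambda>h. h *\<^sub>R y' x)) (at x within {a..b})" if "x \<in> {a..b}" for x
          using der[OF that] by (simp add: has_vector_derivative_def)
        moreover have "onorm (\<lambda>h. h *\<^sub>R y' x) \<le> B" if "x \<in> {a..b}" for x
          by (rule onorm_le) (use mult_right_mono[OF B[OF that] abs_ge_zero] in \<open>simp add: mult.commute\<close>)
        ultimately show "dist (y r) (y s) \<le> B * dist r s"
          unfolding dist_norm by (intro differentiable_bound[of "{a..b}"]) auto
      qed
      have "B-lipschitz_on {0..l} (chart_map c \<circ> \<gamma>)"
      proof (rule lipschitz_onI[OF _ B0])
        fix r s assume rs: "r \<in> {0..l}" "s \<in> {0..l}"
        then have "dist (y (a + r)) (y (a + s)) \<le> B * dist (a + r) (a + s)"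
          using l by (intro lipschitz_onD[OF ylip]) auto
        then show "dist ((chart_map c \<circ> \<gamma>) r) ((chart_map c \<circ> \<gamma>) s) \<le> B * dist r s"
          by (simp add: y\<gamma>[OF rs(1)] y\<gamma>[OF rs(2)] dist_real_def)
      qed
      then have "locally_lipschitz_on (chart_map c \<circ> \<gamma>) ({0..l} \<inter> \<gamma> -` chart_dom c)"
        unfolding locally_lipschitz_on_def by (meson Int_lower1 Int_lower2 lipschitz_on_subset order_trans zero_less_one)
      then show "\<exists>c\<in>charts_at (atlas M) (\<gamma> t). locally_lipschitz_on (chart_map c \<circ> \<gamma>) ({0..l} \<inter> \<gamma> -` chart_dom c)"
        using \<gamma>c[OF t] by blast
    qed
    have "smooth_causal l \<gamma> (\<lambda>t. \<psi> (a + t))"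
      unfolding smooth_causal_def
    proof (intro conjI ballI)
      show "continuous_on {0..l} (\<lambda>t. \<psi> (a + t))"
        by (rule continuous_on_compose2[OF \<psi>c]) (auto intro!: continuous_intros simp: l_def)
      fix t assume t: "t \<in> {0<..<l}"
      then have t': "t \<in> {0..l}" "a + t \<in> {a..b}" "a + t \<in> {a<..<b}" using l by auto
      have near: "\<forall>\<^sub>F s in at t. s \<in> {0<..<l}"
        using eventually_nhds_in_open[of "{0<..<l}" t] t by (auto simp: eventually_at_filter elim: eventually_mono)
      have "(y has_vector_derivative y' (a + t)) (at (a + t))"
        using der[OF t'(2)] at_within_interior[of "a + t" "{a..b}"] t'(3) by simp
      moreover have "((\<lambda>s. a + s) has_vector_derivative 1) (at t)"
        by (auto intro!: derivative_eq_intros)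
      ultimately have "((\<lambda>s. y (a + s)) has_vector_derivative y' (a + t)) (at t)"
        using vector_diff_chain_at[of "\<lambda>s. a + s" 1 t y "y' (a + t)"] by (simp add: o_def)
      then have der\<gamma>: "((chart_map c \<circ> \<gamma>) has_vector_derivative y' (a + t)) (at t)"
        unfolding has_vector_derivative_def
      proof (rule has_derivative_transform_eventually)
        show "\<forall>\<^sub>F s in at t. y (a + s) = (chart_map c \<circ> \<gamma>) s"
          using near by eventually_elim (simp add: y\<gamma>)
      qed (use y\<gamma>[OF t'(1)] in simp_all)
      have nearc: "\<forall>\<^sub>F s in at t. \<gamma> s \<in> chart_dom c"
        using near by eventually_elim (use \<gamma>c charts_atD in auto)
      have hv: "has_velocity (atlas M) \<gamma> t (tvec_of (atlas M) c (\<gamma> t) (y' (a + t)))" (is "has_velocity _ _ _ ?w")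
        by (rule has_velocityI[of c \<gamma> t, OF \<gamma>c[OF t'(1)] nearc der\<gamma>])
      note w = tvec_of_in[OF \<gamma>c[OF t'(1)], of "y' (a + t)"] tvec_of_chart[OF \<gamma>c[OF t'(1)], of "y' (a + t)"]
      have "future_pointing M (\<gamma> t) ?w"
        by (rule future_pointingI[OF \<gamma>c[OF t'(1)] w(1)]) (simp_all add: w(2) y\<gamma>[OF t'(1)] tl[OF t'(2)] fut[OF t'(2)])
      moreover have "sqrt \<bar>metric M (\<gamma> t) ?w ?w\<bar> = \<psi> (a + t)"
        using tl[OF t'(2)] by (simp add: metric_chart[OF \<gamma>c[OF t'(1)] w(1) w(1)] w(2) y\<gamma>[OF t'(1)] \<psi>_def)
      ultimately show "\<exists>w. has_velocity (atlas M) \<gamma> t w \<and> future_pointing M (\<gamma> t) w \<and> sqrt \<bar>metric M (\<gamma> t) w w\<bar> = \<psi> (a + t)"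
        using hv by blast
    qed (use l lip in auto)
    moreover have "integral {0..l} (\<lambda>t. \<psi> (a + t)) = integral {a..b} \<psi>"
      using integral_shift_Icc_real[of 0 l \<psi> a] l by (simp add: o_def add.commute)
    moreover have "f b - f a \<le> integral {a..b} \<psi>"
    proof (rule has_integral_le)
      show "(f' has_integral f b - f a) {a..b}"
        using ab f by (intro fundamental_theorem_of_calculus)
          (auto simp: has_real_derivative_iff_has_vector_derivative[symmetric])
      show "(\<psi> has_integral integral {a..b} \<psi>) {a..b}"
        using \<psi>c by (intro integrable_integral integrable_continuous_interval)
    qed (use f' in \<open>auto simp: \<psi>_def\<close>)
    moreover have "0 \<le> integral {a..b} \<psi>"
      using \<psi>c tl by (intro integral_nonneg integrable_continuous_interval) (auto simp: \<psi>_def less_imp_le)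
    moreover have "\<gamma> 0 = chart_inv c (y a)" "\<gamma> l = chart_inv c (y b)"
      using l by (auto simp: \<gamma>_def)
    ultimately show "time_separation_from M S (chart_inv c (y a)) + ennreal (f b - f a)
        \<le> time_separation_from M S (chart_inv c (y b))"
      using reverse_triangle[of l \<gamma> "\<lambda>t. \<psi> (a + t)" S "f b - f a"] pos by simp
  qed
qed

end

section \<open>Geodesics\<close>

context spacetime_setting
begin

abbreviation coord :: "('m, 'e) chart \<Rightarrow> (real \<Rightarrow> 'm) \<Rightarrow> real \<Rightarrow> 'e" where
  "coord c \<gamma> \<equiv> chart_map c \<circ> \<gamma>"

abbreviation coord' :: "('m, 'e) chart \<Rightarrow> (real \<Rightarrow> 'm) \<Rightarrow> real \<Rightarrow> 'e" where
  "coord' c \<gamma> s \<equiv> vector_derivative (coord c \<gamma>) (at s)"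

abbreviation arc_in :: "('m, 'e) chart \<Rightarrow> (real \<Rightarrow> 'e) \<Rightarrow> (real \<Rightarrow> 'e) \<Rightarrow> real set \<Rightarrow> bool" where
  "arc_in c \<equiv> lorentz_patch.geodesic_arc (chart_img c) (metric_in M c)"

lemma geodesicD:
  assumes "geodesic M I \<gamma>"
  shows "open I" "is_interval I" "continuous_on I \<gamma>"
  using assms by (auto simp: geodesic_def)

lemma geodesic_at:
  assumes geo: "geodesic M I \<gamma>" and t: "t \<in> I" and c: "c \<in> charts_at (atlas M) (\<gamma> t)"
  shows "(coord c \<gamma> has_vector_derivative coord' c \<gamma> t) (at t)"
    and "(coord' c \<gamma> has_vector_derivative - christoffel M c (coord c \<gamma> t) (coord' c \<gamma> t) (coord' c \<gamma> t)) (at t)"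
  using geo t c unfolding geodesic_def Let_def by (auto simp: vector_derivative_works)

lemma geodesic_near_chart:
  assumes geo: "geodesic M I \<gamma>" and t: "t \<in> I" and c: "c \<in> charts_at (atlas M) (\<gamma> t)"
  obtains e where "0 < e" "{t - e..t + e} \<subseteq> I" "\<gamma> ` {t - e..t + e} \<subseteq> chart_dom c"
proof -
  note cA = charts_atD[OF c]
  have "open (I \<inter> \<gamma> -` chart_dom c)"
    by (rule continuous_open_preimage[OF geodesicD(3,1)[OF geo] open_dom[OF cA(1)]])
  moreover have "t \<in> I \<inter> \<gamma> -` chart_dom c" using t cA by auto
  ultimately obtain e where "0 < e" "cball t e \<subseteq> I \<inter> \<gamma> -` chart_dom c"
    using open_contains_cball by blast
  then show ?thesis
    by (intro that[of e]) (auto simp: cball_eq_atLeastAtMost)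
qed

lemma geodesic_arc_chart:
  assumes geo: "geodesic M I \<gamma>" and c: "c \<in> atlas M" and T: "T \<subseteq> I" "\<gamma> ` T \<subseteq> chart_dom c"
  shows "arc_in c (coord c \<gamma>) (coord' c \<gamma>) T"
proof -
  interpret lorentz_patch "chart_img c" "metric_in M c" by (rule patch[OF c])
  show ?thesis
    unfolding geodesic_arc_def
  proof (intro ballI conjI)
    fix r assume r: "r \<in> T"
    then have ca: "c \<in> charts_at (atlas M) (\<gamma> r)" and rI: "r \<in> I"
      using c T by (auto simp: charts_at_def)
    show "coord c \<gamma> r \<in> chart_img c"
      using map_img[OF charts_atD[OF ca]] by simp
    show "(coord c \<gamma> has_vector_derivative coord' c \<gamma> r) (at r within T)"
      "(coord' c \<gamma> has_vector_derivative - Gam (coord c \<gamma> r) (coord' c \<gamma> r) (coord' c \<gamma> r)) (at r within T)"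
      using geodesic_at[OF geo rI ca] unfolding christoffel_Gam[OF c]
      by (auto intro: has_vector_derivative_at_within)
  qed
qed

lemma geodesic_velocity:
  assumes geo: "geodesic M I \<gamma>" and t: "t \<in> I"
  shows "has_velocity (atlas M) \<gamma> t (velocity (atlas M) \<gamma> t)"
    and "velocity (atlas M) \<gamma> t \<in> tangent_space (atlas M) (\<gamma> t)"
    and "c \<in> charts_at (atlas M) (\<gamma> t) \<Longrightarrow> velocity (atlas M) \<gamma> t c = coord' c \<gamma> t"
proof -
  have ev: "\<exists>v. has_velocity (atlas M) \<gamma> t v"
  proof -
    obtain c where c: "c \<in> charts_at (atlas M) (\<gamma> t)" by (rule exists_chart)
    obtain e where e: "0 < e" "{t - e..t + e} \<subseteq> I" "\<gamma> ` {t - e..t + e} \<subseteq> chart_dom c"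
      by (rule geodesic_near_chart[OF geo t c])
    have "\<forall>\<^sub>F s in nhds t. s \<in> {t - e<..<t + e}"
      using e by (intro eventually_nhds_in_open) auto
    then have "\<forall>\<^sub>F s in at t. \<gamma> s \<in> chart_dom c"
      unfolding eventually_at_filter by eventually_elim (use e in auto)
    from has_velocityI[of c \<gamma> t, OF c this geodesic_at(1)[OF geo t c]] show ?thesis by blast
  qed
  then show hv: "has_velocity (atlas M) \<gamma> t (velocity (atlas M) \<gamma> t)"
    using velocity_eq by metis
  then show "velocity (atlas M) \<gamma> t \<in> tangent_space (atlas M) (\<gamma> t)"
    by (simp add: has_velocity_def)
  show "velocity (atlas M) \<gamma> t c = coord' c \<gamma> t" if "c \<in> charts_at (atlas M) (\<gamma> t)"
    using hv that unfolding has_velocity_def by (metis vector_derivative_at)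
qed

text \<open>The parameters at which position and velocity agree form a set that is open by
  Gronwall's inequality in a chart and closed by continuity, inside the connected set
  \<open>I \<inter> J\<close>.\<close>

lemma geodesic_unique:
  assumes g1: "geodesic M I \<gamma>1" and g2: "geodesic M J \<gamma>2" and t0: "t0 \<in> I \<inter> J"
    and eq0: "\<gamma>1 t0 = \<gamma>2 t0" "velocity (atlas M) \<gamma>1 t0 = velocity (atlas M) \<gamma>2 t0"
    and t: "t \<in> I \<inter> J"
  shows "\<gamma>1 t = \<gamma>2 t"
proof -
  define A where "A = {t \<in> I \<inter> J. \<gamma>1 t = \<gamma>2 t \<and> velocity (atlas M) \<gamma>1 t = velocity (atlas M) \<gamma>2 t}"
  have K: "connected (I \<inter> J)"
    using geodesicD(2)[OF g1] geodesicD(2)[OF g2] is_interval_Int is_interval_connected_1 by blast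
  have oK: "open (I \<inter> J)" using geodesicD(1)[OF g1] geodesicD(1)[OF g2] by auto
  have "open A"
    unfolding open_contains_ball
  proof
    fix t assume "t \<in> A"
    then have tI: "t \<in> I" "t \<in> J" and eq: "\<gamma>1 t = \<gamma>2 t" "velocity (atlas M) \<gamma>1 t = velocity (atlas M) \<gamma>2 t"
      by (auto simp: A_def)
    obtain c where c: "c \<in> charts_at (atlas M) (\<gamma>1 t)" by (rule exists_chart)
    then have c2: "c \<in> charts_at (atlas M) (\<gamma>2 t)" using eq by simp
    note cA = charts_atD[OF c]
    obtain e1 where e1: "0 < e1" "{t - e1..t + e1} \<subseteq> I" "\<gamma>1 ` {t - e1..t + e1} \<subseteq> chart_dom c"
      by (rule geodesic_near_chart[OF g1 tI(1) c])
    obtain e2 where e2: "0 < e2" "{t - e2..t + e2} \<subseteq> J" "\<gamma>2 ` {t - e2..t + e2} \<subseteq> chart_dom c"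
      by (rule geodesic_near_chart[OF g2 tI(2) c2])
    define e where "e = min e1 e2"
    have e: "0 < e" "{t - e..t + e} \<subseteq> I" "{t - e..t + e} \<subseteq> J"
      "\<gamma>1 ` {t - e..t + e} \<subseteq> chart_dom c" "\<gamma>2 ` {t - e..t + e} \<subseteq> chart_dom c"
    proof -
      have sub: "{t - e..t + e} \<subseteq> {t - e1..t + e1}" "{t - e..t + e} \<subseteq> {t - e2..t + e2}"
        by (auto simp: e_def)
      show "0 < e" using e1(1) e2(1) by (simp add: e_def)
      show "{t - e..t + e} \<subseteq> I" "{t - e..t + e} \<subseteq> J"
        by (rule order_trans[OF sub(1) e1(2)], rule order_trans[OF sub(2) e2(2)])
      show "\<gamma>1 ` {t - e..t + e} \<subseteq> chart_dom c" "\<gamma>2 ` {t - e..t + e} \<subseteq> chart_dom c"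
        by (rule order_trans[OF image_mono[OF sub(1)] e1(3)], rule order_trans[OF image_mono[OF sub(2)] e2(3)])
    qed
    interpret lorentz_patch "chart_img c" "metric_in M c" by (rule patch[OF cA(1)])
    have arcs: "geodesic_arc (coord c \<gamma>1) (coord' c \<gamma>1) {t - e..t + e}"
      "geodesic_arc (coord c \<gamma>2) (coord' c \<gamma>2) {t - e..t + e}"
      using geodesic_arc_chart[OF g1 cA(1) e(2,4)] geodesic_arc_chart[OF g2 cA(1) e(3,5)] by auto
    let ?x = "chart_map c (\<gamma>1 t)"
    obtain R where R: "0 < R" "cball ?x R \<subseteq> chart_img c"
      using open_img[OF cA(1)] map_img[OF cA] open_contains_cball by blast
    obtain G \<kappa> where "lorentz_ball (chart_img c) (metric_in M c) (cball ?x R) G \<kappa>"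
      using ball_constants[OF compact_cball convex_cball R(2)] .
    then interpret lorentz_ball "chart_img c" "metric_in M c" "cball ?x R" G \<kappa> .
    have "bounded (coord' c \<gamma>1 ` {t - e..t + e} \<union> coord' c \<gamma>2 ` {t - e..t + e})"
      using geodesic_arc_continuous(2)[OF arcs(1)] geodesic_arc_continuous(2)[OF arcs(2)]
      by (intro bounded_Un[THEN iffD2] conjI compact_imp_bounded compact_continuous_image) auto
    then obtain N where N: "\<And>r. r \<in> {t - e..t + e} \<Longrightarrow> norm (coord' c \<gamma>1 r) \<le> N \<and> norm (coord' c \<gamma>2 r) \<le> N"
      unfolding bounded_iff by (metis UnCI image_eqI)
    have near: "\<exists>\<delta>>0. \<forall>r. dist r t < \<delta> \<longrightarrow> coord c \<gamma> r \<in> cball ?x R"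
      if "geodesic_arc (coord c \<gamma>) (coord' c \<gamma>) {t - e..t + e}" "coord c \<gamma> t = ?x" for \<gamma>
    proof -
      have "isCont (coord c \<gamma>) t"
        using geodesic_arc_continuous(1)[OF that(1)] e(1)
        by (intro continuous_on_interior[of "{t - e..t + e}"]) auto
      then obtain \<delta> where "0 < \<delta>" "\<And>r. dist r t < \<delta> \<Longrightarrow> dist (coord c \<gamma> r) (coord c \<gamma> t) < R"
        using R(1) unfolding continuous_at_eps_delta by blast
      then show ?thesis
        using that(2) by (intro exI[of _ \<delta>]) (auto simp: dist_commute less_imp_le)
    qed
    obtain \<delta>1 where \<delta>1: "0 < \<delta>1" "\<And>r. dist r t < \<delta>1 \<Longrightarrow> coord c \<gamma>1 r \<in> cball ?x R"
      using near[OF arcs(1)] by auto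
    obtain \<delta>2 where \<delta>2: "0 < \<delta>2" "\<And>r. dist r t < \<delta>2 \<Longrightarrow> coord c \<gamma>2 r \<in> cball ?x R"
      using near[OF arcs(2)] eq by auto
    define \<delta> where "\<delta> = min e (min \<delta>1 \<delta>2) / 2"
    have \<delta>: "0 < \<delta>" "\<delta> < e" "\<delta> < \<delta>1" "\<delta> < \<delta>2"
      using e(1) \<delta>1(1) \<delta>2(1) by (auto simp: \<delta>_def)
    have sub: "{t - \<delta>..t + \<delta>} \<subseteq> {t - e..t + e}" using \<delta> by auto
    obtain L where flow: "\<And>z1 v1 z2 v2 a b s t. \<lbrakk>geodesic_arc z1 v1 {a..b}; geodesic_arc z2 v2 {a..b};
        \<And>r. r \<in> {a..b} \<Longrightarrow> z1 r \<in> cball ?x R \<and> z2 r \<in> cball ?x R \<and> norm (v1 r) \<le> N \<and> norm (v2 r) \<le> N;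
        s \<in> {a..b}; t \<in> {a..b}\<rbrakk>
      \<Longrightarrow> norm (z1 t - z2 t, v1 t - v2 t) \<le> exp (L * \<bar>t - s\<bar>) * norm (z1 s - z2 s, v1 s - v2 s)"
      using geodesic_flow_lipschitz by blast
    have agree: "\<gamma>1 r = \<gamma>2 r" if r: "r \<in> {t - \<delta>..t + \<delta>}" for r
    proof -
      have "norm (coord c \<gamma>1 r - coord c \<gamma>2 r, coord' c \<gamma>1 r - coord' c \<gamma>2 r)
          \<le> exp (L * \<bar>r - t\<bar>) * norm (coord c \<gamma>1 t - coord c \<gamma>2 t, coord' c \<gamma>1 t - coord' c \<gamma>2 t)"
      proof (rule flow[OF geodesic_arc_subset[OF arcs(1) sub] geodesic_arc_subset[OF arcs(2) sub]])
        fix r assume r: "r \<in> {t - \<delta>..t + \<delta>}"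
        then have "dist r t \<le> \<delta>" by (auto simp: dist_real_def)
        then show "coord c \<gamma>1 r \<in> cball ?x R \<and> coord c \<gamma>2 r \<in> cball ?x R \<and>
            norm (coord' c \<gamma>1 r) \<le> N \<and> norm (coord' c \<gamma>2 r) \<le> N"
          using \<delta>1(2)[of r] \<delta>2(2)[of r] N[of r] r \<delta> sub by auto
      qed (use r \<delta>(1) in auto)
      moreover have "coord' c \<gamma>1 t = coord' c \<gamma>2 t"
        using geodesic_velocity(3)[OF g1 tI(1) c] geodesic_velocity(3)[OF g2 tI(2) c2] eq by simp
      ultimately have "chart_map c (\<gamma>1 r) = chart_map c (\<gamma>2 r)"
        using eq by (simp add: zero_prod_def)
      moreover have "\<gamma>1 r \<in> chart_dom c" "\<gamma>2 r \<in> chart_dom c"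
        using e r sub by auto
      ultimately show ?thesis
        using inv_map[OF cA(1)] by metis
    qed
    have "ball t \<delta> \<subseteq> A"
    proof
      fix r assume "r \<in> ball t \<delta>"
      then have r: "r \<in> {t - \<delta><..<t + \<delta>}" by (auto simp: dist_real_def)
      then have "\<forall>\<^sub>F s in nhds r. s \<in> {t - \<delta><..<t + \<delta>}"
        by (intro eventually_nhds_in_open) auto
      then have "\<forall>\<^sub>F s in at r. \<gamma>1 s = \<gamma>2 s"
        unfolding eventually_at_filter by eventually_elim (auto intro: agree)
      moreover have "\<gamma>1 r = \<gamma>2 r" using r by (intro agree) auto
      moreover have "r \<in> I \<inter> J" using r sub e by auto
      ultimately show "r \<in> A"
        using velocity_cong by (auto simp: A_def)
    qed
    with \<delta>(1) show "\<exists>e>0. ball t e \<subseteq> A" by blast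
  qed
  then have "openin (top_of_set (I \<inter> J)) A"
    by (intro open_subset) (auto simp: A_def)
  \<comment> \<open>Positions converge in \<open>M\<close>. Velocities are compared in one chart
    around the limit point, which contains the tail of the sequence.\<close>
  moreover have "closedin (top_of_set (I \<inter> J)) A"
    unfolding closedin_limpt
  proof (intro conjI allI impI, goal_cases)
    case 1
    show ?case by (auto simp: A_def)
  next
    case (2 t)
    then obtain x where xA: "\<forall>n. x n \<in> A" and lim: "x \<longlonglongrightarrow> t" and tK: "t \<in> I \<inter> J"
      unfolding islimpt_sequential by blast
    have xK: "x n \<in> I" "x n \<in> J" "\<gamma>1 (x n) = \<gamma>2 (x n)" "velocity (atlas M) \<gamma>1 (x n) = velocity (atlas M) \<gamma>2 (x n)" for n
      using xA by (auto simp: A_def)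
    have tI: "t \<in> I" "t \<in> J" using tK by auto
    have cont: "isCont \<gamma>1 t" "isCont \<gamma>2 t"
      using geodesicD[OF g1] geodesicD[OF g2] tI by (auto simp: continuous_on_eq_continuous_at)
    have l1: "(\<lambda>n. \<gamma>1 (x n)) \<longlonglongrightarrow> \<gamma>1 t" and l2: "(\<lambda>n. \<gamma>2 (x n)) \<longlonglongrightarrow> \<gamma>2 t"
      using isCont_tendsto_compose[OF cont(1) lim] isCont_tendsto_compose[OF cont(2) lim] by auto
    have eq: "\<gamma>1 t = \<gamma>2 t"
      using LIMSEQ_unique[OF l1] l2 by (simp add: xK)
    obtain c where c: "c \<in> charts_at (atlas M) (\<gamma>1 t)" by (rule exists_chart)
    then have c2: "c \<in> charts_at (atlas M) (\<gamma>2 t)" using eq by simp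
    have "isCont (coord' c \<gamma>1) t" "isCont (coord' c \<gamma>2) t"
      using has_vector_derivative_continuous[OF geodesic_at(2)[OF g1 tI(1) c]]
        has_vector_derivative_continuous[OF geodesic_at(2)[OF g2 tI(2) c2]] by auto
    then have v1: "(\<lambda>n. coord' c \<gamma>1 (x n)) \<longlonglongrightarrow> coord' c \<gamma>1 t" and v2: "(\<lambda>n. coord' c \<gamma>2 (x n)) \<longlonglongrightarrow> coord' c \<gamma>2 t"
      using isCont_tendsto_compose[OF _ lim] by blast+
    have "\<forall>\<^sub>F n in sequentially. \<gamma>1 (x n) \<in> chart_dom c"
      using topological_tendstoD[OF l1 open_dom] charts_atD[OF c] by blast
    then have "\<forall>\<^sub>F n in sequentially. coord' c \<gamma>1 (x n) = coord' c \<gamma>2 (x n)"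
    proof eventually_elim
      case (elim n)
      then have "c \<in> charts_at (atlas M) (\<gamma>1 (x n))" "c \<in> charts_at (atlas M) (\<gamma>2 (x n))"
        using xK charts_atD[OF c] by (auto simp: charts_at_def)
      then show ?case
        using geodesic_velocity(3)[OF g1 xK(1)] geodesic_velocity(3)[OF g2 xK(2)] xK(4)[of n] by metis
    qed
    then have "(\<lambda>n. coord' c \<gamma>2 (x n)) \<longlonglongrightarrow> coord' c \<gamma>1 t"
      using v1 tendsto_cong by fastforce
    then have "coord' c \<gamma>1 t = coord' c \<gamma>2 t"
      using v2 LIMSEQ_unique by blast
    then have "velocity (atlas M) \<gamma>1 t c = velocity (atlas M) \<gamma>2 t c"
      using geodesic_velocity(3)[OF g1 tI(1) c] geodesic_velocity(3)[OF g2 tI(2) c2] by simp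
    then have "velocity (atlas M) \<gamma>1 t = velocity (atlas M) \<gamma>2 t"
      using tangent_eqI[OF c] geodesic_velocity(2)[OF g1 tI(1)] geodesic_velocity(2)[OF g2 tI(2)] eq by metis
    with eq tK show ?case by (simp add: A_def)
  qed
  ultimately have "A = {} \<or> A = I \<inter> J"
    using K unfolding connected_clopen by blast
  moreover have "t0 \<in> A" using t0 eq0 by (simp add: A_def)
  ultimately show ?thesis using t by (auto simp: A_def)
qed

lemma max_geodesic_eq:
  assumes "geodesic_with_init M v I \<gamma>" "t \<in> I"
  shows "max_geodesic M v t = \<gamma> t"
  unfolding max_geodesic_def
proof (rule the_equality)
  show "\<exists>I \<gamma>'. geodesic_with_init M v I \<gamma>' \<and> t \<in> I \<and> \<gamma>' t = \<gamma> t" using assms by blast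
  fix q assume "\<exists>I \<gamma>. geodesic_with_init M v I \<gamma> \<and> t \<in> I \<and> \<gamma> t = q"
  then obtain J \<gamma>' where J: "geodesic_with_init M v J \<gamma>'" "t \<in> J" "\<gamma>' t = q" by blast
  have "\<gamma>' t = \<gamma> t"
    by (rule geodesic_unique[of J \<gamma>' I \<gamma> 0])
      (use J assms velocity_eq in \<open>auto simp: geodesic_with_init_def\<close>)
  with J show "q = \<gamma> t" by simp
qed

text \<open>The derivative vanishes in each chart by \<open>geodesic_arc_speed\<close>, and the
  domain is an interval.\<close>

lemma geodesic_speed_constant:
  assumes geo: "geodesic M I \<gamma>" and "s \<in> I" "t \<in> I"
  shows "metric M (\<gamma> s) (velocity (atlas M) \<gamma> s) (velocity (atlas M) \<gamma> s)
    = metric M (\<gamma> t) (velocity (atlas M) \<gamma> t) (velocity (atlas M) \<gamma> t)" (is "?F s = ?F t")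
proof -
  have "(?F has_real_derivative 0) (at r within I)" if r: "r \<in> I" for r
  proof -
    obtain c where c: "c \<in> charts_at (atlas M) (\<gamma> r)" by (rule exists_chart)
    note cA = charts_atD[OF c]
    interpret lorentz_patch "chart_img c" "metric_in M c" by (rule patch[OF cA(1)])
    obtain e where e: "0 < e" "{r - e..r + e} \<subseteq> I" "\<gamma> ` {r - e..r + e} \<subseteq> chart_dom c"
      by (rule geodesic_near_chart[OF geo r c])
    have eq: "?F s = metric_in M c (coord c \<gamma> s) (coord' c \<gamma> s) (coord' c \<gamma> s)" if "s \<in> {r - e..r + e}" for s
    proof -
      have "c \<in> charts_at (atlas M) (\<gamma> s)" "s \<in> I" using that e cA by (auto simp: charts_at_def)
      then show ?thesis
        using metric_chart[of c "\<gamma> s"] geodesic_velocity[OF geo] by simp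
    qed
    have "((\<lambda>s. metric_in M c (coord c \<gamma> s) (coord' c \<gamma> s) (coord' c \<gamma> s)) has_real_derivative 0)
        (at r within {r - e..r + e})"
      by (rule geodesic_arc_speed[OF geodesic_arc_chart[OF geo cA(1) e(2,3)]]) (use e in auto)
    then have "((\<lambda>s. metric_in M c (coord c \<gamma> s) (coord' c \<gamma> s) (coord' c \<gamma> s)) has_real_derivative 0) (at r)"
      using at_within_interior[of r "{r - e..r + e}"] e(1) by simp
    then have "(?F has_real_derivative 0) (at r)"
      by (rule has_field_derivative_transform_within_open[where S = "{r - e<..<r + e}"]) (use e(1) eq in auto)
    then show ?thesis by (rule has_field_derivative_at_within)
  qed
  moreover have "convex I" using geodesicD(2)[OF geo] by (rule is_interval_convex)
  ultimately obtain k where "\<And>x. x \<in> I \<Longrightarrow> ?F x = k"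
    using has_field_derivative_zero_constant[of I ?F] by blast
  then show ?thesis using assms(2,3) by metis
qed

text \<open>The velocity stays timelike, so its product with \<open>time_field\<close> is continuous
  and never 0 on an interval and keeps its sign.\<close>

lemma geodesic_future_pointing:
  assumes geo: "geodesic M I \<gamma>" and s: "s \<in> I" and t: "t \<in> I"
    and timelike: "metric M (\<gamma> s) (velocity (atlas M) \<gamma> s) (velocity (atlas M) \<gamma> s) < 0"
    and fut: "future_pointing M (\<gamma> s) (velocity (atlas M) \<gamma> s)"
  shows "future_pointing M (\<gamma> t) (velocity (atlas M) \<gamma> t)"
    and "c \<in> charts_at (atlas M) (\<gamma> t) \<Longrightarrow> metric_in M c (coord c \<gamma> t) (coord_time c (coord c \<gamma> t)) (coord' c \<gamma> t) < 0"
proof -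
  define F where "F t = metric M (\<gamma> t) (time_field M (\<gamma> t)) (velocity (atlas M) \<gamma> t)" for t
  have chartF: "F r = metric_in M c (coord c \<gamma> r) (coord_time c (coord c \<gamma> r)) (coord' c \<gamma> r)"
    if "r \<in> I" "c \<in> charts_at (atlas M) (\<gamma> r)" for r c
    using metric_chart[OF that(2) time_field_in geodesic_velocity(2)[OF geo that(1)]]
      geodesic_velocity(3)[OF geo that] coord_time[OF that(2)] by (simp add: F_def)
  have tl: "metric M (\<gamma> r) (velocity (atlas M) \<gamma> r) (velocity (atlas M) \<gamma> r) < 0" if "r \<in> I" for r
    using geodesic_speed_constant[OF geo s that] timelike by simp
  have nz: "F r \<noteq> 0" if r: "r \<in> I" for r
  proof -
    obtain c where c: "c \<in> charts_at (atlas M) (\<gamma> r)" by (rule exists_chart)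
    interpret lorentz_patch "chart_img c" "metric_in M c" by (rule patch[OF charts_atD(1)[OF c]])
    have "chart_map c (\<gamma> r) \<in> chart_img c" using map_img charts_atD[OF c] by blast
    from timelike_nonzero[OF this] show ?thesis
      using tl[OF r] time_field_timelike[of "\<gamma> r"] metric_chart[OF c] time_field_in geodesic_velocity(2)[OF geo r]
      by (simp add: F_def)
  qed
  have "continuous_on I F"
    unfolding continuous_on_eq_continuous_at[OF geodesicD(1)[OF geo]]
  proof
    fix r assume r: "r \<in> I"
    obtain c where c: "c \<in> charts_at (atlas M) (\<gamma> r)" by (rule exists_chart)
    note cA = charts_atD[OF c]
    \<comment> \<open>Only the continuity of \<open>coord_time\<close> is wanted here, so the empty
      set stands in for the hypersurface.\<close>
    interpret causal_patch "chart_img c" "metric_in M c" "coord_time c"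
      "\<lambda>x. time_separation_from M {} (chart_inv c x)" by (rule causal_patch[OF cA(1)])
    obtain e where e: "0 < e" "{r - e..r + e} \<subseteq> I" "\<gamma> ` {r - e..r + e} \<subseteq> chart_dom c"
      by (rule geodesic_near_chart[OF geo r c])
    note arc = geodesic_arc_chart[OF geo cA(1) e(2,3)]
    have img: "coord c \<gamma> ` {r - e..r + e} \<subseteq> chart_img c"
      using arc by (auto simp: geodesic_arc_def)
    have "continuous_on {r - e..r + e} (\<lambda>s. metric_in M c (coord c \<gamma> s) (coord_time c (coord c \<gamma> s)) (coord' c \<gamma> s))"
      by (intro continuous_on_g geodesic_arc_continuous[OF arc] img
        continuous_on_compose2[OF X_continuous geodesic_arc_continuous(1)[OF arc] img])
    then have "continuous_on {r - e..r + e} F"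
    proof (rule continuous_on_eq)
      fix s assume "s \<in> {r - e..r + e}"
      then have "s \<in> I" "c \<in> charts_at (atlas M) (\<gamma> s)"
        using e cA by (auto simp: charts_at_def)
      then show "metric_in M c (coord c \<gamma> s) (coord_time c (coord c \<gamma> s)) (coord' c \<gamma> s) = F s"
        by (rule chartF[symmetric])
    qed
    then show "isCont F r"
      by (rule continuous_on_interior) (use e(1) in auto)
  qed
  then have "connected (F ` I)"
    using geodesicD(2)[OF geo] by (intro connected_continuous_image) (auto simp: is_interval_connected)
  then have int: "is_interval (F ` I)" by (simp add: is_interval_connected_1)
  have Fs: "F s < 0" using fut by (simp add: F_def future_pointing_def)
  have neg: "F r < 0" if r: "r \<in> I" for r
  proof (rule ccontr)
    assume "\<not> F r < 0"
    then have "F s \<le> 0 \<and> 0 \<le> F r" using Fs by simp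
    then have "0 \<in> F ` I"
      using int[unfolded is_interval_1, rule_format, OF imageI[OF s] imageI[OF r]] by blast
    then show False using nz by auto
  qed
  show "future_pointing M (\<gamma> t) (velocity (atlas M) \<gamma> t)"
  proof -
    have "velocity (atlas M) \<gamma> t \<noteq> (\<lambda>_. 0)"
    proof
      assume z: "velocity (atlas M) \<gamma> t = (\<lambda>_. 0)"
      obtain c where c: "c \<in> charts_at (atlas M) (\<gamma> t)" by (rule exists_chart)
      interpret lorentz_patch "chart_img c" "metric_in M c" by (rule patch[OF charts_atD(1)[OF c]])
      have "chart_map c (\<gamma> t) \<in> chart_img c" using map_img charts_atD[OF c] by blast
      then show False
        using tl[OF t] metric_chart[OF c geodesic_velocity(2)[OF geo t] geodesic_velocity(2)[OF geo t]]
        by (simp add: z g_simps)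
    qed
    then show ?thesis
      using neg[OF t] tl[OF t] geodesic_velocity(2)[OF geo t]
      by (simp add: future_pointing_def causal_vector_def F_def)
  qed
  show "metric_in M c (coord c \<gamma> t) (coord_time c (coord c \<gamma> t)) (coord' c \<gamma> t) < 0"
    if "c \<in> charts_at (atlas M) (\<gamma> t)"
    using neg[OF t] chartF[OF t that] by simp
qed

lemma geodesic_locally_lipschitz:
  assumes geo: "geodesic M I \<gamma>" and sub: "{a..b} \<subseteq> I"
  shows "locally_lipschitz_curve M {a..b} \<gamma>"
proof (rule locally_lipschitz_curveI)
  show "continuous_on {a..b} \<gamma>"
    using geodesicD(3)[OF geo] sub by (rule continuous_on_subset)
  fix t assume "t \<in> {a..b}"
  obtain c where c: "c \<in> charts_at (atlas M) (\<gamma> t)" by (rule exists_chart)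
  note cA = charts_atD[OF c]
  interpret lorentz_patch "chart_img c" "metric_in M c" by (rule patch[OF cA(1)])
  let ?W = "I \<inter> \<gamma> -` chart_dom c"
  have oW: "open ?W"
    by (rule continuous_open_preimage[OF geodesicD(3,1)[OF geo] open_dom[OF cA(1)]])
  have cW: "c \<in> charts_at (atlas M) (\<gamma> r)" if "r \<in> ?W" for r
    using that cA by (auto simp: charts_at_def)
  have "Ck_on (Suc 0) (coord c \<gamma>) ?W"
  proof (simp only: Ck_on.simps, intro conjI ballI allI)
    fix r assume r: "r \<in> ?W"
    show "coord c \<gamma> differentiable at r"
      using geodesic_at(1)[OF geo _ cW[OF r]] r by (auto simp: differentiableI_vector)
  next
    fix v :: real
    have "continuous_on ?W (\<lambda>r. v *\<^sub>R coord' c \<gamma> r)"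
      using has_vector_derivative_continuous[OF geodesic_at(2)[OF geo _ cW]]
      by (intro continuous_intros) (auto simp: continuous_on_eq_continuous_at[OF oW])
    then show "continuous_on ?W (\<lambda>r. frechet_derivative (coord c \<gamma>) (at r) v)"
    proof (rule continuous_on_eq)
      fix r assume r: "r \<in> ?W"
      then have "(coord c \<gamma> has_derivative (\<lambda>h. h *\<^sub>R coord' c \<gamma> r)) (at r)"
        using geodesic_at(1)[OF geo _ cW[OF r]] by (simp add: has_vector_derivative_def)
      from frechet_derivative_at[OF this]
      show "v *\<^sub>R coord' c \<gamma> r = frechet_derivative (coord c \<gamma>) (at r) v" by metis
    qed
  qed
  from locally_lipschitz_on_subset[OF Ck_on_locally_lipschitz[OF this oW]]
  have "locally_lipschitz_on (coord c \<gamma>) ({a..b} \<inter> \<gamma> -` chart_dom c)"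
    using sub by blast
  with c show "\<exists>c\<in>charts_at (atlas M) (\<gamma> t). locally_lipschitz_on (coord c \<gamma>) ({a..b} \<inter> \<gamma> -` chart_dom c)"
    by blast
qed

end

section \<open>The cut locus\<close>

context spacetime_setting
begin

text \<open>The second derivative of the rescaled curve acquires the factor \<open>a * a\<close>,
  and so does the Christoffel term by \<open>Gam_scale\<close>. This identifies the exponential of
  \<open>s\<close> times \<open>v\<close> with the geodesic of \<open>v\<close> at time
  \<open>s\<close>.\<close>

lemma geodesic_rescale:
  assumes init: "geodesic_with_init M (p, v) I \<gamma>" and a: "a \<noteq> 0"
  shows "geodesic_with_init M (p, tscale a v) ((\<lambda>t. a * t) -` I) (\<lambda>t. \<gamma> (a * t))"
proof -
  have geo: "geodesic M I \<gamma>" and 0: "0 \<in> I" "\<gamma> 0 = p" and hv: "has_velocity (atlas M) \<gamma> 0 v"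
    using init by (auto simp: geodesic_with_init_def)
  have chain: "((\<lambda>s. f (a * s)) has_vector_derivative a *\<^sub>R f') (at t)"
    if "(f has_vector_derivative f') (at (a * t))" for f :: "real \<Rightarrow> 'e" and f' t
  proof -
    have "((\<lambda>s. a * s) has_vector_derivative a) (at t)"
      by (auto intro!: derivative_eq_intros)
    from vector_diff_chain_at[OF this that] show ?thesis by (simp add: o_def)
  qed
  have "geodesic M ((\<lambda>t. a * t) -` I) (\<lambda>t. \<gamma> (a * t))"
    unfolding geodesic_def Let_def
  proof (intro conjI ballI)
    show "open ((\<lambda>t. a * t) -` I)"
      by (intro open_vimage geodesicD(1)[OF geo] continuous_intros)
    show "is_interval ((\<lambda>t. a * t) -` I)"
    proof -
      have "convex ((\<lambda>t. a * t) -` I)"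
        using is_interval_convex[OF geodesicD(2)[OF geo]] by (intro convex_linear_vimage) (auto intro: linearI simp: algebra_simps)
      then show ?thesis by (simp add: is_interval_convex_1)
    qed
    show "continuous_on ((\<lambda>t. a * t) -` I) (\<lambda>t. \<gamma> (a * t))"
      by (rule continuous_on_compose2[OF geodesicD(3)[OF geo]]) (auto intro!: continuous_intros)
    fix t c assume t: "t \<in> (\<lambda>t. a * t) -` I" and c: "c \<in> charts_at (atlas M) (\<gamma> (a * t))"
    note cA = charts_atD[OF c]
    have oW: "open ((\<lambda>t. a * t) -` (I \<inter> \<gamma> -` chart_dom c))"
      by (intro open_vimage continuous_open_preimage[OF geodesicD(3,1)[OF geo] open_dom[OF cA(1)]] continuous_intros)
    have der: "((chart_map c \<circ> (\<lambda>t. \<gamma> (a * t))) has_vector_derivative a *\<^sub>R coord' c \<gamma> (a * s)) (at s)"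
      if "s \<in> (\<lambda>t. a * t) -` (I \<inter> \<gamma> -` chart_dom c)" for s
      using chain[OF geodesic_at(1)[OF geo, of "a * s" c]] that cA by (simp add: charts_at_def o_def)
    have tW: "t \<in> (\<lambda>t. a * t) -` (I \<inter> \<gamma> -` chart_dom c)" using t cA by auto
    show "(chart_map c \<circ> (\<lambda>t. \<gamma> (a * t))) differentiable at t"
      using der[OF tW] by (rule differentiableI_vector)
    interpret lorentz_patch "chart_img c" "metric_in M c" by (rule patch[OF cA(1)])
    have xU: "coord c \<gamma> (a * t) \<in> chart_img c" using map_img[OF cA] by simp
    let ?x' = "\<lambda>s. vector_derivative (chart_map c \<circ> (\<lambda>t. \<gamma> (a * t))) (at s)"
    have x': "?x' s = a *\<^sub>R coord' c \<gamma> (a * s)" if "s \<in> (\<lambda>t. a * t) -` (I \<inter> \<gamma> -` chart_dom c)" for s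
      using der[OF that] by (rule vector_derivative_at)
    have "((\<lambda>s. a *\<^sub>R coord' c \<gamma> (a * s)) has_vector_derivative
        a *\<^sub>R (a *\<^sub>R (- christoffel M c (coord c \<gamma> (a * t)) (coord' c \<gamma> (a * t)) (coord' c \<gamma> (a * t))))) (at t)"
      using chain[OF geodesic_at(2)[OF geo _ c]] t
      by (intro bounded_linear.has_vector_derivative[OF bounded_linear_scaleR_right]) simp
    also have "a *\<^sub>R (a *\<^sub>R (- christoffel M c (coord c \<gamma> (a * t)) (coord' c \<gamma> (a * t)) (coord' c \<gamma> (a * t))))
        = - christoffel M c ((chart_map c \<circ> (\<lambda>t. \<gamma> (a * t))) t) (?x' t) (?x' t)"
      unfolding x'[OF tW] christoffel_Gam[OF cA(1)]
      using Gam_scale[OF xU, of a "coord' c \<gamma> (a * t)"] by simp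
    finally show "(?x' has_vector_derivative
        - christoffel M c ((chart_map c \<circ> (\<lambda>t. \<gamma> (a * t))) t) (?x' t) (?x' t)) (at t)"
      by (rule has_vector_derivative_transform_within_open[OF _ oW tW]) (rule x'[symmetric])
  qed
  moreover have "has_velocity (atlas M) (\<lambda>t. \<gamma> (a * t)) 0 (tscale a v)"
    unfolding has_velocity_def
  proof (intro conjI ballI)
    have v: "v \<in> tangent_space (atlas M) p" using hv 0 by (simp add: has_velocity_def)
    have "tscale a v \<in> tangent_space (atlas M) p"
      unfolding tangent_space_def mem_Collect_eq
    proof (intro conjI ballI allI impI)
      fix c d assume cd: "c \<in> charts_at (atlas M) p" "d \<in> charts_at (atlas M) p"
      have "v d = dtr c d (chart_map c p) (v c)"
        using v cd unfolding tangent_space_def by blast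
      then show "tscale a v d = dtr c d (chart_map c p) (tscale a v c)"
        using linear_cmul[OF has_derivative_linear[OF transition_derivative[OF cd]]] by (simp add: tscale_def)
    next
      fix c assume "c \<notin> charts_at (atlas M) p"
      then have "v c = 0" using v unfolding tangent_space_def by blast
      then show "tscale a v c = 0" by (simp add: tscale_def)
    qed
    then show "tscale a v \<in> tangent_space (atlas M) (\<gamma> (a * 0))" using 0 by simp
    fix c assume "c \<in> charts_at (atlas M) (\<gamma> (a * 0))"
    then have "(coord c \<gamma> has_vector_derivative v c) (at (a * 0))"
      using hv by (simp add: has_velocity_def)
    from chain[OF this] show "((chart_map c \<circ> (\<lambda>t. \<gamma> (a * t))) has_vector_derivative tscale a v c) (at 0)"
      by (simp add: tscale_def o_def)
  qed
  ultimately show ?thesis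
    using 0 by (simp add: geodesic_with_init_def)
qed

lemma unit_geodesic_smooth_causal:
  assumes geo: "geodesic M I \<gamma>" and sub: "{a..b} \<subseteq> I" and ab: "a < b"
    and unit: "\<And>t. t \<in> I \<Longrightarrow> metric M (\<gamma> t) (velocity (atlas M) \<gamma> t) (velocity (atlas M) \<gamma> t) = -1"
    and fut: "\<And>t. t \<in> I \<Longrightarrow> future_pointing M (\<gamma> t) (velocity (atlas M) \<gamma> t)"
  shows "smooth_causal (b - a) (\<lambda>t. \<gamma> (t + a)) (\<lambda>_. 1)"
  unfolding smooth_causal_def
proof (intro conjI ballI)
  show "locally_lipschitz_curve M {0..b - a} (\<lambda>t. \<gamma> (t + a))"
    using locally_lipschitz_curve_shift[OF geodesic_locally_lipschitz[OF geo sub], of "- a"] by simp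
  fix t assume "t \<in> {0<..<b - a}"
  then have t: "t + a \<in> I" using sub by auto
  have "has_velocity (atlas M) (\<lambda>t. \<gamma> (t + a)) t (velocity (atlas M) \<gamma> (t + a))"
    using has_velocity_shift[of \<gamma> t "- a"] geodesic_velocity(1)[OF geo t] by simp
  then show "\<exists>w. has_velocity (atlas M) (\<lambda>t. \<gamma> (t + a)) t w \<and> future_pointing M (\<gamma> (t + a)) w \<and>
      sqrt \<bar>metric M (\<gamma> (t + a)) w w\<bar> = 1"
    using unit[OF t] fut[OF t] by auto
qed (use ab in auto)

lemma curve_length_unit:
  assumes "0 \<le> t" "\<And>r. r \<in> {0..t} \<Longrightarrow> speed \<gamma> r = 1"
  shows "curve_length M 0 t \<gamma> = t"
proof -
  have "curve_length M 0 t \<gamma> = (LINT r:{0..t}|lebesgue. 1)"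
    unfolding curve_length_speed by (rule set_lebesgue_integral_cong) (use assms in auto)
  then show ?thesis
    using assms(1) by (simp add: set_lebesgue_integral_def)
qed

text \<open>The cut function is a supremum of parameters; it has to be translated into the local
  description of a cut point, where \<open>u\<close> is realised at every parameter shortly before
  \<open>s\<close> and at none shortly after.\<close>

lemma measure_zero_future_cut_locus: "measure_zero M (future_cut_locus M S)"
  unfolding measure_zero_def
proof
  fix c assume cA: "c \<in> atlas M"
  interpret causal_patch "chart_img c" "metric_in M c" "coord_time c"
    "\<lambda>x. time_separation_from M S (chart_inv c x)" by (rule causal_patch[OF cA])
  show "negligible (chart_map c ` (chart_dom c \<inter> future_cut_locus M S))"
  proof (rule negligible_subset[OF negligible_cut_locus], intro subsetI, elim imageE)
    fix x q assume x: "x = chart_map c q" and "q \<in> chart_dom c \<inter> future_cut_locus M S"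
    then obtain p v s where qc: "q \<in> chart_dom c" and q: "q = exp_map M (p, tscale s v)"
      and pv: "(p, v) \<in> future_unit_normals M S"
      and cut: "cut_function M S (p, v) = ereal s" and sD: "s \<in> geodesic_domain M (p, v)"
      by (auto simp: future_cut_locus_def tangential_cut_locus_def)
    from sD obtain I \<gamma> where init: "geodesic_with_init M (p, v) I \<gamma>" and sI: "s \<in> I"
      by (auto simp: geodesic_domain_def)
    then have geo: "geodesic M I \<gamma>" and 0: "0 \<in> I" "\<gamma> 0 = p" and hv: "has_velocity (atlas M) \<gamma> 0 v"
      by (auto simp: geodesic_with_init_def)
    have v0: "velocity (atlas M) \<gamma> 0 = v" by (rule velocity_eq[OF hv])
    have pS: "p \<in> S" and vv: "metric M p v v = -1" and vf: "future_pointing M p v"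
      using pv by (auto simp: future_unit_normals_def normal_bundle_def)
    have unit: "metric M (\<gamma> t) (velocity (atlas M) \<gamma> t) (velocity (atlas M) \<gamma> t) = -1" if "t \<in> I" for t
      using geodesic_speed_constant[OF geo that 0(1)] v0 0 vv by simp
    have fut: "future_pointing M (\<gamma> t) (velocity (atlas M) \<gamma> t)" if "t \<in> I" for t
      by (rule geodesic_future_pointing(1)[OF geo 0(1) that]) (use v0 0 vv vf in auto)
    have Iconn: "r \<in> I" if "t \<in> I" "0 \<le> r" "r \<le> t" for r t
      using geodesicD(2)[OF geo] 0(1) that unfolding is_interval_1 by blast
    have speed\<gamma>: "speed \<gamma> t = 1" if "t \<in> I" for t
      using unit[OF that] by (simp add: speed_def)
    \<comment> \<open>The cut function measures the length of \<open>max_geodesic\<close>, which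
      agrees with \<open>\<gamma>\<close> on the open set \<open>I\<close> and therefore has the
      same velocity there.\<close>
    have speedmax: "speed (max_geodesic M (p, v)) t = 1" if t: "t \<in> I" for t
    proof -
      have "\<forall>\<^sub>F r in nhds t. r \<in> I"
        using geodesicD(1)[OF geo] t by (rule eventually_nhds_in_open)
      then have "\<forall>\<^sub>F r in at t. max_geodesic M (p, v) r = \<gamma> r"
        unfolding eventually_at_filter by eventually_elim (simp add: max_geodesic_eq[OF init])
      then show ?thesis
        using speed_cong[of "max_geodesic M (p, v)" \<gamma> t] max_geodesic_eq[OF init t] speed\<gamma>[OF t] by simp
    qed
    define B where "B = {t. 0 < t \<and> t \<in> geodesic_domain M (p, v) \<and>
      time_separation_from M S (max_geodesic M (p, v) t) = ennreal (curve_length M 0 t (max_geodesic M (p, v)))}"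
    have SupB: "Sup (ereal ` B) = ereal s"
      using cut unfolding cut_function_def B_def by (simp add: image_Collect)
    have B_iff: "t \<in> B \<longleftrightarrow> time_separation_from M S (\<gamma> t) = ennreal t" if t: "t \<in> I" "0 < t" for t
    proof -
      have "t \<in> geodesic_domain M (p, v)"
        using init t unfolding geodesic_domain_def by blast
      moreover have "curve_length M 0 t (max_geodesic M (p, v)) = t"
        by (rule curve_length_unit) (use t Iconn speedmax in auto)
      ultimately show ?thesis
        using t max_geodesic_eq[OF init t(1)] by (simp add: B_def)
    qed
    have B_le: "t \<le> s" if "t \<in> B" for t
      using Sup_upper[of "ereal t" "ereal ` B"] that SupB by simp
    have B_ex: "\<exists>t\<in>B. r < ereal t" if "r < ereal s" for r
      using that less_Sup_iff[of r "ereal ` B"] SupB by auto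
    \<comment> \<open>The supremum of the empty set in \<open>ereal\<close> is
      \<open>-\<infinity>\<close>, whereas the cut value is the real number \<open>s\<close>; so
      \<open>B\<close> is nonempty, and its elements are positive.\<close>
    obtain t0 where "t0 \<in> B" using B_ex[of "-\<infinity>"] by auto
    then have s: "0 < s" using B_le[of t0] by (auto simp: B_def)
    \<comment> \<open>Being realised at some \<open>t > r\<close> is inherited by \<open>r\<close>:
      the segment of \<open>\<gamma>\<close> up to \<open>r\<close> gives the value at least
      \<open>r\<close>, and a larger value could be prolonged along \<open>\<gamma>\<close> to
      exceed \<open>t\<close> at \<open>\<gamma> t\<close>. The lower bound also supplies the
      positivity that \<open>reverse_triangle\<close> asks for.\<close>
    have max: "time_separation_from M S (\<gamma> r) = ennreal r" if r: "0 < r" "r < s" for r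
    proof -
      obtain t where t: "t \<in> B" "r < t" using B_ex[of "ereal r"] r by auto
      then have ts: "t \<le> s" by (intro B_le)
      have rI: "r \<in> I" and tI: "t \<in> I"
        using Iconn[OF sI] r t ts by auto
      have lower: "ennreal r \<le> time_separation_from M S (\<gamma> r)"
      proof -
        have "smooth_causal (r - 0) (\<lambda>t. \<gamma> (t + 0)) (\<lambda>_. 1)"
          by (rule unit_geodesic_smooth_causal[OF geo _ r(1) unit fut]) (use Iconn[OF rI] in auto)
        from smooth_causal_fd[OF this] have "fd_causal_curve_from_to M 0 r \<gamma> p (\<gamma> r)"
          using 0 by simp
        moreover have "curve_length M 0 r \<gamma> = r"
          by (rule curve_length_unit) (use r Iconn[OF rI] speed\<gamma> in auto)
        ultimately have "ennreal r \<in> {ennreal (curve_length M a b \<gamma>') | a b \<gamma>'. fd_causal_curve_from_to M a b \<gamma>' p (\<gamma> r)}"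
          by force
        then have "ennreal r \<le> time_separation M p (\<gamma> r)"
          unfolding time_separation_def by (rule Sup_upper)
        also have "\<dots> \<le> time_separation_from M S (\<gamma> r)"
          unfolding time_separation_from_def using pS by (rule SUP_upper)
        finally show ?thesis .
      qed
      have "time_separation_from M S (\<gamma> r) + ennreal (t - r) \<le> ennreal t"
      proof -
        have "smooth_causal (t - r) (\<lambda>x. \<gamma> (x + r)) (\<lambda>_. 1)"
          by (rule unit_geodesic_smooth_causal[OF geo _ t(2) unit fut]) (use Iconn[OF tI] r in auto)
        moreover have "0 < time_separation_from M S (\<gamma> r)"
          using lower r(1) by (meson ennreal_less_zero_iff less_le_trans)
        ultimately have "time_separation_from M S (\<gamma> r) + ennreal (t - r) \<le> time_separation_from M S (\<gamma> t)"
          using reverse_triangle[of "t - r" "\<lambda>x. \<gamma> (x + r)" "\<lambda>_. 1" S "t - r"] t(2) by simp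
        also have "\<dots> = ennreal t"
          using B_iff[OF tI] t r by simp
        finally show ?thesis .
      qed
      then have "time_separation_from M S (\<gamma> r) \<le> ennreal r"
        using t(2) r(1) by (cases "time_separation_from M S (\<gamma> r)")
          (auto simp: top_unique ennreal_plus[symmetric] ennreal_le_iff simp del: ennreal_plus)
      with lower show ?thesis by (rule antisym[rotated])
    qed
    have nonmax: "time_separation_from M S (\<gamma> r) \<noteq> ennreal r" if "s < r" "r \<in> I" for r
      using B_iff[OF that(2)] B_le[of r] that s by auto
    have q\<gamma>: "q = \<gamma> s"
      using max_geodesic_eq[OF geodesic_rescale[OF init, of s], of 1] s sI
      by (simp add: q exp_map_def)
    then have cs: "c \<in> charts_at (atlas M) (\<gamma> s)"
      using qc cA by (simp add: charts_at_def)
    obtain e where e: "0 < e" "{s - e..s + e} \<subseteq> I" "\<gamma> ` {s - e..s + e} \<subseteq> chart_dom c"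
      by (rule geodesic_near_chart[OF geo sI cs])
    \<comment> \<open>\<open>s / 2\<close> keeps the interval within positive parameters, where
      \<open>max\<close> applies.\<close>
    define \<eta> where "\<eta> = min e (s / 2)"
    have \<eta>: "0 < \<eta>" "\<eta> < s" "\<eta> \<le> e" using e(1) s by (auto simp: \<eta>_def)
    have sub: "{s - \<eta><..<s + \<eta>} \<subseteq> {s - e..s + e}" using \<eta> by auto
    have near: "r \<in> I" "c \<in> charts_at (atlas M) (\<gamma> r)" if "r \<in> {s - \<eta><..<s + \<eta>}" for r
    proof -
      have "r \<in> {s - e..s + e}" using that sub by blast
      then show "r \<in> I" "c \<in> charts_at (atlas M) (\<gamma> r)"
        using e(2,3) cA by (auto simp: charts_at_def)
    qed
    have u: "chart_inv c (coord c \<gamma> r) = \<gamma> r" if "r \<in> {s - \<eta><..<s + \<eta>}" for r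
      using inv_map[OF charts_atD[OF near(2)[OF that]]] by simp
    show "x \<in> {y s |y v s \<eta>. 0 < \<eta> \<and> \<eta> < s \<and> geodesic_arc y v {s - \<eta><..<s + \<eta>} \<and>
      (\<forall>r\<in>{s - \<eta><..<s + \<eta>}. metric_in M c (y r) (v r) (v r) = -1 \<and> metric_in M c (y r) (coord_time c (y r)) (v r) < 0) \<and>
      (\<forall>r\<in>{s - \<eta><..<s}. time_separation_from M S (chart_inv c (y r)) = ennreal r) \<and>
      (\<forall>r\<in>{s<..<s + \<eta>}. time_separation_from M S (chart_inv c (y r)) \<noteq> ennreal r)}"
      unfolding mem_Collect_eq
    proof (rule exI[of _ "coord c \<gamma>"], rule exI[of _ "coord' c \<gamma>"], rule exI[of _ s], rule exI[of _ \<eta>],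
        intro conjI ballI)
      show "x = coord c \<gamma> s" by (simp add: x q\<gamma>)
      show "geodesic_arc (coord c \<gamma>) (coord' c \<gamma>) {s - \<eta><..<s + \<eta>}"
        by (rule geodesic_arc_subset[OF geodesic_arc_chart[OF geo cA e(2,3)] sub])
      fix r assume r: "r \<in> {s - \<eta><..<s + \<eta>}"
      show "metric_in M c (coord c \<gamma> r) (coord' c \<gamma> r) (coord' c \<gamma> r) = -1"
        using unit[OF near(1)[OF r]] metric_chart[OF near(2)[OF r]] geodesic_velocity[OF geo near(1)[OF r]] near(2)[OF r]
        by simp
      show "metric_in M c (coord c \<gamma> r) (coord_time c (coord c \<gamma> r)) (coord' c \<gamma> r) < 0"
        by (rule geodesic_future_pointing(2)[OF geo 0(1) near(1)[OF r]])
          (use v0 0 vv vf near(2)[OF r] in auto)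
    next
      fix r assume r: "r \<in> {s - \<eta><..<s}"
      show "time_separation_from M S (chart_inv c (coord c \<gamma> r)) = ennreal r"
        using u[of r] max[of r] r \<eta> by auto
    next
      fix r assume r: "r \<in> {s<..<s + \<eta>}"
      show "time_separation_from M S (chart_inv c (coord c \<gamma> r)) \<noteq> ennreal r"
        using u[of r] nonmax[of r] near(1)[of r] r \<eta> by auto
    qed (use \<eta> in auto)
  qed
qed

end

theorem proposition3p23:
  fixes M :: "('m::{t2_space, second_countable_topology}, 'e::euclidean_space) spacetime"
    and S :: "'m set"
  assumes "DIM('e) \<ge> 2"
    and "connected (UNIV :: 'm set)"
    and "smooth_structure (atlas M)"
    and "lorentzian_metric M"
    and "C11_metric M"
    and "time_oriented M"
    and "globally_hyperbolic M"
    and "smooth_hypersurface M S"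
    and "spacelike M S"
    and "acausal M S"
    and "future_causally_complete M S"
  shows "measure_zero M (future_cut_locus M S)"
proof -
  interpret spacetime_setting M
    by unfold_locales (fact assms)+
  show ?thesis by (rule measure_zero_future_cut_locus)
qed

end
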